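(* Let $\epsilon\in(0,1)$ and let $\nu:=|\mathcal{X}_1||\mathcal{X}_2|+\kappa+\tfrac32$. Define $\mathscr{R}_{\mathrm{in}}(n,\epsilon)$ as the set of rate pairs $(R_1,R_2)$ whose rate vector satisfies $$\mathbf{R}\in \mathbf{H}+\frac{1}{\sqrt n}\mathscr{S}(\mathbf{V},\epsilon)+\frac{\nu\log n}{n}\mathbf{1},$$ and $\mathscr{R}_{\mathrm{out}}(n,\epsilon)$ as the set of rate pairs $(R_1,R_2)$ whose rate vector satisfies $$\mathbf{R}\in \mathbf{H}+\frac{1}{\sqrt n}\mathscr{S}(\mathbf{V},\epsilon)-\frac{\log n}{n}\mathbf{1}.$$ Then for all $n$ sufficiently large, $$\mathscr{R}_{\mathrm{in}}(n,\epsilon)\subset \mathscr{R}^*_{\mathrm{SW}}(n,\epsilon)\subset\mathscr{R}_{\mathrm{out}}(n,\epsilon).$$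
   Context: Let $\mathcal{X}_1,\mathcal{X}_2$ be finite sets and $p_{X_1,X_2}$ a probability distribution on $\mathcal{X}_1\times\mathcal{X}_2$ with $p_{X_1,X_2}(x_1,x_2)>0$ for all $(x_1,x_2)$, and such that $X_1,X_2$ are not independent. The source is $(X_1^n,X_2^n)\sim\prod_{k=1}^n p_{X_1,X_2}(x_{1k},x_{2k})$. Logarithms are base 2. For $R\ge 0$, $[2^{nR}]:=\{1,\dots,\lceil 2^{nR}\rceil\}$. An $(n,2^{nR_1},2^{nR_2},\epsilon)$-SW code consists of encoders $f_j:\mathcal{X}_j^n\to[2^{nR_j}]$, $j=1,2$, and a decoder $\varphi:[2^{nR_1}]\times[2^{nR_2}]\to\mathcal{X}_1^n\times\mathcal{X}_2^n$ such that $\mathsf{P}(\varphi(f_1(X_1^n),f_2(X_2^n))\neq(X_1^n,X_2^n))\le\epsilon$. A pair $(R_1,R_2)$ is $(n,\epsilon)$-achievable if such a code exists; $\mathscr{R}^*_{\mathrm{SW}}(n,\epsilon)\subset\mathbb{R}^2$ is the set of all $(n,\epsilon)$-achievable pairs. The entropy density vector is $\mathbf{h}(X_1,X_2):=(-\log p_{X_1|X_2}(X_1|X_2),\,-\log p_{X_2|X_1}(X_2|X_1),\,-\log p_{X_1,X_2}(X_1,X_2))^T$; $\mathbf{H}:=\mathsf{E}[\mathbf{h}(X_1,X_2)]=(H(X_1|X_2),H(X_2|X_1),H(X_1,X_2))^T$ with entries $H_t$, and $\mathbf{V}:=\mathrm{Cov}(\mathbf{h}(X_1,X_2))$ (entropy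 dispersion matrix). $\kappa:=\max_{1\le t\le 3}\|\nabla^2 H_t(p_{X_1,X_2})\|_2$, the maximal spectral norm of the Hessians of $p_{X_1,X_2}\mapsto H_t(p_{X_1,X_2})$ viewed as functions of the vector $p_{X_1,X_2}\in\mathbb{R}^{|\mathcal{X}_1||\mathcal{X}_2|}$. The rate vector is $\mathbf{R}:=(R_1,R_2,R_1+R_2)^T$, and $\mathbf{1}$ is the all-ones vector. Vector inequalities are componentwise. For a positive semidefinite $\mathbf{V}\in\mathbb{R}^{3\times3}$ let $\mathbf{Z}\sim\mathcal{N}(\mathbf{0},\mathbf{V})$ (possibly degenerate) and $\mathscr{S}(\mathbf{V},\epsilon):=\{\mathbf{z}\in\mathbb{R}^3:\mathsf{P}(\mathbf{Z}\le\mathbf{z})\ge1-\epsilon\}$. Set sums $\mathbf{a}+c\mathscr{S}$ denote Minkowski translates/scalings. *)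

theory Defs
  imports "HOL-Probability.Probability"
begin

definition marg1 :: "('a::finite \<times> 'b::finite \<Rightarrow> real) \<Rightarrow> 'a \<Rightarrow> real" where
  "marg1 p x1 = (\<Sum>x2\<in>UNIV. p (x1, x2))"

definition marg2 :: "('a::finite \<times> 'b::finite \<Rightarrow> real) \<Rightarrow> 'b \<Rightarrow> real" where
  "marg2 p x2 = (\<Sum>x1\<in>UNIV. p (x1, x2))"

definition independent_pmf :: "('a::finite \<times> 'b::finite \<Rightarrow> real) \<Rightarrow> bool" where
  "independent_pmf p \<longleftrightarrow> (\<forall>x1 x2. p (x1, x2) = marg1 p x1 * marg2 p x2)"

definition ent_density :: "('a::finite \<times> 'b::finite \<Rightarrow> real) \<Rightarrow> 'a \<times> 'b \<Rightarrow> real^3" where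
  "ent_density p x = vector
     [ - log 2 (p x / marg2 p (snd x)),
       - log 2 (p x / marg1 p (fst x)),
       - log 2 (p x) ]"

definition ent_vec :: "('a::finite \<times> 'b::finite \<Rightarrow> real) \<Rightarrow> real^3" where
  "ent_vec p = (\<Sum>x\<in>UNIV. p x *\<^sub>R ent_density p x)"

definition disp_mat :: "('a::finite \<times> 'b::finite \<Rightarrow> real) \<Rightarrow> real^3^3" where
  "disp_mat p = (\<chi> i j. \<Sum>x\<in>UNIV. p x * (ent_density p x $ i - ent_vec p $ i)
                                      * (ent_density p x $ j - ent_vec p $ j))"

definition H_cond1 :: "('a::finite \<times> 'b::finite \<Rightarrow> real) \<Rightarrow> real" where
  "H_cond1 q = - (\<Sum>x\<in>UNIV. q x * log 2 (q x / marg2 q (snd x)))"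

definition H_cond2 :: "('a::finite \<times> 'b::finite \<Rightarrow> real) \<Rightarrow> real" where
  "H_cond2 q = - (\<Sum>x\<in>UNIV. q x * log 2 (q x / marg1 q (fst x)))"

definition H_joint :: "('a::finite \<times> 'b::finite \<Rightarrow> real) \<Rightarrow> real" where
  "H_joint q = - (\<Sum>x\<in>UNIV. q x * log 2 (q x))"

definition bump :: "('c \<Rightarrow> real) \<Rightarrow> 'c \<Rightarrow> real \<Rightarrow> 'c \<Rightarrow> real" where
  "bump q i t = q(i := q i + t)"

definition hessian :: "(('c::finite \<Rightarrow> real) \<Rightarrow> real) \<Rightarrow> ('c \<Rightarrow> real) \<Rightarrow> real^'c^'c" where
  "hessian f q = (\<chi> i j. deriv (\<lambda>s. deriv (\<lambda>t. f (bump (bump q j s) i t)) 0) 0)"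

definition spec_norm :: "real^'c::finite^'c \<Rightarrow> real" where
  "spec_norm M = onorm (\<lambda>v. M *v v)"

definition kappa :: "('a::finite \<times> 'b::finite \<Rightarrow> real) \<Rightarrow> real" where
  "kappa p = Max {spec_norm (hessian H_cond1 p), spec_norm (hessian H_cond2 p),
                  spec_norm (hessian H_joint p)}"

definition std_normal_measure :: "real measure" where
  "std_normal_measure = density lborel std_normal_density"

text \<open>Z ~ N(0,V) realised as Z = A W with W standard Gaussian on R^3 and A A^T = V
  (the law does not depend on the choice of A).\<close>
definition gauss_cdf :: "real^3^3 \<Rightarrow> real^3 \<Rightarrow> real" where
  "gauss_cdf V z =
    (let A = (SOME A :: real^3^3. A ** transpose A = V);
         M = PiM (UNIV :: 3 set) (\<lambda>_. std_normal_measure)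
     in measure M {w \<in> space M. \<forall>i. (A *v (\<chi> j. w j)) $ i \<le> z $ i})"

definition S_set :: "real^3^3 \<Rightarrow> real \<Rightarrow> (real^3) set" where
  "S_set V \<epsilon> = {z. gauss_cdf V z \<ge> 1 - \<epsilon>}"

definition seqs :: "nat \<Rightarrow> (nat \<Rightarrow> 'a) set" where
  "seqs n = PiE {..<n} (\<lambda>_. UNIV)"

definition msg_size :: "nat \<Rightarrow> real \<Rightarrow> nat" where
  "msg_size n R = nat \<lceil>2 powr (real n * R)\<rceil>"

definition sw_error :: "('a::finite \<times> 'b::finite \<Rightarrow> real) \<Rightarrow> nat \<Rightarrow>
    ((nat \<Rightarrow> 'a) \<Rightarrow> nat) \<Rightarrow> ((nat \<Rightarrow> 'b) \<Rightarrow> nat) \<Rightarrow>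
    (nat \<Rightarrow> nat \<Rightarrow> (nat \<Rightarrow> 'a) \<times> (nat \<Rightarrow> 'b)) \<Rightarrow> real" where
  "sw_error p n f1 f2 \<phi> =
     (\<Sum>x1\<in>seqs n. \<Sum>x2\<in>seqs n. (\<Prod>k<n. p (x1 k, x2 k)) *
        (if \<phi> (f1 x1) (f2 x2) \<noteq> (x1, x2) then 1 else 0))"

definition sw_achievable :: "('a::finite \<times> 'b::finite \<Rightarrow> real) \<Rightarrow> nat \<Rightarrow> real \<Rightarrow> real \<Rightarrow> real \<Rightarrow> bool" where
  "sw_achievable p n \<epsilon> R1 R2 \<longleftrightarrow> R1 \<ge> 0 \<and> R2 \<ge> 0 \<and>
     (\<exists>(f1 :: (nat \<Rightarrow> 'a) \<Rightarrow> nat) (f2 :: (nat \<Rightarrow> 'b) \<Rightarrow> nat) \<phi>.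
        (\<forall>x\<in>seqs n. f1 x \<in> {1..msg_size n R1}) \<and>
        (\<forall>x\<in>seqs n. f2 x \<in> {1..msg_size n R2}) \<and>
        (\<forall>m1 m2. \<phi> m1 m2 \<in> seqs n \<times> seqs n) \<and>
        sw_error p n f1 f2 \<phi> \<le> \<epsilon>)"

definition SW_region :: "('a::finite \<times> 'b::finite \<Rightarrow> real) \<Rightarrow> nat \<Rightarrow> real \<Rightarrow> (real \<times> real) set" where
  "SW_region p n \<epsilon> = {(R1, R2). sw_achievable p n \<epsilon> R1 R2}"

definition rate_vec :: "real \<Rightarrow> real \<Rightarrow> real^3" where
  "rate_vec R1 R2 = vector [R1, R2, R1 + R2]"

definition nu :: "('a::finite \<times> 'b::finite \<Rightarrow> real) \<Rightarrow> real" where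
  "nu p = real (CARD('a) * CARD('b)) + kappa p + 3/2"

definition R_in :: "('a::finite \<times> 'b::finite \<Rightarrow> real) \<Rightarrow> nat \<Rightarrow> real \<Rightarrow> (real \<times> real) set" where
  "R_in p n \<epsilon> = {(R1, R2). \<exists>z\<in>S_set (disp_mat p) \<epsilon>.
      rate_vec R1 R2 = ent_vec p + (1 / sqrt (real n)) *\<^sub>R z
                       + (nu p * log 2 (real n) / real n) *\<^sub>R vec 1}"

definition R_out :: "('a::finite \<times> 'b::finite \<Rightarrow> real) \<Rightarrow> nat \<Rightarrow> real \<Rightarrow> (real \<times> real) set" where
  "R_out p n \<epsilon> = {(R1, R2). \<exists>z\<in>S_set (disp_mat p) \<epsilon>.
      rate_vec R1 R2 = ent_vec p + (1 / sqrt (real n)) *\<^sub>R z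
                       - (log 2 (real n) / real n) *\<^sub>R vec 1}"

end

theory Submission
  imports Defs
begin

text \<open>
  Both inclusions reduce to comparing the distribution of the centred sum of the entropy density
  vectors, evaluated on orthants, with its Gaussian limit up to an error \<open>O(1/\<surd>n)\<close>: random binning with
  a threshold decoder, and the Miyake--Kanaya converse, both with slack \<open>\<gamma> = (log n)/2\<close>, cost only
  \<open>3/\<surd>n\<close> in probability and \<open>O(log n)\<close> in the thresholds.

  The Berry--Esseen bound for orthants is proved by a Lindeberg replacement. Let \<open>T\<close> average a function
  over one step of the walk and let \<open>G\<^sub>t\<close> be convolution with the centred Gaussian of covariance \<open>t V\<close>.
  Writing \<open>V = A A\<^sup>T\<close> and lifting the step through \<open>A\<close> (with extra noise in the kernel of \<open>A\<close>, so that
  singular \<open>V\<close> is allowed) to a vector with identity covariance, a second order expansion of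
  the Cameron--Martin density \<open>exp (s \<bullet> w - |s|\<^sup>2/2)\<close> shows \<open>|T G\<^sub>j f - G\<^bsub>j+1\<^esub> f| \<le> C j\<^bsup>-3/2\<^esup> sup |f|\<close>.
  In the telescoping sum for \<open>T\<^sup>n G\<^sub>M f - G\<^bsub>n+M\<^esub> f\<close> each term is split by \<open>T\<^sup>k f = (T\<^sup>k f - G\<^sub>k f) + G\<^sub>k f\<close>:
  the first part is controlled by induction on \<open>n\<close>, the second by the semigroup property of \<open>G\<close>. The
  smoothing \<open>G\<^sub>M\<close> is then removed because every coordinate of the Gaussian limit has a bounded density.
  This last point uses that \<open>X\<^sub>1\<close>, \<open>X\<^sub>2\<close> are dependent, which forces \<open>V\<^sub>i\<^sub>i > 0\<close>.

  Finally a shift of the threshold by \<open>\<delta>\<close> in every coordinate raises the Gaussian probability by at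
  least \<open>c \<delta>\<close> while it stays away from \<open>0\<close> and \<open>1\<close>, so the remaining \<open>(log n)/\<surd>n\<close> of slack
  absorbs every \<open>O(1/\<surd>n)\<close> error.
\<close>

section \<open>Standard Gaussian vectors\<close>

text \<open>The rate 1/\<surd>n must hold for indicators, where a Lindeberg argument with smooth
  test functions would lose powers of n. All smoothness is therefore taken from the Gaussian factor,
  and the expansion applies to every bounded Borel function. The price is the factor j to the power
  -3/2, whose sum from M on is of order 1/\<surd>M. The induction thus reproduces its own constant B
  with a factor of order C/\<surd>M, and it closes once a fixed M, chosen from C alone, makes that
  factor at most 1/2. Two properties of orthants carry the argument: translates of orthants are
  orthants, which turns a bound at the origin into a bound at every starting point, as the induction
  requires; and orthant probabilities are monotone in the threshold, which allows the smoothing to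
  be removed. The lift exists because increments with a singular covariance lie in the range of A,
  while the expansion needs identity covariance to match second moments exactly. The coding part is
  finite counting, valid for each fixed n.\<close>

abbreviation N1 :: "real measure" where "N1 \<equiv> std_normal_measure"

lemma prob_space_std_normal_measure: "prob_space N1"
  unfolding std_normal_measure_def by (rule prob_space_normal_density) simp

interpretation N1: prob_space N1
  by (rule prob_space_std_normal_measure)

lemma sets_std_normal_measure [simp, measurable_cong]: "sets N1 = sets borel"
  by (simp add: std_normal_measure_def)

lemma space_std_normal_measure [simp]: "space N1 = UNIV"
  by (simp add: std_normal_measure_def)

lemma borel_measurable_vec_lambda [measurable (raw)]:
  fixes f :: "'a \<Rightarrow> 'n::finite \<Rightarrow> real"
  assumes "\<And>i. (\<lambda>x. f x i) \<in> borel_measurable M"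
  shows "(\<lambda>x. \<chi> i. f x i) \<in> borel_measurable M"
  by (subst borel_measurable_euclidean_space)
     (auto simp: Basis_vec_def inner_axis assms)

lemma borel_measurable_vec_nth [measurable (raw)]:
  fixes f :: "'a \<Rightarrow> real^'n::finite"
  assumes "f \<in> borel_measurable M"
  shows "(\<lambda>x. f x $ i) \<in> borel_measurable M"
proof -
  have "(\<lambda>v::real^'n. v $ i) \<in> borel_measurable borel"
    by (intro borel_measurable_continuous_onI continuous_intros)
  from measurable_compose[OF assms this] show ?thesis .
qed

lemma Collect_in_borel: "Measurable.pred borel P \<Longrightarrow> {x. P x} \<in> sets borel"
  by (simp add: pred_def)

text \<open>Translating Lebesgue measure and completing the square: the one-dimensional
  Cameron-Martin formula. Nonnegative integrals avoid integrability side conditions.\<close>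

lemma nn_integral_std_normal_shift:
  assumes [measurable]: "f \<in> borel_measurable borel"
  shows "(\<integral>\<^sup>+x. f (x + s) \<partial>N1)
       = (\<integral>\<^sup>+x. f x * ennreal (exp (s * x - s\<^sup>2 / 2)) \<partial>N1)"
proof -
  have dens: "std_normal_density (- s + x) = std_normal_density x * exp (s * x - s\<^sup>2 / 2)" for x
    by (auto simp: std_normal_density_def power2_eq_square algebra_simps diff_divide_distrib
        add_divide_distrib simp flip: exp_add)
  have "(\<integral>\<^sup>+x. f (x + s) \<partial>N1)
      = (\<integral>\<^sup>+x. ennreal (std_normal_density x) * f (x + s) \<partial>lborel)"
    by (simp add: std_normal_measure_def nn_integral_density)
  also have "\<dots> = (\<integral>\<^sup>+x. ennreal (std_normal_density (- s + x)) * f x \<partial>lborel)"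
    by (subst nn_integral_real_affine[where c=1 and t="-s"]) auto
  also have "\<dots> = (\<integral>\<^sup>+x. ennreal (std_normal_density x) * (f x * ennreal (exp (s * x - s\<^sup>2 / 2))) \<partial>lborel)"
    unfolding dens by (simp add: ennreal_mult' ac_simps)
  also have "\<dots> = (\<integral>\<^sup>+x. f x * ennreal (exp (s * x - s\<^sup>2 / 2)) \<partial>N1)"
    by (simp add: std_normal_measure_def nn_integral_density)
  finally show ?thesis .
qed

text \<open>Turns a dilated standard normal variable into an integral against
  \<open>normal_density 0 a\<close>, the form in which normal densities can be convolved.\<close>

lemma nn_integral_std_normal_scale:
  assumes [measurable]: "f \<in> borel_measurable borel" and a: "a > 0"
  shows "(\<integral>\<^sup>+x. f (a * x) \<partial>N1)
       = (\<integral>\<^sup>+x. ennreal (normal_density 0 a x) * f x \<partial>lborel)"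
proof -
  have dens: "a * normal_density 0 a (a * x) = std_normal_density x" for x
    using a by (simp add: normal_density_def real_sqrt_mult field_simps)
  have "(\<integral>\<^sup>+x. ennreal (normal_density 0 a x) * f x \<partial>lborel)
      = (\<integral>\<^sup>+x. ennreal a * (ennreal (normal_density 0 a (a * x)) * f (a * x)) \<partial>lborel)"
    using a by (subst nn_integral_real_affine[where c=a and t=0]) (auto simp: nn_integral_cmult)
  also have "\<dots> = (\<integral>\<^sup>+x. ennreal (std_normal_density x) * f (a * x) \<partial>lborel)"
    using a by (simp add: dens mult.assoc[symmetric] flip: ennreal_mult')
  finally show ?thesis
    by (simp add: std_normal_measure_def nn_integral_density)
qed

lemma nn_integral_std_normal_convolution:
  assumes [measurable]: "f \<in> borel_measurable borel" and a: "a > 0" and b: "b > 0"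
  shows "(\<integral>\<^sup>+x. \<integral>\<^sup>+y. f (a * x + b * y) \<partial>N1 \<partial>N1)
       = (\<integral>\<^sup>+x. f (sqrt (a\<^sup>2 + b\<^sup>2) * x) \<partial>N1)"
proof -
  have conv: "(\<integral>\<^sup>+x. ennreal (normal_density 0 a x) * ennreal (normal_density 0 b (u - x)) \<partial>lborel)
     = ennreal (normal_density 0 (sqrt (a\<^sup>2 + b\<^sup>2)) u)" for u
    using fun_cong[OF conv_normal_density_zero_mean[OF b a], of u]
    by (simp add: ennreal_mult' ac_simps)
  have trans: "(\<integral>\<^sup>+y. ennreal (normal_density 0 b y) * f (x + y) \<partial>lborel) = (\<integral>\<^sup>+u. ennreal (normal_density 0 b (u - x)) * f u \<partial>lborel)" for x
    by (subst nn_integral_real_affine[where c=1 and t="-x"]) auto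
  have pos: "sqrt (a\<^sup>2 + b\<^sup>2) > 0" using a b by (simp add: sum_power2_gt_zero_iff)
  have "(\<integral>\<^sup>+x. \<integral>\<^sup>+y. f (a * x + b * y) \<partial>N1 \<partial>N1)
      = (\<integral>\<^sup>+x. \<integral>\<^sup>+y. ennreal (normal_density 0 b y) * f (a * x + y) \<partial>lborel \<partial>N1)"
  proof (intro nn_integral_cong)
    fix x show "(\<integral>\<^sup>+y. f (a * x + b * y) \<partial>N1) = (\<integral>\<^sup>+y. ennreal (normal_density 0 b y) * f (a * x + y) \<partial>lborel)"
      by (rule nn_integral_std_normal_scale[OF _ b]) measurable
  qed
  also have "\<dots> = (\<integral>\<^sup>+x. ennreal (normal_density 0 a x) *
          (\<integral>\<^sup>+y. ennreal (normal_density 0 b y) * f (x + y) \<partial>lborel) \<partial>lborel)"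
    by (subst nn_integral_std_normal_scale[where a=a, symmetric]) (auto simp: a)
  also have "\<dots> = (\<integral>\<^sup>+x. ennreal (normal_density 0 a x) *
          (\<integral>\<^sup>+u. ennreal (normal_density 0 b (u - x)) * f u \<partial>lborel) \<partial>lborel)"
    by (simp only: trans)
  also have "\<dots> = (\<integral>\<^sup>+x. \<integral>\<^sup>+u. ennreal (normal_density 0 a x) * ennreal (normal_density 0 b (u - x)) * f u \<partial>lborel \<partial>lborel)"
    by (simp add: nn_integral_cmult mult.assoc)
  also have "\<dots> = (\<integral>\<^sup>+u. \<integral>\<^sup>+x. ennreal (normal_density 0 a x) * ennreal (normal_density 0 b (u - x)) * f u \<partial>lborel \<partial>lborel)"
    by (subst lborel_pair.Fubini') auto
  also have "\<dots> = (\<integral>\<^sup>+u. ennreal (normal_density 0 (sqrt (a\<^sup>2 + b\<^sup>2)) u) * f u \<partial>lborel)"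
    by (simp add: nn_integral_multc conv)
  also have "\<dots> = (\<integral>\<^sup>+x. f (sqrt (a\<^sup>2 + b\<^sup>2) * x) \<partial>N1)"
    by (rule nn_integral_std_normal_scale[OF _ pos, symmetric]) auto
  finally show ?thesis .
qed

text \<open>The product measure is moved from functions to vectors so that inner products and
  matrices act on it. It is the same product that occurs in \<open>gauss_cdf\<close>.\<close>

definition std_gauss :: "(real^'n::finite) measure" where
  "std_gauss = distr (PiM UNIV (\<lambda>_. N1)) borel (\<lambda>w. \<chi> i. w i)"

lemma sets_std_gauss [simp, measurable_cong]: "sets std_gauss = sets borel"
  by (simp add: std_gauss_def)

lemma space_std_gauss [simp]: "space std_gauss = UNIV"
  by (simp add: std_gauss_def)

interpretation N1_prod: product_prob_space "\<lambda>_. N1" UNIV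
  by (unfold_locales)

lemma measurable_vec_lambda_PiM [measurable]:
  "(\<lambda>w. \<chi> i. w i) \<in> borel_measurable (PiM (UNIV::'n::finite set) (\<lambda>_. N1))"
  by (rule borel_measurable_vec_lambda) measurable

interpretation gauss: prob_space "std_gauss :: (real^'n::finite) measure"
  unfolding std_gauss_def by (rule N1_prod.P.prob_space_distr) measurable

text \<open>Products of Borel sets determine a product measure. Shift, sum and resampling are
  thereby reduced to one-dimensional identities, one per coordinate.\<close>

lemma std_gauss_eqI:
  fixes N :: "(real^'n::finite) measure"
  assumes sN: "sets N = sets borel"
    and box: "\<And>E. (\<And>i. E i \<in> sets borel) \<Longrightarrow>
       emeasure N {v. \<forall>i. v $ i \<in> E i} = (\<Prod>i\<in>UNIV. emeasure N1 (E i))"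
  shows "N = std_gauss"
proof -
  have [measurable_cong]: "sets N = sets borel" by fact
  have spN: "space N = UNIV" using sets_eq_imp_space_eq[OF sN] by simp
  let ?P = "distr N (PiM UNIV (\<lambda>_. N1)) (\<lambda>v i. v $ i)"
  have m: "(\<lambda>v i. v $ i) \<in> measurable N (PiM (UNIV::'n set) (\<lambda>_. N1))"
    by (rule measurable_PiM_single') auto
  have "?P = PiM UNIV (\<lambda>_. N1)"
  proof (rule N1_prod.PiM_eqI)
    fix A :: "'n \<Rightarrow> real set" assume A: "\<And>i. i \<in> UNIV \<Longrightarrow> A i \<in> sets N1"
    have "emeasure ?P (PiE UNIV A) = emeasure N ((\<lambda>v i. v $ i) -` PiE UNIV A \<inter> space N)"
      by (rule emeasure_distr[OF m]) (use A in \<open>auto intro!: sets_PiM_I_finite\<close>)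
    also have "(\<lambda>v i. v $ i) -` PiE UNIV A \<inter> space N = {v. \<forall>i. v $ i \<in> A i}"
      by (auto simp: spN)
    also have "emeasure N \<dots> = (\<Prod>i\<in>UNIV. emeasure N1 (A i))"
      by (rule box) (use A in auto)
    finally show "emeasure ?P (PiE UNIV A) = (\<Prod>i\<in>UNIV. emeasure N1 (A i))" .
  qed auto
  then have "std_gauss = distr ?P borel (\<lambda>w. \<chi> i. w i)"
    by (simp add: std_gauss_def)
  also have "\<dots> = distr N borel ((\<lambda>w. \<chi> i. w i) \<circ> (\<lambda>v i. v $ i))"
    by (rule distr_distr[OF _ m]) measurable
  also have "\<dots> = N"
    using distr_id2[OF sN[symmetric]] by (simp add: comp_def)
  finally show ?thesis ..
qed

lemma nn_integral_std_gauss_prod: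
  fixes f :: "'n::finite \<Rightarrow> real \<Rightarrow> ennreal"
  assumes [measurable]: "\<And>i. f i \<in> borel_measurable borel"
  shows "(\<integral>\<^sup>+w. (\<Prod>i\<in>UNIV. f i (w $ i)) \<partial>std_gauss) = (\<Prod>i\<in>UNIV. \<integral>\<^sup>+x. f i x \<partial>N1)"
  unfolding std_gauss_def
  by (subst nn_integral_distr) (auto simp: N1_prod.product_nn_integral_prod)

lemma integral_std_gauss_prod:
  fixes f :: "'n::finite \<Rightarrow> real \<Rightarrow> real"
  assumes "\<And>i. integrable N1 (f i)"
  shows "(\<integral>w. (\<Prod>i\<in>UNIV. f i (w $ i)) \<partial>std_gauss) = (\<Prod>i\<in>UNIV. \<integral>x. f i x \<partial>N1)"
    and "integrable std_gauss (\<lambda>w. (\<Prod>i\<in>UNIV. f i (w $ i)))"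
proof -
  have [measurable]: "f i \<in> borel_measurable borel" for i
    using borel_measurable_integrable[OF assms, of i] by simp
  show "(\<integral>w. (\<Prod>i\<in>UNIV. f i (w $ i)) \<partial>std_gauss) = (\<Prod>i\<in>UNIV. \<integral>x. f i x \<partial>N1)"
    unfolding std_gauss_def
    by (subst integral_distr) (auto simp: N1_prod.product_integral_prod assms)
  show "integrable std_gauss (\<lambda>w. (\<Prod>i\<in>UNIV. f i (w $ i)))"
    unfolding std_gauss_def
    by (subst integrable_distr_eq) (auto simp: N1_prod.product_integrable_prod assms)
qed

lemma indicator_box:
  "indicator {v::real^'n::finite. \<forall>i. v $ i \<in> E i} w = (\<Prod>i\<in>UNIV. indicator (E i) (w $ i) :: ennreal)"
proof (cases "\<forall>i. w $ i \<in> E i")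
  case False
  then obtain i where "w $ i \<notin> E i" by auto
  then have "(\<Prod>i\<in>UNIV. indicator (E i) (w $ i) :: ennreal) = 0"
    by (intro prod_zero) (auto intro!: exI[of _ i])
  with False show ?thesis by simp
qed simp

lemma box_in_borel [measurable]:
  assumes [measurable]: "\<And>i. E i \<in> sets borel"
  shows "{v::real^'n::finite. \<forall>i. v $ i \<in> E i} \<in> sets borel" by (rule Collect_in_borel) measurable

text \<open>Checked in reverse: the weighted measure, moved back by \<open>s\<close>, is standard,
  because the exponential factors over the coordinates and each factor is the one-dimensional shift
  formula.\<close>

lemma std_gauss_shift:
  fixes s :: "real^'n::finite"
  shows "distr std_gauss borel (\<lambda>w. w + s) = density std_gauss (\<lambda>w. ennreal (exp (s \<bullet> w - (s \<bullet> s) / 2)))"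
proof -
  let ?D = "density std_gauss (\<lambda>w. ennreal (exp (s \<bullet> w - (s \<bullet> s) / 2)))"
  have "distr ?D borel (\<lambda>w. w - s) = std_gauss"
  proof (rule std_gauss_eqI)
    fix E :: "'n \<Rightarrow> real set" assume E[measurable]: "\<And>i. E i \<in> sets borel"
    let ?B = "{v::real^'n. \<forall>i. v $ i \<in> E i}"
    have [measurable]: "?B \<in> sets borel" by (rule box_in_borel[OF E])
    have expand: "ennreal (exp (s \<bullet> w - (s \<bullet> s) / 2)) = (\<Prod>i\<in>UNIV. ennreal (exp (s $ i * w $ i - (s $ i)\<^sup>2 / 2)))" for w
      by (subst prod_ennreal)
         (auto simp: inner_vec_def exp_sum[symmetric] sum_subtractf sum_divide_distrib power2_eq_square)
    have "emeasure (distr ?D borel (\<lambda>w. w - s)) ?B = (\<integral>\<^sup>+w. indicator ?B w \<partial>distr ?D borel (\<lambda>w. w - s))"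
      by simp
    also have "\<dots> = (\<integral>\<^sup>+w. ennreal (exp (s \<bullet> w - (s \<bullet> s) / 2)) * indicator ?B (w - s) \<partial>std_gauss)"
      by (subst nn_integral_distr) (auto simp: nn_integral_density)
    also have "\<dots> = (\<integral>\<^sup>+w. (\<Prod>i\<in>UNIV. indicator (E i) (w $ i - s $ i) * ennreal (exp (s $ i * w $ i - (s $ i)\<^sup>2 / 2))) \<partial>std_gauss)"
      by (simp add: expand indicator_box prod.distrib mult.commute)
    also have "\<dots> = (\<Prod>i\<in>UNIV. \<integral>\<^sup>+x. indicator (E i) (x - s $ i) * ennreal (exp (s $ i * x - (s $ i)\<^sup>2 / 2)) \<partial>N1)"
      by (subst nn_integral_std_gauss_prod[symmetric]) auto
    also have "\<dots> = (\<Prod>i\<in>UNIV. \<integral>\<^sup>+x. indicator (E i) x \<partial>N1)"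
      by (subst nn_integral_std_normal_shift[symmetric]) auto
    finally show "emeasure (distr ?D borel (\<lambda>w. w - s)) ?B = (\<Prod>i\<in>UNIV. emeasure N1 (E i))"
      by simp
  qed simp
  then have "distr std_gauss borel (\<lambda>w. w + s) = distr (distr ?D borel (\<lambda>w. w - s)) borel (\<lambda>w. w + s)"
    by simp
  also have "\<dots> = distr ?D borel ((\<lambda>w. w + s) \<circ> (\<lambda>w. w - s))"
    by (rule distr_distr) auto
  also have "\<dots> = ?D"
    by (simp add: comp_def distr_id2)
  finally show ?thesis .
qed

text \<open>Dividing by the total scale makes the sum standard, which can be tested on boxes by
  one-dimensional convolution; multiplying back gives the claim.\<close>

lemma std_gauss_convolution:
  assumes a: "a > 0" and b: "b > 0"
  shows "distr (std_gauss \<Otimes>\<^sub>M std_gauss) borel (\<lambda>(v, w). a *\<^sub>R v + b *\<^sub>R w)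
       = distr (std_gauss :: (real^'n::finite) measure) borel (\<lambda>w. sqrt (a\<^sup>2 + b\<^sup>2) *\<^sub>R w)" (is "_ = ?R")
proof -
  let ?c = "sqrt (a\<^sup>2 + b\<^sup>2)"
  interpret pair_prob_space "std_gauss :: (real^'n) measure" "std_gauss :: (real^'n) measure" ..
  have c: "?c > 0" using a b by (simp add: sum_power2_gt_zero_iff)
  have "distr (std_gauss \<Otimes>\<^sub>M std_gauss) borel (\<lambda>(v, w). (1 / ?c) *\<^sub>R (a *\<^sub>R v + b *\<^sub>R w)) = (std_gauss :: (real^'n) measure)"
    (is "?D = _")
  proof (rule std_gauss_eqI)
    fix E :: "'n \<Rightarrow> real set" assume E[measurable]: "\<And>i. E i \<in> sets borel"
    let ?B = "{v::real^'n. \<forall>i. v $ i \<in> E i}"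
    have [measurable]: "?B \<in> sets borel" by (rule box_in_borel[OF E])
    have "emeasure ?D ?B = (\<integral>\<^sup>+w. indicator ?B w \<partial>?D)" by simp
    also have "\<dots> = (\<integral>\<^sup>+v. \<integral>\<^sup>+w. indicator ?B ((1 / ?c) *\<^sub>R (a *\<^sub>R v + b *\<^sub>R w)) \<partial>std_gauss \<partial>std_gauss)"
      by (subst nn_integral_distr)
         (auto simp: split_beta' gauss.nn_integral_fst[symmetric] simp del: scaleR_conv_of_real)
    also have "\<dots> = (\<integral>\<^sup>+v. (\<Prod>i\<in>UNIV. \<integral>\<^sup>+y. indicator (E i) ((1 / ?c) * (a * v $ i + b * y)) \<partial>N1) \<partial>std_gauss)"
      unfolding indicator_box
      by (intro nn_integral_cong, subst nn_integral_std_gauss_prod[symmetric]) auto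
    also have "\<dots> = (\<Prod>i\<in>UNIV. \<integral>\<^sup>+x. \<integral>\<^sup>+y. indicator (E i) ((1 / ?c) * (a * x + b * y)) \<partial>N1 \<partial>N1)"
      by (subst nn_integral_std_gauss_prod[symmetric]) auto
    also have "\<dots> = (\<Prod>i\<in>UNIV. \<integral>\<^sup>+x. indicator (E i) ((1 / ?c) * (?c * x)) \<partial>N1)"
      by (intro prod.cong refl nn_integral_std_normal_convolution[where f="\<lambda>u. indicator (E _) ((1 / ?c) * u)"] a b) measurable
    also have "\<dots> = (\<Prod>i\<in>UNIV. emeasure N1 (E i))"
      using a b by simp
    finally show "emeasure ?D ?B = (\<Prod>i\<in>UNIV. emeasure N1 (E i))" .
  qed simp
  then have "?R = distr ?D borel (\<lambda>w. ?c *\<^sub>R w)" by simp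
  also have "\<dots> = distr (std_gauss \<Otimes>\<^sub>M std_gauss) borel ((\<lambda>w. ?c *\<^sub>R w) \<circ> (\<lambda>(v, w). (1 / ?c) *\<^sub>R (a *\<^sub>R v + b *\<^sub>R w)))"
    by (rule distr_distr) auto
  also have "(\<lambda>w::real^'n. ?c *\<^sub>R w) \<circ> (\<lambda>(v, w). (1 / ?c) *\<^sub>R (a *\<^sub>R v + b *\<^sub>R w)) = (\<lambda>(v, w). a *\<^sub>R v + b *\<^sub>R w)"
    using c by auto
  finally show ?thesis ..
qed

text \<open>Coordinates are independent, so a fresh copy of one of them leaves the law unchanged.
  This is the tool for conditioning on the other coordinates, on which both the upper and the lower
  estimates for orthants rest.\<close>

lemma std_gauss_resample:
  fixes j :: "'n::finite"
  shows "distr (std_gauss \<Otimes>\<^sub>M N1) borel (\<lambda>(w, t). \<chi> i. if i = j then t else w $ i) = std_gauss" (is "?D = _")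
proof (rule std_gauss_eqI)
  interpret pair_prob_space "std_gauss :: (real^'n) measure" N1 ..
  fix E :: "'n \<Rightarrow> real set" assume E[measurable]: "\<And>i. E i \<in> sets borel"
  let ?B = "{v::real^'n. \<forall>i. v $ i \<in> E i}"
  have [measurable]: "?B \<in> sets borel" by (rule box_in_borel[OF E])
  have m[measurable]: "(\<lambda>(w, t). \<chi> i. if i = j then t else w $ i) \<in> borel_measurable (std_gauss \<Otimes>\<^sub>M N1)"
    unfolding case_prod_beta' by (rule borel_measurable_vec_lambda) measurable
  have "emeasure ?D ?B = (\<integral>\<^sup>+w. indicator ?B w \<partial>?D)" by simp
  also have "\<dots> = (\<integral>\<^sup>+z. indicator ?B (case z of (w, t) \<Rightarrow> \<chi> i. if i = j then t else w $ i) \<partial>(std_gauss \<Otimes>\<^sub>M N1))"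
    by (subst nn_integral_distr) (auto)
  also have "\<dots> = (\<integral>\<^sup>+w. \<integral>\<^sup>+t. indicator ?B (\<chi> i. if i = j then t else w $ i) \<partial>N1 \<partial>std_gauss)"
    by (subst N1.nn_integral_fst[symmetric]) auto
  also have "\<dots> = (\<integral>\<^sup>+w. \<integral>\<^sup>+t. indicator (E j) t * (\<Prod>i\<in>UNIV-{j}. indicator (E i) (w $ i)) \<partial>N1 \<partial>std_gauss)"
    unfolding indicator_box by (intro nn_integral_cong) (subst prod.remove[of _ j], auto)
  also have "\<dots> = (\<integral>\<^sup>+w. emeasure N1 (E j) * (\<Prod>i\<in>UNIV-{j}. indicator (E i) (w $ i)) \<partial>std_gauss)"
    by (simp add: nn_integral_multc)
  also have "\<dots> = (\<integral>\<^sup>+w. (\<Prod>i\<in>UNIV. if i = j then emeasure N1 (E j) else indicator (E i) (w $ i)) \<partial>std_gauss)"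
    by (intro nn_integral_cong) (subst (2) prod.remove[of _ j], auto)
  also have "\<dots> = (\<Prod>i\<in>UNIV. \<integral>\<^sup>+x. (if i = j then emeasure N1 (E j) else indicator (E i) x) \<partial>N1)"
    by (rule nn_integral_std_gauss_prod) measurable
  also have "\<dots> = (\<Prod>i\<in>UNIV. emeasure N1 (E i))"
  proof (rule prod.cong)
    fix i show "(\<integral>\<^sup>+x. (if i = j then emeasure N1 (E j) else indicator (E i) x) \<partial>N1) = emeasure N1 (E i)"
      using N1.emeasure_space_1 by (cases "i = j") auto
  qed simp
  finally show "emeasure ?D ?B = (\<Prod>i\<in>UNIV. emeasure N1 (E i))" .
qed simp

section \<open>Exponential integrability and moments of the standard Gaussian vector\<close>

lemma integrable_std_normal_exp: "integrable N1 (\<lambda>x. exp (c * x))"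
proof -
  have "(\<integral>\<^sup>+x. ennreal (exp (c * x - c\<^sup>2 / 2)) \<partial>N1) = 1"
    using nn_integral_std_normal_shift[of "\<lambda>_. 1" c] N1.emeasure_space_1 by simp
  then have "integrable N1 (\<lambda>x. exp (c * x - c\<^sup>2 / 2))"
    by (intro integrableI_nonneg) auto
  then have "integrable N1 (\<lambda>x. exp (c\<^sup>2 / 2) * exp (c * x - c\<^sup>2 / 2))"
    by (rule integrable_mult_right)
  then show ?thesis by (simp flip: exp_add)
qed

lemma integrable_std_normal_exp_abs: "integrable N1 (\<lambda>x. exp (c * \<bar>x\<bar>))"
proof (rule Bochner_Integration.integrable_bound)
  show "integrable N1 (\<lambda>x. exp (c * x) + exp (- c * x))"
    by (intro Bochner_Integration.integrable_add integrable_std_normal_exp)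
  show "AE x in N1. norm (exp (c * \<bar>x\<bar>)) \<le> norm (exp (c * x) + exp (- c * x))"
  proof (rule AE_I2)
    fix x
    have "exp (c * \<bar>x\<bar>) \<le> exp (c * x) + exp (- c * x)" by (cases "x \<ge> 0") auto
    moreover have "0 \<le> exp (c * x) + exp (- c * x)" by (intro add_nonneg_nonneg) auto
    ultimately show "norm (exp (c * \<bar>x\<bar>)) \<le> norm (exp (c * x) + exp (- c * x))" by simp
  qed
qed measurable

text \<open>The Euclidean norm is at most the sum of the absolute coordinates, so a product of
  one-dimensional exponentials dominates.\<close>

lemma integrable_std_gauss_exp_norm:
  assumes "c \<ge> 0"
  shows "integrable (std_gauss :: (real^'n::finite) measure) (\<lambda>w. exp (c * norm w))"
proof (rule Bochner_Integration.integrable_bound)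
  show "integrable (std_gauss :: (real^'n) measure) (\<lambda>w. \<Prod>i\<in>UNIV. exp (c * \<bar>w $ i\<bar>))"
    by (rule integral_std_gauss_prod(2)) (rule integrable_std_normal_exp_abs)
  show "AE w in std_gauss. norm (exp (c * norm w)) \<le> norm (\<Prod>i\<in>UNIV. exp (c * \<bar>(w::real^'n) $ i\<bar>))"
  proof (rule AE_I2)
    fix w :: "real^'n"
    have "c * norm w \<le> c * (\<Sum>i\<in>UNIV. \<bar>w $ i\<bar>)"
      by (intro mult_left_mono norm_le_l1_cart assms)
    then show "norm (exp (c * norm w)) \<le> norm (\<Prod>i\<in>UNIV. exp (c * \<bar>w $ i\<bar>))"
      by (simp add: exp_sum[symmetric] sum_distrib_left prod_nonneg)
  qed
qed measurable

lemma power_le_fact_exp: "0 \<le> x \<Longrightarrow> x ^ k \<le> fact k * exp (x::real)"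
proof (induction k arbitrary: x)
  case (Suc k)
  show ?case
  proof (cases "x = 0")
    case False
    then have x: "x > 0" using Suc by simp
    have "x ^ Suc k / fact (Suc k) \<le> (\<Sum>m<Suc (Suc k). x ^ m / fact m)"
      using x by (intro member_le_sum[of "Suc k" _ "\<lambda>m. x ^ m / fact m"]) auto
    also have "\<dots> \<le> exp x"
    proof -
      obtain t where "exp x = (\<Sum>m<Suc (Suc k). x ^ m / fact m) + exp t / fact (Suc (Suc k)) * x ^ Suc (Suc k)"
        using Maclaurin_exp_le by blast
      moreover have "exp t / fact (Suc (Suc k)) * x ^ Suc (Suc k) \<ge> 0" using x by simp
      ultimately show ?thesis by linarith
    qed
    finally show ?thesis by (simp add: divide_le_eq mult.commute del: fact_Suc power_Suc)
  qed simp
qed simp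

lemma integrable_std_gauss_poly:
  fixes f :: "real^'n::finite \<Rightarrow> real"
  assumes [measurable]: "f \<in> borel_measurable borel" and "\<And>w. \<bar>f w\<bar> \<le> c * (norm w) ^ k"
  shows "integrable std_gauss f"
proof (rule Bochner_Integration.integrable_bound)
  show "integrable std_gauss (\<lambda>w::real^'n. \<bar>c\<bar> * (fact k * exp (1 * norm w)))"
    by (intro integrable_mult_right integrable_std_gauss_exp_norm) simp
  show "AE w in std_gauss. norm (f w) \<le> norm (\<bar>c\<bar> * (fact k * exp (1 * norm w)))"
  proof (rule AE_I2)
    fix w
    have "\<bar>f w\<bar> \<le> c * (norm w) ^ k" by fact
    also have "\<dots> \<le> \<bar>c\<bar> * (norm w) ^ k" by (intro mult_right_mono) auto
    also have "\<dots> \<le> \<bar>c\<bar> * (fact k * exp (1 * norm w))"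
      using power_le_fact_exp[of "norm w" k] by (intro mult_left_mono) auto
    finally show "norm (f w) \<le> norm (\<bar>c\<bar> * (fact k * exp (1 * norm w)))" by simp
  qed
qed measurable

lemma std_normal_mean: "(\<integral>x. x \<partial>N1) = 0"
  and std_normal_second_moment: "(\<integral>x. x\<^sup>2 \<partial>N1) = 1"
  using integral_std_normal_moment_odd[of 0] integral_std_normal_moment_even[of 1]
  by (simp_all add: std_normal_measure_def integral_density)

lemma integrable_std_normal_power: "integrable N1 (\<lambda>x. x ^ k)"
  using integrable_std_normal_moment[of k]
  by (simp add: std_normal_measure_def integrable_density)

lemma std_gauss_mean: "(\<integral>w. w $ i \<partial>std_gauss) = (0::real)" for i :: "'n::finite"
proof -
  \<comment> \<open>Written as a product over all coordinates with factors 1, the shape that the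
    product formula integrates.\<close>
  have "(\<integral>w. w $ i \<partial>std_gauss) = (\<integral>w. (\<Prod>l\<in>UNIV. if l = i then w $ l else 1) \<partial>(std_gauss::(real^'n) measure))"
    by (simp add: prod.delta)
  also have "\<dots> = (\<Prod>l\<in>UNIV. \<integral>x. (if l = i then x else 1) \<partial>N1)"
  proof (rule integral_std_gauss_prod(1))
    fix l show "integrable N1 (\<lambda>x. if l = i then x else 1)"
      using integrable_std_normal_power[of 1] by (cases "l = i") auto
  qed
  also have "\<dots> = 0"
    by (rule prod_zero) (auto intro!: exI[of _ i] simp: std_normal_mean)
  finally show ?thesis .
qed

lemma std_gauss_cov: "(\<integral>w. w $ i * w $ k \<partial>std_gauss) = (if i = k then 1 else 0 :: real)" for i k :: "'n::finite"
proof -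
  let ?f = "\<lambda>l x. (if l = i then x else 1) * (if l = k then x else (1::real))"
  have int: "integrable N1 (?f l)" for l
    using integrable_std_normal_power[of 1] integrable_std_normal_power[of 2]
    by (cases "l = i"; cases "l = k") (auto simp: power2_eq_square)
  have "(\<integral>w. w $ i * w $ k \<partial>std_gauss) = (\<integral>w. (\<Prod>l\<in>UNIV. ?f l (w $ l)) \<partial>(std_gauss::(real^'n) measure))"
    by (simp add: prod.distrib prod.delta)
  also have "\<dots> = (\<Prod>l\<in>UNIV. \<integral>x. ?f l x \<partial>N1)"
    by (rule integral_std_gauss_prod(1)) (rule int)
  also have "\<dots> = (if i = k then 1 else 0)"
  proof (cases "i = k")
    case True
    have "(\<integral>x. ?f l x \<partial>N1) = 1" for l
      using True N1.prob_space std_normal_second_moment by (cases "l = i") (auto simp: power2_eq_square)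
    then show ?thesis using True by simp
  next
    case False
    then have "(\<integral>x. ?f i x \<partial>N1) = 0" by (simp add: std_normal_mean)
    then show ?thesis using False by (auto intro!: prod_zero exI[of _ i])
  qed
  finally show ?thesis .
qed

section \<open>Second order expansion under a Gaussian shift\<close>

lemma gauss_integral_shift:
  fixes F :: "real^'n::finite \<Rightarrow> real"
  assumes [measurable]: "F \<in> borel_measurable borel"
  shows "(\<integral>w. F (w + s) \<partial>std_gauss) = (\<integral>w. exp (s \<bullet> w - (s \<bullet> s) / 2) * F w \<partial>std_gauss)"
proof -
  have "(\<integral>w. F (w + s) \<partial>std_gauss) = (\<integral>w. F w \<partial>distr std_gauss borel (\<lambda>w. w + s))"
    by (rule integral_distr[symmetric]) auto
  also have "\<dots> = (\<integral>w. exp (s \<bullet> w - (s \<bullet> s) / 2) * F w \<partial>std_gauss)"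
    unfolding std_gauss_shift by (subst integral_density) auto
  finally show ?thesis .
qed

lemma std_gauss_exp:
  fixes s :: "real^'n::finite"
  shows "integrable std_gauss (\<lambda>w. exp (s \<bullet> w - (s \<bullet> s) / 2))"
    and "(\<integral>w. exp (s \<bullet> w - (s \<bullet> s) / 2) \<partial>std_gauss) = 1"
proof -
  show "(\<integral>w. exp (s \<bullet> w - (s \<bullet> s) / 2) \<partial>std_gauss) = 1"
    using gauss_integral_shift[of "\<lambda>_. 1" s] gauss.prob_space[where 'n='n] by simp
  \<comment> \<open>A non-integrable function has integral 0 by convention, so the value 1 already
    implies integrability.\<close>
  then show "integrable std_gauss (\<lambda>w. exp (s \<bullet> w - (s \<bullet> s) / 2))"
    using not_integrable_integral_eq by fastforce
qed

text \<open>The remainder of the Cameron-Martin density after its terms of degree 0, 1 and 2 in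
  \<open>s\<close>. The subtracted terms are Hermite polynomials in \<open>w\<close>, whence the
  \<open>s \<bullet> s\<close> in the quadratic one.\<close>

definition cm_rem :: "real^'n::finite \<Rightarrow> real^'n \<Rightarrow> real" where
  "cm_rem s w = exp (s \<bullet> w - (s \<bullet> s) / 2) - 1 - s \<bullet> w - ((s \<bullet> w)\<^sup>2 - s \<bullet> s) / 2"

lemma cm_rem_measurable [measurable]: "cm_rem s \<in> borel_measurable borel"
  unfolding cm_rem_def by measurable

text \<open>For short \<open>s\<close> this is Taylor's formula for the exponential with third order
  remainder. For long \<open>s\<close> the polynomial terms are dominated through
  \<open>norm s ^ 3\<close>, whereas the exponential stays in the bound and is later integrated
  exactly. The shift by 1 in \<open>norm w + 1\<close> leaves room for the lower order
  terms.\<close>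

lemma cm_rem_pointwise:
  fixes s w :: "real^'n::finite"
  shows "\<bar>cm_rem s w\<bar> \<le> (if norm s \<le> 1 then 0 else exp (s \<bullet> w - (s \<bullet> s) / 2))
           + 2 * norm s ^ 3 * exp (2 * (norm w + 1))"
proof -
  define t y where "t = norm s" and "y = norm w + 1"
  have t: "t \<ge> 0" and y: "y \<ge> 1" by (auto simp: t_def y_def)
  have ss: "s \<bullet> s = t\<^sup>2" by (simp add: t_def power2_norm_eq_inner)
  have sw: "\<bar>s \<bullet> w\<bar> \<le> t * (y - 1)" using Cauchy_Schwarz_ineq2[of s w] by (simp add: t_def y_def)
  have yexp: "y \<le> exp y" "y\<^sup>2 \<le> 2 * exp y" "y ^ 3 \<le> 6 * exp y"
    using power_le_fact_exp[of y 1] power_le_fact_exp[of y 2] power_le_fact_exp[of y 3] y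
    by (auto simp: fact_numeral numeral_eq_Suc)
  have e2: "exp (2 * y) = exp y * exp y" by (simp flip: exp_add)
  have e12: "exp y \<le> exp (2 * y)" using y by simp
  show ?thesis
  proof (cases "t \<le> 1")
    case True
    define v where "v = s \<bullet> w - t\<^sup>2 / 2"
    have "\<bar>v\<bar> \<le> \<bar>s \<bullet> w\<bar> + t\<^sup>2 / 2" using zero_le_power2[of t] unfolding v_def by linarith
    also have "\<dots> \<le> t * (y - 1) + t * 1"
      using sw True t mult_left_mono[of t 1 t] by (intro add_mono) (auto simp: power2_eq_square)
    finally have v: "\<bar>v\<bar> \<le> t * y" by (simp add: algebra_simps)
    then have vy: "\<bar>v\<bar> \<le> y" using True t y by (smt (verit) mult_le_cancel_right2)
    obtain \<xi> where \<xi>: "\<bar>\<xi>\<bar> \<le> \<bar>v\<bar>" "exp v = (\<Sum>m<3. v ^ m / fact m) + exp \<xi> / fact 3 * v ^ 3"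
      using Maclaurin_exp_le by blast
    have ex: "exp v - 1 - v - v\<^sup>2 / 2 = exp \<xi> / 6 * v ^ 3"
      using \<xi>(2) by (simp add: eval_nat_numeral)
    have "\<bar>exp \<xi> / 6 * v ^ 3\<bar> = exp \<xi> / 6 * \<bar>v\<bar> ^ 3" by (simp add: abs_mult power_abs)
    also have "\<dots> \<le> exp y / 6 * (t * y) ^ 3"
      using \<xi>(1) vy v by (intro mult_mono power_mono divide_right_mono) auto
    also have "\<dots> = t ^ 3 * (exp y * (y ^ 3 / 6))" by (simp add: power_mult_distrib)
    also have "\<dots> \<le> t ^ 3 * (exp y * exp y)"
      using yexp t by (intro mult_left_mono) auto
    finally have main: "\<bar>exp v - 1 - v - v\<^sup>2 / 2\<bar> \<le> t ^ 3 * exp (2 * y)"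
      by (simp add: ex e2)
    \<comment> \<open>Taylor expands in \<open>v\<close>, which contains
      \<open>- t\<^sup>2 / 2\<close>; the cross term and the square that this produces in
      \<open>v\<^sup>2 / 2\<close> have degree 3 and 4 in \<open>s\<close> and count as
      remainder.\<close>
    have eq: "cm_rem s w = (exp v - 1 - v - v\<^sup>2 / 2) + (t\<^sup>2 * t\<^sup>2 / 8 - (s \<bullet> w) * t\<^sup>2 / 2)"
      by (simp add: cm_rem_def v_def ss power2_eq_square field_simps)
    have "\<bar>t\<^sup>2 * t\<^sup>2 / 8 - (s \<bullet> w) * t\<^sup>2 / 2\<bar> \<le> \<bar>t\<^sup>2 * t\<^sup>2 / 8\<bar> + \<bar>(s \<bullet> w) * t\<^sup>2 / 2\<bar>" by (rule abs_triangle_ineq4)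
    also have "\<dots> = t\<^sup>2 * t\<^sup>2 / 8 + \<bar>s \<bullet> w\<bar> * t\<^sup>2 / 2" by (simp add: abs_mult)
    also have "\<dots> \<le> t ^ 3 * 1 + (t * (y - 1)) * t\<^sup>2"
    proof (rule add_mono)
      have "t\<^sup>2 * t\<^sup>2 = t ^ 3 * t" by (simp add: power2_eq_square power3_eq_cube)
      also have "\<dots> \<le> t ^ 3 * 1" using True t by (intro mult_left_mono) auto
      finally show "t\<^sup>2 * t\<^sup>2 / 8 \<le> t ^ 3 * 1" using zero_le_power[OF t, of 3] by linarith
      have "\<bar>s \<bullet> w\<bar> * t\<^sup>2 / 2 \<le> \<bar>s \<bullet> w\<bar> * t\<^sup>2" by simp
      also have "\<dots> \<le> (t * (y - 1)) * t\<^sup>2" using sw by (intro mult_right_mono) auto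
      finally show "\<bar>s \<bullet> w\<bar> * t\<^sup>2 / 2 \<le> (t * (y - 1)) * t\<^sup>2" .
    qed
    also have "\<dots> = t ^ 3 * y" by (simp add: power2_eq_square power3_eq_cube algebra_simps)
    also have "\<dots> \<le> t ^ 3 * exp (2 * y)" using order_trans[OF yexp(1) e12] t by (intro mult_left_mono) auto
    finally have "\<bar>cm_rem s w\<bar> \<le> 2 * t ^ 3 * exp (2 * y)"
      unfolding eq using main by linarith
    then show ?thesis using True by (simp add: t_def y_def)
  next
    case False
    then have t1: "t \<ge> 1" by simp
    have t13: "1 \<le> t ^ 3" "t \<le> t ^ 3" "t\<^sup>2 \<le> t ^ 3"
      using t1 power_increasing[of 1 3 t] power_increasing[of 2 3 t] by auto
    have "\<bar>1 + s \<bullet> w\<bar> \<le> 1 + t * (y - 1)" using sw by linarith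
    also have "\<dots> \<le> t ^ 3 + t ^ 3 * (y - 1)"
      using t13 y by (intro add_mono mult_right_mono) auto
    also have "\<dots> = t ^ 3 * y" by (simp add: algebra_simps)
    finally have a1: "\<bar>1 + s \<bullet> w\<bar> \<le> t ^ 3 * y" .
    have abs_half: "\<bar>(a - c) / 2\<bar> \<le> (b + c) / 2" if "0 \<le> a" "a \<le> b" "0 \<le> c" for a b c :: real
      using that by (auto simp: abs_le_iff field_simps)
    have "(s \<bullet> w)\<^sup>2 \<le> (t * (y - 1))\<^sup>2" using sw by (simp add: abs_le_square_iff[symmetric] t)
    then have "\<bar>((s \<bullet> w)\<^sup>2 - t\<^sup>2) / 2\<bar> \<le> ((t * (y - 1))\<^sup>2 + t\<^sup>2) / 2"
      using abs_half[OF zero_le_power2 _ zero_le_power2] by blast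
    also have "\<dots> = t\<^sup>2 * (((y - 1)\<^sup>2 + 1) / 2)" by (simp add: power2_eq_square field_simps)
    also have "\<dots> \<le> t\<^sup>2 * (y\<^sup>2 / 2)" using y by (intro mult_left_mono) (auto simp: power2_eq_square algebra_simps)
    also have "\<dots> \<le> t ^ 3 * exp y" using t13 yexp t by (intro mult_mono) auto
    finally have a2: "\<bar>((s \<bullet> w)\<^sup>2 - t\<^sup>2) / 2\<bar> \<le> t ^ 3 * exp y" .
    have "t ^ 3 * y \<le> t ^ 3 * exp y" using yexp t by (intro mult_left_mono) auto
    moreover have "t ^ 3 * exp y \<le> t ^ 3 * exp (2 * y)" using e12 t by (intro mult_left_mono) auto
    moreover have "\<bar>cm_rem s w\<bar> \<le> exp (s \<bullet> w - (s \<bullet> s) / 2) + \<bar>1 + s \<bullet> w\<bar> + \<bar>((s \<bullet> w)\<^sup>2 - t\<^sup>2) / 2\<bar>"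
      unfolding cm_rem_def ss using exp_ge_zero[of "s \<bullet> w - t\<^sup>2 / 2"] by linarith
    ultimately have "\<bar>cm_rem s w\<bar> \<le> exp (s \<bullet> w - (s \<bullet> s) / 2) + 2 * (t ^ 3 * exp (2 * y))"
      using a1 a2 by linarith
    then show ?thesis using False by (simp add: t_def y_def mult.assoc)
  qed
qed

text \<open>The 1 pays for the density itself when \<open>norm s > 1\<close>, where its integral 1
  is at most \<open>norm s ^ 3\<close>; the rest is the integral of the exponential majorant. The
  type argument carries the dimension.\<close>

definition cm_const :: "'n::finite itself \<Rightarrow> real" where
  "cm_const _ = 1 + 2 * (\<integral>w. exp (2 * (norm w + 1)) \<partial>(std_gauss :: (real^'n) measure))"

lemma cm_const_ge_1: "cm_const TYPE('n::finite) \<ge> 1"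
  by (simp add: cm_const_def)

lemma cm_rem_integral:
  fixes s :: "real^'n::finite"
  shows "integrable std_gauss (cm_rem s)"
    and "(\<integral>w. \<bar>cm_rem s w\<bar> \<partial>std_gauss) \<le> cm_const TYPE('n) * norm s ^ 3"
proof -
  let ?b = "\<lambda>w. (if norm s \<le> 1 then 0 else exp (s \<bullet> w - (s \<bullet> s) / 2))
           + 2 * norm s ^ 3 * exp (2 * (norm w + 1))"
  have ie: "integrable (std_gauss :: (real^'n) measure) (\<lambda>w. exp (2 * (norm w + 1)))"
    using integrable_mult_right[OF integrable_std_gauss_exp_norm[of 2], of "exp 2"]
    by (simp add: algebra_simps flip: exp_add)
  have ib: "integrable std_gauss ?b"
    by (intro Bochner_Integration.integrable_add integrable_mult_right ie)
       (cases "norm s \<le> 1"; simp add: std_gauss_exp)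
  show i: "integrable std_gauss (cm_rem s)"
    by (rule Bochner_Integration.integrable_bound[OF ib])
       (auto intro!: AE_I2 order_trans[OF cm_rem_pointwise])
  have "(\<integral>w. \<bar>cm_rem s w\<bar> \<partial>std_gauss) \<le> (\<integral>w. ?b w \<partial>std_gauss)"
    by (intro integral_mono integrable_abs i ib cm_rem_pointwise)
  also have "\<dots> = (if norm s \<le> 1 then 0 else 1) + 2 * norm s ^ 3 * (\<integral>w. exp (2 * (norm w + 1)) \<partial>(std_gauss :: (real^'n) measure))"
    using std_gauss_exp[of s] ie by (cases "norm s \<le> 1") simp_all
  also have "\<dots> \<le> cm_const TYPE('n) * norm s ^ 3"
    by (auto simp: cm_const_def algebra_simps one_le_power)
  finally show "(\<integral>w. \<bar>cm_rem s w\<bar> \<partial>std_gauss) \<le> cm_const TYPE('n) * norm s ^ 3" .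
qed

lemma integrable_bounded_mult:
  fixes F g :: "'a \<Rightarrow> real"
  assumes g: "integrable M g" and [measurable]: "F \<in> borel_measurable M" and K: "\<And>w. \<bar>F w\<bar> \<le> K"
  shows "integrable M (\<lambda>w. F w * g w)"
proof (rule Bochner_Integration.integrable_bound)
  show "integrable M (\<lambda>w. K * g w)" using g by simp
  have "K \<ge> 0" using K[of undefined] by simp
  then show "AE w in M. norm (F w * g w) \<le> norm (K * g w)"
    using K by (auto simp: abs_mult intro!: mult_right_mono)
qed (use g in measurable)

definition quad_poly :: "real \<Rightarrow> ('n::finite \<Rightarrow> real) \<Rightarrow> ('n \<Rightarrow> 'n \<Rightarrow> real) \<Rightarrow> real^'n \<Rightarrow> real" where
  "quad_poly m0 m1 m2 s = m0 + (\<Sum>k\<in>UNIV. s $ k * m1 k) + (\<Sum>k\<in>UNIV. \<Sum>l\<in>UNIV. (s $ k * s $ l) * m2 k l)"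

text \<open>The shift formula puts the Cameron-Martin density next to \<open>F\<close>, and the
  density is expanded, so \<open>F\<close> may be as rough as an indicator. The coefficients can
  stay existential: comparing two step laws uses that they do not depend on
  \<open>s\<close>.\<close>

lemma gauss_shift_expansion:
  fixes F :: "real^'n::finite \<Rightarrow> real"
  assumes F[measurable]: "F \<in> borel_measurable borel" and K: "\<And>w. \<bar>F w\<bar> \<le> K"
  shows "\<exists>m0 m1 m2. \<forall>s. \<bar>(\<integral>w. F (w + s) \<partial>std_gauss) - quad_poly m0 m1 m2 s\<bar>
           \<le> cm_const TYPE('n) * K * norm s ^ 3"
proof -
  have K0: "K \<ge> 0" using K[of 0] by simp
  define m0 where "m0 = (\<integral>w. F w \<partial>std_gauss)"
  define m1 where "m1 k = (\<integral>w. F w * w $ k \<partial>std_gauss)" for k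
  \<comment> \<open>Half the second moment weighted by \<open>F\<close>; the diagonal correction
    comes from \<open>- (s \<bullet> s) / 2\<close> in the density.\<close>
  define m2 where "m2 k l = (\<integral>w. F w * (w $ k * w $ l) \<partial>std_gauss) / 2 - (if k = l then m0 / 2 else 0)" for k l
  have i1: "integrable std_gauss (\<lambda>w::real^'n. w $ k)" for k
    by (rule integrable_std_gauss_poly[where c=1 and k=1]) (auto simp: component_le_norm_cart)
  have i2: "integrable std_gauss (\<lambda>w::real^'n. w $ k * w $ l)" for k l
    by (rule integrable_std_gauss_poly[where c=1 and k=2])
       (auto simp: abs_mult power2_eq_square intro!: mult_mono component_le_norm_cart)
  have j0: "integrable std_gauss F"
    using integrable_bounded_mult[of std_gauss "\<lambda>_. 1" F K] K by simp
  have j1: "integrable std_gauss (\<lambda>w. F w * w $ k)" for k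
    by (rule integrable_bounded_mult[OF i1 _ K]) simp
  have j2: "integrable std_gauss (\<lambda>w. F w * (w $ k * w $ l))" for k l
    by (rule integrable_bounded_mult[OF i2 _ K]) simp
  have jr: "integrable std_gauss (\<lambda>w. F w * cm_rem s w)" for s
    by (rule integrable_bounded_mult[OF cm_rem_integral(1) _ K]) simp
  have "\<bar>(\<integral>w. F (w + s) \<partial>std_gauss) - quad_poly m0 m1 m2 s\<bar> \<le> cm_const TYPE('n) * K * norm s ^ 3" for s
  proof -
    have pw: "exp (s \<bullet> w - (s \<bullet> s) / 2) * F w = F w * cm_rem s w + (F w + (\<Sum>k\<in>UNIV. s $ k * (F w * w $ k))
        + (\<Sum>k\<in>UNIV. \<Sum>l\<in>UNIV. (s $ k * s $ l) * (F w * (w $ k * w $ l))) / 2 - (s \<bullet> s) / 2 * F w)" for w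
    proof -
      have a: "(\<Sum>k\<in>UNIV. s $ k * (F w * w $ k)) = F w * (s \<bullet> w)"
        by (simp add: inner_vec_def sum_distrib_left algebra_simps)
      have b: "(\<Sum>k\<in>UNIV. \<Sum>l\<in>UNIV. (s $ k * s $ l) * (F w * (w $ k * w $ l))) = F w * (s \<bullet> w)\<^sup>2"
        by (simp add: inner_vec_def power2_eq_square sum_product sum_distrib_left algebra_simps)
      show ?thesis unfolding a b cm_rem_def by (simp add: field_simps)
    qed
    have "(\<integral>w. F (w + s) \<partial>std_gauss) = (\<integral>w. F w * cm_rem s w \<partial>std_gauss) +
       (m0 + (\<Sum>k\<in>UNIV. s $ k * m1 k)
        + (\<Sum>k\<in>UNIV. \<Sum>l\<in>UNIV. (s $ k * s $ l) * (\<integral>w. F w * (w $ k * w $ l) \<partial>std_gauss)) / 2 - (s \<bullet> s) / 2 * m0)"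
      unfolding gauss_integral_shift[OF F] pw m0_def m1_def
      by (simp add: j0 j1 j2 jr)
    also have "\<dots> = (\<integral>w. F w * cm_rem s w \<partial>std_gauss) + quad_poly m0 m1 m2 s"
      unfolding quad_poly_def m2_def
      by (simp add: right_diff_distrib sum_subtractf sum_divide_distrib if_distrib[of "(*) _"] inner_vec_def
          sum_distrib_right sum.delta' cong: if_cong)
    finally have eq: "(\<integral>w. F (w + s) \<partial>std_gauss) - quad_poly m0 m1 m2 s = (\<integral>w. F w * cm_rem s w \<partial>std_gauss)" by simp
    have "\<bar>\<integral>w. F w * cm_rem s w \<partial>std_gauss\<bar> \<le> (\<integral>w. \<bar>F w * cm_rem s w\<bar> \<partial>std_gauss)"
      by (rule integral_abs_bound)
    also have "\<dots> \<le> (\<integral>w. K * \<bar>cm_rem s w\<bar> \<partial>std_gauss)"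
      by (intro integral_mono integrable_abs jr integrable_mult_right cm_rem_integral(1))
         (auto simp: abs_mult intro!: mult_right_mono K)
    also have "\<dots> \<le> K * (cm_const TYPE('n) * norm s ^ 3)"
      using cm_rem_integral(2)[of s] K0 by (simp add: mult_left_mono)
    finally show ?thesis by (simp add: eq algebra_simps)
  qed
  then show ?thesis by blast
qed

section \<open>Averaging operators\<close>

text \<open>The bound is an explicit parameter because the induction applies the swap estimate to
  differences with small supremum, and the error is proportional to it.\<close>

definition bdd_borel :: "real \<Rightarrow> ('v::euclidean_space \<Rightarrow> real) \<Rightarrow> bool" where
  "bdd_borel K f \<longleftrightarrow> f \<in> borel_measurable borel \<and> (\<forall>x. \<bar>f x\<bar> \<le> K)"

lemma bdd_borelD: "bdd_borel K f \<Longrightarrow> f \<in> borel_measurable borel" "bdd_borel K f \<Longrightarrow> \<bar>f x\<bar> \<le> K"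
  by (auto simp: bdd_borel_def)

lemma bdd_borel_diff:
  assumes "bdd_borel K f" "bdd_borel L g" "\<And>x. \<bar>f x - g x\<bar> \<le> B"
  shows "bdd_borel B (\<lambda>x. f x - g x)"
  using assms by (auto simp: bdd_borel_def)

definition gauss_op :: "real^'n::finite^'m::finite \<Rightarrow> real \<Rightarrow> (real^'m \<Rightarrow> real) \<Rightarrow> real^'m \<Rightarrow> real" where
  "gauss_op A t f x = (\<integral>w. f (x + sqrt t *\<^sub>R (A *v w)) \<partial>std_gauss)"

definition step_op :: "('c::finite \<Rightarrow> real) \<Rightarrow> ('c \<Rightarrow> real^'m::finite) \<Rightarrow> (real^'m \<Rightarrow> real) \<Rightarrow> real^'m \<Rightarrow> real" where
  "step_op q d f x = (\<Sum>c\<in>UNIV. q c * f (x + d c))"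

lemma measurable_matrix_vector_mult [measurable (raw)]:
  fixes A :: "real^'n::finite^'m::finite"
  assumes "f \<in> borel_measurable M"
  shows "(\<lambda>x. A *v f x) \<in> borel_measurable M"
proof -
  have "(\<lambda>v. A *v v) \<in> borel_measurable borel"
    by (intro borel_measurable_continuous_onI linear_continuous_on)
       (simp add: linear_linear)
  from measurable_compose[OF assms this] show ?thesis .
qed

lemma gauss_integrable_bdd:
  fixes g :: "real^'n::finite \<Rightarrow> real"
  assumes "g \<in> borel_measurable borel" "\<And>w. \<bar>g w\<bar> \<le> K"
  shows "integrable std_gauss g"
  using assms by (intro gauss.integrable_const_bound[where B=K]) auto

lemma gauss_op_integrable:
  assumes "bdd_borel K f"
  shows "integrable std_gauss (\<lambda>w. f (x + sqrt t *\<^sub>R (A *v w)))"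
proof -
  have [measurable]: "f \<in> borel_measurable borel" by (rule bdd_borelD(1)[OF assms])
  show ?thesis by (rule gauss_integrable_bdd[where K=K]) (use bdd_borelD(2)[OF assms] in auto)
qed

lemma gauss_abs_integral_le:
  fixes g :: "real^'n::finite \<Rightarrow> real"
  assumes "integrable std_gauss g" "\<And>w. \<bar>g w\<bar> \<le> K"
  shows "\<bar>\<integral>w. g w \<partial>std_gauss\<bar> \<le> K"
proof -
  have "\<bar>\<integral>w. g w \<partial>std_gauss\<bar> \<le> (\<integral>w. \<bar>g w\<bar> \<partial>std_gauss)" by (rule integral_abs_bound)
  also have "\<dots> \<le> (\<integral>w. K \<partial>(std_gauss :: (real^'n) measure))"
    using assms by (intro integral_mono) auto
  finally show ?thesis using gauss.prob_space[where 'n='n] by simp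
qed

lemma bdd_borel_gauss_op:
  assumes "bdd_borel K f"
  shows "bdd_borel K (gauss_op A t f)"
proof -
  have [measurable]: "f \<in> borel_measurable borel" by (rule bdd_borelD(1)[OF assms])
  have "gauss_op A t f \<in> borel_measurable borel"
    unfolding gauss_op_def by measurable
  moreover have "\<bar>gauss_op A t f x\<bar> \<le> K" for x
    unfolding gauss_op_def by (rule gauss_abs_integral_le[OF gauss_op_integrable[OF assms] bdd_borelD(2)[OF assms]])
  ultimately show ?thesis by (simp add: bdd_borel_def)
qed

lemma gauss_op_0: "gauss_op A 0 f = f"
  using gauss.prob_space by (auto simp: gauss_op_def fun_eq_iff)

lemma gauss_op_diff:
  assumes "bdd_borel K f" "bdd_borel L g"
  shows "gauss_op A t (\<lambda>x. f x - g x) x = gauss_op A t f x - gauss_op A t g x"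
  unfolding gauss_op_def by (rule Bochner_Integration.integral_diff) (rule gauss_op_integrable; fact)+

text \<open>The law of the sum of two independent Gaussian vectors. Time 0 is separate because the
  convolution formula asks for positive scales; it occurs in the telescoping sum at
  \<open>k = 0\<close>.\<close>

lemma gauss_op_gauss_op:
  fixes A :: "real^'n::finite^'m::finite"
  assumes f: "bdd_borel K f" and st: "s \<ge> 0" "t \<ge> 0"
  shows "gauss_op A s (gauss_op A t f) = gauss_op A (s + t) f"
proof (cases "s = 0 \<or> t = 0")
  case True
  then show ?thesis by (auto simp: gauss_op_0)
next
  case False
  then have s: "s > 0" and t: "t > 0" using st by auto
  have [measurable]: "f \<in> borel_measurable borel" by (rule bdd_borelD(1)[OF f])
  interpret pair_prob_space "std_gauss :: (real^'n) measure" "std_gauss :: (real^'n) measure" ..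
  show ?thesis
  proof
    fix x
    let ?h = "\<lambda>u. f (x + A *v u)"
    have int: "integrable (std_gauss \<Otimes>\<^sub>M std_gauss) (\<lambda>(v, w). ?h (sqrt s *\<^sub>R v + sqrt t *\<^sub>R w))"
      by (rule integrable_const_bound[where B=K]) (auto intro!: AE_I2 simp: bdd_borelD(2)[OF f])
    have "gauss_op A s (gauss_op A t f) x = (\<integral>v. \<integral>w. ?h (sqrt s *\<^sub>R v + sqrt t *\<^sub>R w) \<partial>std_gauss \<partial>std_gauss)"
      by (simp add: gauss_op_def matrix_vector_right_distrib matrix_vector_mult_scaleR add.assoc)
    also have "\<dots> = (\<integral>z. (\<lambda>(v, w). ?h (sqrt s *\<^sub>R v + sqrt t *\<^sub>R w)) z \<partial>(std_gauss \<Otimes>\<^sub>M std_gauss))"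
      by (rule integral_fst[OF int])
    also have "\<dots> = (\<integral>u. ?h u \<partial>distr (std_gauss \<Otimes>\<^sub>M std_gauss) borel (\<lambda>(v, w). sqrt s *\<^sub>R v + sqrt t *\<^sub>R w))"
      by (subst integral_distr) (auto simp: case_prod_beta')
    also have "\<dots> = (\<integral>u. ?h u \<partial>distr std_gauss borel (\<lambda>w. sqrt (s + t) *\<^sub>R w))"
      using std_gauss_convolution[of "sqrt s" "sqrt t", where 'n='n] s t by simp
    also have "\<dots> = gauss_op A (s + t) f x"
      by (subst integral_distr) (auto simp: gauss_op_def matrix_vector_mult_scaleR)
    finally show "gauss_op A s (gauss_op A t f) x = gauss_op A (s + t) f x" .
  qed
qed

lemma bdd_borel_step_op:
  assumes f: "bdd_borel K f" and q: "\<And>c. q c \<ge> 0" "(\<Sum>c\<in>UNIV. q c) = 1"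
  shows "bdd_borel K (step_op q d f)"
proof -
  have [measurable]: "f \<in> borel_measurable borel" by (rule bdd_borelD(1)[OF f])
  have "\<bar>step_op q d f x\<bar> \<le> K" for x
  proof -
    have "\<bar>step_op q d f x\<bar> \<le> (\<Sum>c\<in>UNIV. \<bar>q c * f (x + d c)\<bar>)" unfolding step_op_def by (rule sum_abs)
    also have "\<dots> \<le> (\<Sum>c\<in>UNIV. q c * K)"
      by (intro sum_mono) (auto simp: abs_mult q intro!: mult_left_mono bdd_borelD(2)[OF f])
    finally show ?thesis by (simp add: q flip: sum_distrib_right)
  qed
  moreover have "step_op q d f \<in> borel_measurable borel" unfolding step_op_def by measurable
  ultimately show ?thesis by (simp add: bdd_borel_def)
qed

text \<open>Both operators average translates, and translations commute.\<close>

lemma step_op_gauss_op: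
  assumes f: "bdd_borel K f"
  shows "step_op q d (gauss_op A t f) = gauss_op A t (step_op q d f)"
proof
  fix x
  have "integrable std_gauss (\<lambda>w. f (x + sqrt t *\<^sub>R (A *v w) + d c))" for c
    using gauss_op_integrable[OF f, of "x + d c" t A] by (simp add: add_ac)
  then show "step_op q d (gauss_op A t f) x = gauss_op A t (step_op q d f) x"
    unfolding step_op_def gauss_op_def by (simp add: add_ac)
qed

lemma step_op_diff: "step_op q d (\<lambda>x. f x - g x) x = step_op q d f x - step_op q d g x"
  by (simp add: step_op_def right_diff_distrib sum_subtractf)

text \<open>Only the first two moments of \<open>u\<close> enter the quadratic part of the expansion, and these are
  the moments of the standard Gaussian vector.\<close>

lemma step_gauss_swap:
  fixes A :: "real^'n::finite^'m::finite" and r :: "'e::finite \<Rightarrow> real" and u :: "'e \<Rightarrow> real^'n"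
  assumes lift: "\<And>f x. step_op q d f x = (\<Sum>e\<in>UNIV. r e * f (x + A *v u e))"
    and r: "\<And>e. r e \<ge> 0" "(\<Sum>e\<in>UNIV. r e) = 1"
    and mean: "\<And>k. (\<Sum>e\<in>UNIV. r e * u e $ k) = 0"
    and cov: "\<And>k l. (\<Sum>e\<in>UNIV. r e * (u e $ k * u e $ l)) = (if k = l then 1 else 0)"
  shows "\<exists>C\<ge>0. \<forall>j>0. \<forall>K f x. bdd_borel K f \<longrightarrow>
     \<bar>step_op q d (gauss_op A j f) x - gauss_op A (j + 1) f x\<bar> \<le> C * K / (j * sqrt j)"
proof -
  define C where "C = cm_const TYPE('n) * ((\<Sum>e\<in>UNIV. r e * norm (u e) ^ 3) + (\<integral>y. norm y ^ 3 \<partial>(std_gauss :: (real^'n) measure)))"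
  have "C \<ge> 0" unfolding C_def
    using cm_const_ge_1[where 'n='n] r by (auto intro!: mult_nonneg_nonneg add_nonneg_nonneg sum_nonneg)
  moreover have "\<bar>step_op q d (gauss_op A j f) x - gauss_op A (j + 1) f x\<bar> \<le> C * K / (j * sqrt j)"
    if j: "j > 0" and f: "bdd_borel K f" for j K f x
  proof -
    have [measurable]: "f \<in> borel_measurable borel" by (rule bdd_borelD(1)[OF f])
    define F where "F w = f (x + sqrt j *\<^sub>R (A *v w))" for w
    have Fm[measurable]: "F \<in> borel_measurable borel" unfolding F_def by measurable
    have FK: "\<bar>F w\<bar> \<le> K" for w unfolding F_def by (rule bdd_borelD(2)[OF f])
    have K0: "K \<ge> 0" using FK[of 0] by simp
    define G where "G s = (\<integral>w. F (w + s) \<partial>std_gauss)" for s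
    have Gm[measurable]: "G \<in> borel_measurable borel" unfolding G_def by measurable
    have GK: "\<bar>G s\<bar> \<le> K" for s
      unfolding G_def by (intro gauss_abs_integral_le gauss_integrable_bdd[where K=K]) (auto simp: FK)
    obtain m0 m1 m2 where ex: "\<And>s. \<bar>G s - quad_poly m0 m1 m2 s\<bar> \<le> cm_const TYPE('n) * K * norm s ^ 3"
      using gauss_shift_expansion[OF Fm FK] unfolding G_def by blast
    \<comment> \<open>Measured in units of the smoothing scale \<open>sqrt j\<close>, an increment
      \<open>u e\<close> becomes \<open>a *\<^sub>R u e\<close>, so the cubic remainder gains
      \<open>a ^ 3\<close>.\<close>
    define a where "a = 1 / sqrt j"
    have a0: "a > 0" using j by (simp add: a_def)
    have Gu: "gauss_op A j f (x + A *v y) = G (a *\<^sub>R y)" for y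
    proof -
      have "sqrt j *\<^sub>R (A *v (a *\<^sub>R y)) = A *v y"
        using j by (simp add: matrix_vector_mult_scaleR a_def)
      then show ?thesis
        by (simp add: gauss_op_def G_def F_def matrix_vector_right_distrib scaleR_right_distrib add_ac)
    qed
    have S: "step_op q d (gauss_op A j f) x = (\<Sum>e\<in>UNIV. r e * G (a *\<^sub>R u e))"
      by (simp add: lift Gu)
    \<comment> \<open>The extra unit of Gaussian time is peeled off by the semigroup law, so the
      Gaussian step averages the same function \<open>G\<close> as the walk step.\<close>
    have T: "gauss_op A (j + 1) f x = (\<integral>y. G (a *\<^sub>R y) \<partial>std_gauss)"
    proof -
      have "gauss_op A (j + 1) f x = gauss_op A 1 (gauss_op A j f) x"
        using gauss_op_gauss_op[OF f, of 1 j A] j by (simp add: add.commute)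
      also have "\<dots> = (\<integral>y. gauss_op A j f (x + A *v y) \<partial>std_gauss)"
        by (simp add: gauss_op_def[of A 1])
      finally show ?thesis by (simp only: Gu)
    qed
    \<comment> \<open>The common average of the quadratic part: centring removes the linear terms
      and identity covariance turns the quadratic form into its trace. The cubic remainders are all
      that is left of the difference.\<close>
    let ?Q = "m0 + a\<^sup>2 * (\<Sum>k\<in>UNIV. m2 k k)"
    have qp: "quad_poly m0 m1 m2 (a *\<^sub>R y) = m0 + (\<Sum>k\<in>UNIV. (a * m1 k) * y $ k) + (\<Sum>k\<in>UNIV. \<Sum>l\<in>UNIV. (a\<^sup>2 * m2 k l) * (y $ k * y $ l))" for y
      by (simp add: quad_poly_def power2_eq_square algebra_simps)
    have fin: "(\<Sum>k\<in>UNIV. \<Sum>l\<in>UNIV. (a\<^sup>2 * m2 k l) * (if k = l then 1 else 0)) = a\<^sup>2 * (\<Sum>k\<in>UNIV. m2 k k)"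
      by (simp add: if_distrib[of "(*) _"] sum_distrib_left cong: if_cong)
    have QS: "(\<Sum>e\<in>UNIV. r e * quad_poly m0 m1 m2 (a *\<^sub>R u e)) = ?Q"
    proof -
      have "(\<Sum>e\<in>UNIV. r e * quad_poly m0 m1 m2 (a *\<^sub>R u e)) = (\<Sum>e\<in>UNIV. r e) * m0
          + (\<Sum>e\<in>UNIV. \<Sum>k\<in>UNIV. (a * m1 k) * (r e * u e $ k))
          + (\<Sum>e\<in>UNIV. \<Sum>k\<in>UNIV. \<Sum>l\<in>UNIV. (a\<^sup>2 * m2 k l) * (r e * (u e $ k * u e $ l)))"
        unfolding qp by (simp add: distrib_left sum.distrib sum_distrib_left sum_distrib_right algebra_simps)
      also have "(\<Sum>e\<in>UNIV. \<Sum>k\<in>UNIV. (a * m1 k) * (r e * u e $ k)) = (\<Sum>k\<in>UNIV. (a * m1 k) * (\<Sum>e\<in>UNIV. r e * u e $ k))"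
        by (subst sum.swap) (simp add: sum_distrib_left)
      also have "(\<Sum>e\<in>UNIV. \<Sum>k\<in>UNIV. \<Sum>l\<in>UNIV. (a\<^sup>2 * m2 k l) * (r e * (u e $ k * u e $ l)))
          = (\<Sum>k\<in>UNIV. \<Sum>l\<in>UNIV. (a\<^sup>2 * m2 k l) * (\<Sum>e\<in>UNIV. r e * (u e $ k * u e $ l)))"
        by (subst sum.swap, intro sum.cong refl, subst sum.swap) (simp add: sum_distrib_left)
      finally show ?thesis unfolding mean cov fin r(2) by simp
    qed
    have i1: "integrable std_gauss (\<lambda>w::real^'n. w $ k)" for k
      by (rule integrable_std_gauss_poly[where c=1 and k=1]) (auto simp: component_le_norm_cart)
    have i2: "integrable std_gauss (\<lambda>w::real^'n. w $ k * w $ l)" for k l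
      by (rule integrable_std_gauss_poly[where c=1 and k=2])
         (auto simp: abs_mult power2_eq_square intro!: mult_mono component_le_norm_cart)
    have i3: "integrable std_gauss (\<lambda>w::real^'n. norm w ^ 3)"
      by (rule integrable_std_gauss_poly[where c=1 and k=3]) auto
    have iQ: "integrable std_gauss (\<lambda>y. quad_poly m0 m1 m2 (a *\<^sub>R y))"
      unfolding qp by (intro Bochner_Integration.integrable_add Bochner_Integration.integrable_sum integrable_mult_right i1 i2) auto
    have iG: "integrable std_gauss (\<lambda>y. G (a *\<^sub>R y))"
      by (rule gauss_integrable_bdd[where K=K]) (auto simp: GK)
    have QT: "(\<integral>y. quad_poly m0 m1 m2 (a *\<^sub>R y) \<partial>std_gauss) = ?Q"
    proof -
      have "(\<integral>y. quad_poly m0 m1 m2 (a *\<^sub>R y) \<partial>std_gauss) = m0 + (\<Sum>k\<in>UNIV. (a * m1 k) * (\<integral>y. y $ k \<partial>(std_gauss::(real^'n) measure)))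
         + (\<Sum>k\<in>UNIV. \<Sum>l\<in>UNIV. (a\<^sup>2 * m2 k l) * (\<integral>y. y $ k * y $ l \<partial>(std_gauss::(real^'n) measure)))"
        unfolding qp using gauss.prob_space[where 'n='n] by (simp add: i1 i2)
      then show ?thesis unfolding std_gauss_mean std_gauss_cov fin by simp
    qed
    have a3: "a ^ 3 = 1 / (j * sqrt j)"
      using j by (simp add: a_def power3_eq_cube)
    have nrm: "norm (a *\<^sub>R y) ^ 3 = a ^ 3 * norm y ^ 3" for y :: "real^'n"
      using a0 by (simp add: power_mult_distrib)
    have "\<bar>(\<Sum>e\<in>UNIV. r e * G (a *\<^sub>R u e)) - ?Q\<bar> \<le> cm_const TYPE('n) * K * a ^ 3 * (\<Sum>e\<in>UNIV. r e * norm (u e) ^ 3)"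
    proof -
      have "\<bar>(\<Sum>e\<in>UNIV. r e * G (a *\<^sub>R u e)) - ?Q\<bar> = \<bar>\<Sum>e\<in>UNIV. r e * (G (a *\<^sub>R u e) - quad_poly m0 m1 m2 (a *\<^sub>R u e))\<bar>"
        unfolding QS[symmetric] by (simp add: right_diff_distrib sum_subtractf)
      also have "\<dots> \<le> (\<Sum>e\<in>UNIV. \<bar>r e * (G (a *\<^sub>R u e) - quad_poly m0 m1 m2 (a *\<^sub>R u e))\<bar>)" by (rule sum_abs)
      also have "\<dots> \<le> (\<Sum>e\<in>UNIV. r e * (cm_const TYPE('n) * K * norm (a *\<^sub>R u e) ^ 3))"
        by (intro sum_mono) (auto simp only: abs_mult abs_of_nonneg[OF r(1)] intro!: mult_left_mono ex r)
      also have "\<dots> = cm_const TYPE('n) * K * a ^ 3 * (\<Sum>e\<in>UNIV. r e * norm (u e) ^ 3)"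
        unfolding nrm by (simp add: sum_distrib_left algebra_simps)
      finally show ?thesis .
    qed
    moreover have "\<bar>(\<integral>y. G (a *\<^sub>R y) \<partial>std_gauss) - ?Q\<bar> \<le> cm_const TYPE('n) * K * a ^ 3 * (\<integral>y. norm y ^ 3 \<partial>(std_gauss :: (real^'n) measure))"
    proof -
      have "\<bar>(\<integral>y. G (a *\<^sub>R y) \<partial>std_gauss) - ?Q\<bar> = \<bar>\<integral>y. G (a *\<^sub>R y) - quad_poly m0 m1 m2 (a *\<^sub>R y) \<partial>std_gauss\<bar>"
        unfolding QT[symmetric] by (simp add: iG iQ)
      also have "\<dots> \<le> (\<integral>y. \<bar>G (a *\<^sub>R y) - quad_poly m0 m1 m2 (a *\<^sub>R y)\<bar> \<partial>std_gauss)" by (rule integral_abs_bound)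
      also have "\<dots> \<le> (\<integral>y. (cm_const TYPE('n) * K * a ^ 3) * norm y ^ 3 \<partial>(std_gauss :: (real^'n) measure))"
        by (intro integral_mono integrable_abs Bochner_Integration.integrable_diff iG iQ integrable_mult_right i3)
           (use ex[of "a *\<^sub>R _", unfolded nrm] in \<open>simp add: mult.assoc\<close>)
      finally show ?thesis by simp
    qed
    moreover have "C * K / (j * sqrt j) = cm_const TYPE('n) * K * a ^ 3 * (\<Sum>e\<in>UNIV. r e * norm (u e) ^ 3)
        + cm_const TYPE('n) * K * a ^ 3 * (\<integral>y. norm y ^ 3 \<partial>(std_gauss :: (real^'n) measure))"
      unfolding a3 C_def by (simp add: algebra_simps add_divide_distrib)
    ultimately show ?thesis unfolding S T by linarith
  qed
  ultimately show ?thesis by blast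
qed

section \<open>Orthants and anti-concentration\<close>

definition orthant :: "real^'m::finite \<Rightarrow> (real^'m) set" where
  "orthant z = {y. \<forall>i. y $ i \<le> z $ i}"

lemma orthant_translate: "x + y \<in> orthant z \<longleftrightarrow> y \<in> orthant (z - x)"
  by (auto simp: orthant_def algebra_simps)

abbreviation orth :: "real^'m::finite \<Rightarrow> real^'m \<Rightarrow> real" where "orth z \<equiv> indicator (orthant z)"

lemma indicator_orthant_translate: "indicator (orthant z) (x + y) = (indicator (orthant (z - x)) y :: real)"
  by (auto simp: indicator_def orthant_translate)

lemma orthant_borel [measurable]: "orthant z \<in> sets borel"
  unfolding orthant_def using box_in_borel[of "\<lambda>i. {..z $ i}"] by simp

lemma bdd_borel_orthant: "bdd_borel 1 (orth z)"
  by (auto simp: bdd_borel_def indicator_def)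

section \<open>Numerical sums for the telescoping error\<close>

lemma sum_inverse_power_three_half:
  fixes M N :: nat
  assumes "M \<ge> 1"
  shows "(\<Sum>j=M..N. 1 / (real j * sqrt j)) \<le> 3 / sqrt M"
proof -
  \<comment> \<open>Comparison with the telescoping sequence \<open>2 / sqrt j\<close>; the term
    \<open>j = M\<close> stays outside and accounts for the third unit in
    \<open>3 / sqrt M\<close>.\<close>
  have tele: "1 / (real (Suc j) * sqrt (Suc j)) \<le> 2 / sqrt j - 2 / sqrt (Suc j)" if "j \<ge> 1" for j
  proof -
    define a b where "a = sqrt (real j)" and "b = sqrt (real (Suc j))"
    have ab: "a > 0" "b > 0" "a \<le> b" "b\<^sup>2 = a\<^sup>2 + 1" "real (Suc j) = b\<^sup>2" using that by (auto simp: a_def b_def)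
    have 1: "(b - a) * (b + a) = 1" using ab by (simp add: power2_eq_square algebra_simps)
    have "b - a = 1 / (b + a)" using 1 ab by (simp add: field_simps)
    moreover have "1 / (b + a) \<ge> 1 / (2 * b)" using ab by (intro divide_left_mono) auto
    ultimately have "b - a \<ge> 1 / (2 * b)" by simp
    then have "2 * (b - a) / (a * b) \<ge> 2 * (1 / (2 * b)) / (a * b)"
      using ab by (intro divide_right_mono mult_left_mono) auto
    moreover have "2 * (1 / (2 * b)) / (a * b) = 1 / (b * (a * b))" using ab by (simp add: field_simps)
    moreover have "1 / (b * (a * b)) \<ge> 1 / (b * (b * b))" using ab by (intro divide_left_mono mult_left_mono mult_right_mono) auto
    moreover have "2 * (b - a) / (a * b) = 2 / a - 2 / b" using ab by (simp add: field_simps)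
    ultimately have "1 / (b * (b * b)) \<le> 2 / a - 2 / b" by linarith
    then show ?thesis using ab(2) unfolding ab(5) a_def[symmetric] by (simp add: power2_eq_square mult.assoc)
  qed
  have M: "1 / (real M * sqrt M) \<le> 1 / sqrt M"
    using assms by (intro divide_left_mono) auto
  have "(\<Sum>j=M..N. 1 / (real j * sqrt j)) \<le> 3 / sqrt M - 2 / sqrt N" if "M \<le> N"
    using that
  proof (induction N rule: dec_induct)
    case base
    then show ?case using M by simp
  next
    case (step N)
    have "(\<Sum>j=M..Suc N. 1 / (real j * sqrt j)) = (\<Sum>j=M..N. 1 / (real j * sqrt j)) + 1 / (real (Suc N) * sqrt (Suc N))"
      using step by simp
    then show ?case using step tele[of N] assms by linarith
  qed
  then have "(\<Sum>j=M..N. 1 / (real j * sqrt j)) \<le> 3 / sqrt M" if "M \<le> N"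
    using that order_trans[OF _ diff_left_mono[of 0 "2 / sqrt N" "3 / sqrt M"]] by simp
  then show ?thesis by (cases "M \<le> N") auto
qed

lemma sum_inverse_sqrt: "(\<Sum>k=1..n. 1 / sqrt (real k)) \<le> 2 * sqrt n"
proof (induction n)
  case (Suc n)
  define a b where "a = sqrt (real n)" and "b = sqrt (real (Suc n))"
  have ab: "a \<ge> 0" "b > 0" "a \<le> b" "b\<^sup>2 = a\<^sup>2 + 1" by (auto simp: a_def b_def)
  have 1: "(b - a) * (b + a) = 1" using ab by (simp add: power2_eq_square algebra_simps)
  have "b - a = 1 / (b + a)" using 1 ab by (simp add: field_simps)
  moreover have "1 / (b + a) \<ge> 1 / (2 * b)" using ab by (intro divide_left_mono) auto
  ultimately have "2 * b \<ge> 2 * a + 1 / b" by simp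
  then show ?case using Suc unfolding a_def b_def by (simp del: of_nat_Suc)
qed simp

text \<open>Split at \<open>k = n / 2\<close>. For large \<open>k\<close> the factor
  \<open>1 / sqrt k\<close> is of order \<open>1 / sqrt n\<close> and the other factors sum to at
  most \<open>3 / sqrt M\<close>. For small \<open>k\<close> the other factor is at most
  \<open>2 / (n * sqrt M)\<close> and the \<open>1 / sqrt k\<close> sum to at most
  \<open>2 * sqrt n\<close>. The 9 rounds up 9/2 + 4.\<close>

lemma sum_sqrt_power_three_half:
  fixes M n :: nat
  assumes M: "M \<ge> 1" and n: "n \<ge> 1"
  shows "(\<Sum>k=1..<n. 1 / sqrt (real k) * (1 / (real (n - 1 - k + M) * sqrt (real (n - 1 - k + M))))) \<le> 9 / (sqrt M * sqrt n)"
proof -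
  define g where "g j = 1 / (real j * sqrt (real j))" for j :: nat
  have g0: "g j \<ge> 0" for j by (simp add: g_def)
  have pw: "1 / sqrt (real k) * g (n - 1 - k + M) \<le> 3/2 / sqrt n * g (n - 1 - k + M) + 2 / (n * sqrt M) * (1 / sqrt k)"
    if k: "k \<in> {1..<n}" for k
  proof (cases "2 * k \<ge> n")
    case True
    have "sqrt n \<le> sqrt (2 * real k)" using True by simp
    also have "\<dots> = sqrt 2 * sqrt k" by (rule real_sqrt_mult)
    also have "\<dots> \<le> 3/2 * sqrt k" by (intro mult_right_mono real_le_lsqrt) (auto simp: power2_eq_square)
    finally have "1 / sqrt k \<le> 3/2 / sqrt n" using k n by (simp add: field_simps)
    then have "1 / sqrt (real k) * g (n - 1 - k + M) \<le> 3/2 / sqrt n * g (n - 1 - k + M)"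
      by (intro mult_right_mono g0)
    moreover have "2 / (n * sqrt M) * (1 / sqrt k) \<ge> 0" by simp
    ultimately show ?thesis by linarith
  next
    case False
    define j where "j = n - 1 - k + M"
    have j: "real n / 2 \<le> real j" "real M \<le> real j" using False k M by (auto simp: j_def)
    have "real n / 2 * sqrt M \<le> real j * sqrt j" using j by (intro mult_mono) auto
    then have "g j \<le> 1 / (real n / 2 * sqrt M)"
      unfolding g_def using n M j by (intro divide_left_mono) auto
    then have "1 / sqrt (real k) * g j \<le> 1 / sqrt k * (2 / (n * sqrt M))" by (intro mult_left_mono) auto
    moreover have "3/2 / sqrt n * g j \<ge> 0" using g0 by simp
    ultimately show ?thesis unfolding j_def[symmetric] by (simp add: mult.commute)
  qed
  have "(\<Sum>k=1..<n. 1 / sqrt (real k) * g (n - 1 - k + M))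
     \<le> (\<Sum>k=1..<n. 3/2 / sqrt n * g (n - 1 - k + M) + 2 / (n * sqrt M) * (1 / sqrt k))"
    by (rule sum_mono) (rule pw)
  also have "\<dots> = 3/2 / sqrt n * (\<Sum>k=1..<n. g (n - 1 - k + M)) + 2 / (n * sqrt M) * (\<Sum>k=1..<n. 1 / sqrt k)"
    by (simp only: sum.distrib sum_distrib_left)
  also have "\<dots> \<le> 3/2 / sqrt n * (3 / sqrt M) + 2 / (n * sqrt M) * (2 * sqrt n)"
  proof (intro add_mono mult_left_mono)
    have "(\<Sum>k=1..<n. g (n - 1 - k + M)) = (\<Sum>j\<in>(\<lambda>k. n - 1 - k + M) ` {1..<n}. g j)"
      by (subst sum.reindex) (auto simp: inj_on_def)
    also have "\<dots> \<le> (\<Sum>j=M..n+M. g j)" by (intro sum_mono2) (auto simp: g0)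
    also have "\<dots> \<le> 3 / sqrt M" unfolding g_def by (rule sum_inverse_power_three_half[OF M])
    finally show "(\<Sum>k=1..<n. g (n - 1 - k + M)) \<le> 3 / sqrt M" .
    have "(\<Sum>k=1..<n. 1 / sqrt (real k)) \<le> (\<Sum>k=1..n. 1 / sqrt (real k))" by (intro sum_mono2) auto
    also have "\<dots> \<le> 2 * sqrt n" by (rule sum_inverse_sqrt)
    finally show "(\<Sum>k=1..<n. 1 / sqrt (real k)) \<le> 2 * sqrt n" .
  qed auto
  also have "\<dots> = (9/2 + 4) / (sqrt M * sqrt n)"
  proof -
    have "real n = sqrt n * sqrt n" by simp
    then have "2 / (n * sqrt M) * (2 * sqrt n) = 4 / (sqrt M * sqrt n)" using n M by (simp add: field_simps)
    moreover have "3/2 / sqrt n * (3 / sqrt M) = 9/2 / (sqrt M * sqrt n)" by simp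
    ultimately show ?thesis by (simp add: add_divide_distrib)
  qed
  also have "\<dots> \<le> 9 / (sqrt M * sqrt n)" by (intro divide_right_mono) auto
  finally show ?thesis unfolding g_def .
qed

section \<open>Resampling a single coordinate, and strip estimates\<close>

definition upd :: "real^'n::finite \<Rightarrow> 'n \<Rightarrow> real \<Rightarrow> real^'n" where
  "upd w j t = (\<chi> i. if i = j then t else w $ i)"

lemma upd_measurable [measurable]: "(\<lambda>(w, t). upd w j t) \<in> borel_measurable (std_gauss \<Otimes>\<^sub>M N1)"
  unfolding upd_def case_prod_beta' by (rule borel_measurable_vec_lambda) measurable

lemma upd_measurable' [measurable]: "upd w j \<in> borel_measurable borel"
  unfolding upd_def by measurable

lemma matrix_upd: "(A *v upd w j t) $ i = (A *v upd w j 0) $ i + A $ i $ j * t"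
proof -
  have "(A *v upd w j t) $ i = A $ i $ j * t + (\<Sum>k\<in>UNIV-{j}. A $ i $ k * w $ k)" for t
    unfolding matrix_vector_mult_def upd_def by (simp, subst sum.remove[of _ j], auto)
  then show ?thesis by simp
qed

lemma gauss_resample_nn:
  assumes [measurable]: "f \<in> borel_measurable borel"
  shows "(\<integral>\<^sup>+w. f w \<partial>std_gauss) = (\<integral>\<^sup>+w. \<integral>\<^sup>+t. f (upd w j t) \<partial>N1 \<partial>std_gauss)"
proof -
  interpret pair_prob_space "std_gauss :: (real^'a) measure" N1 ..
  have "(\<integral>\<^sup>+w. f w \<partial>std_gauss) = (\<integral>\<^sup>+w. f w \<partial>distr (std_gauss \<Otimes>\<^sub>M N1) borel (\<lambda>(w, t). upd w j t))"
    by (simp add: upd_def std_gauss_resample)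
  also have "\<dots> = (\<integral>\<^sup>+z. f (case z of (w, t) \<Rightarrow> upd w j t) \<partial>(std_gauss \<Otimes>\<^sub>M N1))"
    by (subst nn_integral_distr) auto
  also have "\<dots> = (\<integral>\<^sup>+w. \<integral>\<^sup>+t. f (upd w j t) \<partial>N1 \<partial>std_gauss)"
    by (subst N1.nn_integral_fst[symmetric]) auto
  finally show ?thesis .
qed

lemma std_normal_density_le_1: "std_normal_density x \<le> 1"
proof -
  have "sqrt (2 * pi) \<ge> 1" using pi_gt3 by simp
  then have "1 / sqrt (2 * pi) * exp (- x\<^sup>2 / 2) \<le> 1 * 1"
    by (intro mult_mono) auto
  then show ?thesis by (simp add: std_normal_density_def)
qed

lemma std_normal_strip:
  assumes c: "c \<noteq> 0" and ab: "a \<le> b"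
  shows "emeasure N1 {t. a < r + c * t \<and> r + c * t \<le> b} \<le> ennreal ((b - a) / \<bar>c\<bar>)"
proof -
  let ?S = "{t. a < r + c * t \<and> r + c * t \<le> b}"
  have "emeasure N1 ?S = (\<integral>\<^sup>+t. ennreal (std_normal_density t) * indicator ?S t \<partial>lborel)"
    unfolding std_normal_measure_def by (rule emeasure_density) auto
  also have "\<dots> \<le> (\<integral>\<^sup>+t. indicator ?S t \<partial>lborel)"
    by (intro nn_integral_mono) (auto simp: indicator_def std_normal_density_le_1)
  also have "\<dots> = emeasure lborel ?S" by simp
  also have "\<dots> = ennreal ((b - a) / \<bar>c\<bar>)"
  proof (cases "c > 0")
    case True
    then have "?S = {(a - r) / c <.. (b - r) / c}" by (auto simp: field_simps)
    moreover have "(a - r) / c \<le> (b - r) / c" using True ab by (simp add: divide_right_mono)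
    ultimately show ?thesis using True by (simp add: diff_divide_distrib)
  next
    case False
    then have "c < 0" using c by simp
    then have "?S = {(b - r) / c ..< (a - r) / c}" by (auto simp: field_simps)
    moreover have "(b - r) / c \<le> (a - r) / c" using \<open>c < 0\<close> ab by (simp add: divide_right_mono_neg)
    ultimately show ?thesis using \<open>c < 0\<close> by (simp add: diff_divide_distrib)
  qed
  finally show ?thesis .
qed

text \<open>Given the other coordinates, the \<open>i\<close>-th component is affine in coordinate
  \<open>j\<close> with slope \<open>A $ i $ j\<close>, and the standard normal density is at most
  1. A single nonzero entry in the row thus bounds the density of that component, whatever the rank
  of \<open>A\<close>.\<close>

lemma gauss_strip:
  fixes A :: "real^'n::finite^'m::finite"
  assumes c: "A $ i $ j \<noteq> 0" and ab: "a \<le> b"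
  shows "measure std_gauss {w. a < (A *v w) $ i \<and> (A *v w) $ i \<le> b} \<le> (b - a) / \<bar>A $ i $ j\<bar>"
proof -
  let ?S = "{w. a < (A *v w) $ i \<and> (A *v w) $ i \<le> b}"
  define J where "J w = {t. a < (A *v upd w j 0) $ i + A $ i $ j * t \<and> (A *v upd w j 0) $ i + A $ i $ j * t \<le> b}" for w
  have [measurable]: "J w \<in> sets borel" for w unfolding J_def by (rule Collect_in_borel) measurable
  have [measurable]: "?S \<in> sets borel" by (rule Collect_in_borel) measurable
  have "emeasure std_gauss ?S = (\<integral>\<^sup>+w. indicator ?S w \<partial>std_gauss)" by simp
  also have "\<dots> = (\<integral>\<^sup>+w. \<integral>\<^sup>+t. indicator ?S (upd w j t) \<partial>N1 \<partial>std_gauss)"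
    by (rule gauss_resample_nn) measurable
  also have "\<dots> = (\<integral>\<^sup>+w. emeasure N1 (J w) \<partial>std_gauss)"
  proof (intro nn_integral_cong)
    fix w
    have "(\<integral>\<^sup>+t. indicator ?S (upd w j t) \<partial>N1)
       = (\<integral>\<^sup>+t. indicator (J w) t \<partial>N1)"
    proof (intro nn_integral_cong)
      fix t
      show "indicator ?S (upd w j t) = (indicator (J w) t :: ennreal)"
        unfolding J_def indicator_def mem_Collect_eq matrix_upd[of A w j t i] ..
    qed
    then show "(\<integral>\<^sup>+t. indicator ?S (upd w j t) \<partial>N1) = emeasure N1 (J w)"
      by simp
  qed
  also have "\<dots> \<le> (\<integral>\<^sup>+w. ennreal ((b - a) / \<bar>A $ i $ j\<bar>) \<partial>(std_gauss :: (real^'n) measure))"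
    unfolding J_def by (intro nn_integral_mono std_normal_strip c ab)
  also have "\<dots> = ennreal ((b - a) / \<bar>A $ i $ j\<bar>)"
    using gauss.emeasure_space_1[where 'n='n] by simp
  finally show ?thesis
    using ab by (simp add: gauss.emeasure_eq_measure ennreal_le_iff)
qed

section \<open>A Berry--Esseen bound for orthants\<close>

lemma matrix_component_le:
  fixes A :: "real^'n::finite^'m::finite"
  shows "\<bar>(A *v w) $ i\<bar> \<le> onorm ((*v) A) * norm w"
proof -
  have "\<bar>(A *v w) $ i\<bar> \<le> norm (A *v w)" by (rule component_le_norm_cart)
  also have "\<dots> \<le> onorm ((*v) A) * norm w" by (rule onorm) (simp add: linear_linear)
  finally show ?thesis .
qed

lemma onorm_matrix_nonneg: "onorm ((*v) (A :: real^'n::finite^'m::finite)) \<ge> 0"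
  by (rule onorm_pos_le) (simp add: linear_linear)

lemma gauss_tight:
  assumes "\<eta> > 0"
  shows "\<exists>R>0. measure std_gauss {w :: real^'n::finite. norm w \<le> R} \<ge> 1 - \<eta>"
proof -
  define S where "S = (\<integral>w. norm w \<partial>(std_gauss :: (real^'n) measure))"
  have S0: "S \<ge> 0" by (simp add: S_def)
  have i: "integrable std_gauss (\<lambda>w::real^'n. norm w)"
    by (rule integrable_std_gauss_poly[where c=1 and k=1]) auto
  \<comment> \<open>Markov's inequality asks for \<open>S \<le> R * \<eta>\<close>; the extra 1
    keeps \<open>R\<close> positive.\<close>
  define R where "R = S / \<eta> + 1"
  have R: "R > 0" using S0 assms by (simp add: R_def add_nonneg_pos)
  have "measure std_gauss {w\<in>space std_gauss. norm (w::real^'n) \<ge> R} \<le> S / R"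
    unfolding S_def using R by (intro integral_Markov_inequality_measure[OF i]) auto
  also have "\<dots> \<le> \<eta>"
    using R S0 assms by (simp add: R_def field_simps)
  finally have "measure std_gauss {w\<in>space std_gauss. norm (w::real^'n) \<ge> R} \<le> \<eta>" .
  moreover have "measure std_gauss {w\<in>space std_gauss. norm (w::real^'n) > R} \<le> measure std_gauss {w\<in>space std_gauss. norm (w::real^'n) \<ge> R}"
    by (intro gauss.finite_measure_mono) auto
  moreover have "measure std_gauss {w :: real^'n. norm w \<le> R} = 1 - measure std_gauss {w\<in>space std_gauss. norm (w::real^'n) > R}"
    using gauss.prob_compl[of "{w::real^'n. norm w \<le> R}"]
    by (auto simp: Compl_eq_Diff_UNIV[symmetric] Collect_neg_eq[symmetric] not_le)
  ultimately show ?thesis using R by (intro exI[of _ R]) auto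
qed

text \<open>A point of one orthant outside the other has a coordinate between the two thresholds, so
  strips cover the difference. The maximum makes a strip empty where the threshold
  decreases.\<close>

lemma gauss_op_orthant_lipschitz:
  fixes A :: "real^'n::finite^'m::finite"
  assumes rows: "\<And>i. \<exists>j. A $ i $ j \<noteq> 0"
  shows "\<exists>\<Lambda>\<ge>0. \<forall>t>0. \<forall>z z'. gauss_op A t (orth z') 0 - gauss_op A t (orth z) 0
           \<le> \<Lambda> / sqrt t * (\<Sum>i\<in>UNIV. \<bar>z' $ i - z $ i\<bar>)"
proof -
  obtain j where j: "\<And>i. A $ i $ j i \<noteq> 0" using rows by metis
  define \<Lambda> where "\<Lambda> = (\<Sum>i\<in>UNIV. 1 / \<bar>A $ i $ j i\<bar>)"
  have \<Lambda>i: "1 / \<bar>A $ i $ j i\<bar> \<le> \<Lambda>" for i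
    unfolding \<Lambda>_def by (rule member_le_sum[of i _ "\<lambda>i. 1 / \<bar>A $ i $ j i\<bar>"]) auto
  have "\<Lambda> \<ge> 0" unfolding \<Lambda>_def by (intro sum_nonneg) auto
  moreover have "gauss_op A t (orth z') 0 - gauss_op A t (orth z) 0
           \<le> \<Lambda> / sqrt t * (\<Sum>i\<in>UNIV. \<bar>z' $ i - z $ i\<bar>)" if t: "t > 0" for t z z'
  proof -
    define S where "S i = {w. z $ i / sqrt t < (A *v w) $ i \<and> (A *v w) $ i \<le> max (z $ i) (z' $ i) / sqrt t}" for i
    have Sm[measurable]: "S i \<in> sets borel" for i unfolding S_def by (rule Collect_in_borel) measurable
    have pw: "indicator (orthant z') (sqrt t *\<^sub>R (A *v w)) - indicator (orthant z) (sqrt t *\<^sub>R (A *v w)) \<le> (\<Sum>i\<in>UNIV. indicator (S i) w :: real)" for w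
    proof (cases "sqrt t *\<^sub>R (A *v w) \<in> orthant z' \<and> sqrt t *\<^sub>R (A *v w) \<notin> orthant z")
      case True
      then obtain i where "\<not> sqrt t * (A *v w) $ i \<le> z $ i" by (auto simp: orthant_def)
      moreover have "sqrt t * (A *v w) $ i \<le> z' $ i" using True by (auto simp: orthant_def)
      ultimately have "w \<in> S i" using t by (auto simp: S_def field_simps)
      then have "1 \<le> (\<Sum>i\<in>UNIV. indicator (S i) w :: real)"
        using member_le_sum[of i UNIV "\<lambda>i. indicator (S i) w :: real"] by auto
      then show ?thesis using True by (simp add: indicator_def)
    next
      case False
      have "0 \<le> (\<Sum>i\<in>UNIV. indicator (S i) w :: real)" by (intro sum_nonneg) auto
      moreover have "indicator (orthant z') (sqrt t *\<^sub>R (A *v w)) - indicator (orthant z) (sqrt t *\<^sub>R (A *v w)) \<le> (0::real)"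
        using False by (auto simp: indicator_def)
      ultimately show ?thesis by linarith
    qed
    have int: "integrable std_gauss (\<lambda>w. indicator (orthant z) (sqrt t *\<^sub>R (A *v w)) :: real)" for z
      using gauss_op_integrable[OF bdd_borel_orthant, where x=0] by simp
    have iS: "integrable std_gauss (\<lambda>w. indicator (S i) w :: real)" for i
      by (rule gauss_integrable_bdd[where K=1]) (auto simp: indicator_def)
    have "gauss_op A t (orth z') 0 - gauss_op A t (orth z) 0
       = (\<integral>w. indicator (orthant z') (sqrt t *\<^sub>R (A *v w)) - indicator (orthant z) (sqrt t *\<^sub>R (A *v w)) \<partial>std_gauss)"
      unfolding gauss_op_def by (simp add: int)
    also have "\<dots> \<le> (\<integral>w. (\<Sum>i\<in>UNIV. indicator (S i) w :: real) \<partial>std_gauss)"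
      by (intro integral_mono Bochner_Integration.integrable_diff int Bochner_Integration.integrable_sum iS pw)
    also have "\<dots> = (\<Sum>i\<in>UNIV. measure std_gauss (S i))" by (simp add: iS)
    also have "\<dots> \<le> (\<Sum>i\<in>UNIV. \<Lambda> / sqrt t * \<bar>z' $ i - z $ i\<bar>)"
    proof (rule sum_mono)
      fix i
      have "measure std_gauss (S i) \<le> (max (z $ i) (z' $ i) / sqrt t - z $ i / sqrt t) / \<bar>A $ i $ j i\<bar>"
        unfolding S_def using t by (intro gauss_strip j divide_right_mono) auto
      also have "\<dots> = (1 / \<bar>A $ i $ j i\<bar>) * ((max (z $ i) (z' $ i) - z $ i) / sqrt t)" by (simp add: diff_divide_distrib)
      also have "\<dots> \<le> \<Lambda> * (\<bar>z' $ i - z $ i\<bar> / sqrt t)"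
        using \<open>\<Lambda> \<ge> 0\<close> t by (intro mult_mono \<Lambda>i divide_right_mono) auto
      finally show "measure std_gauss (S i) \<le> \<Lambda> / sqrt t * \<bar>z' $ i - z $ i\<bar>" by simp
    qed
    finally show ?thesis by (simp add: sum_distrib_left)
  qed
  ultimately show ?thesis by blast
qed

text \<open>The swap estimate is an assumption: the lifted increments serve to derive it, and the
  induction sees the walk and \<open>A\<close> alone.\<close>

locale lindeberg_swap =
  fixes q :: "'c::finite \<Rightarrow> real" and d :: "'c \<Rightarrow> real^'m::finite" and A :: "real^'n::finite^'m" and C :: real
  assumes q: "\<And>c. q c \<ge> 0" "(\<Sum>c\<in>UNIV. q c) = 1"
    and rows: "\<And>i. \<exists>j. A $ i $ j \<noteq> 0"
    and C_nonneg: "C \<ge> 0"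
    and swap: "\<And>j K f x. j > 0 \<Longrightarrow> bdd_borel K f \<Longrightarrow>
       \<bar>step_op q d (gauss_op A j f) x - gauss_op A (j + 1) f x\<bar> \<le> C * K / (j * sqrt j)"
begin

abbreviation "T \<equiv> step_op q d"
abbreviation "G \<equiv> gauss_op A"

lemma bdd_borel_T_pow: "bdd_borel K f \<Longrightarrow> bdd_borel K ((T ^^ k) f)"
  by (induction k) (auto intro: bdd_borel_step_op q)

lemma T_pow_G: "bdd_borel K f \<Longrightarrow> (T ^^ k) (G t f) = G t ((T ^^ k) f)"
  by (induction k) (auto simp: step_op_gauss_op[OF bdd_borel_T_pow])

lemma T_pow_translate: "(T ^^ k) f (x + y) = (T ^^ k) (\<lambda>v. f (x + v)) y"
proof (induction k arbitrary: y)
  case (Suc k)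
  have "(T ^^ Suc k) f (x + y) = (\<Sum>c\<in>UNIV. q c * (T ^^ k) f (x + (y + d c)))"
    by (simp add: step_op_def add_ac)
  also have "\<dots> = (T ^^ Suc k) (\<lambda>v. f (x + v)) y"
    unfolding Suc by (simp add: step_op_def)
  finally show ?case .
qed simp

text \<open>Moving the starting point is the same as moving the threshold. A bound at the origin
  uniform in \<open>z\<close> is thus uniform in the starting point, the form in which the induction
  hypothesis is consumed.\<close>

lemma T_pow_orthant: "(T ^^ k) (orth z) x = (T ^^ k) (indicator (orthant (z - x))) 0"
  using T_pow_translate[of k "indicator (orthant z)" x 0]
  by (simp add: indicator_orthant_translate)

lemma G_orthant: "G t (orth z) x = G t (indicator (orthant (z - x))) 0"
  by (simp add: gauss_op_def indicator_orthant_translate)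

lemma T_pow_mono:
  assumes "\<And>x. f x \<le> g x"
  shows "(T ^^ k) f x \<le> (T ^^ k) g x"
  by (induction k arbitrary: x) (auto simp: step_op_def assms q intro!: sum_mono mult_left_mono)

lemma T_pow_orthant_mono:
  assumes "\<And>i. z $ i \<le> z' $ i"
  shows "(T ^^ k) (orth z) x \<le> (T ^^ k) (orth z') x"
  by (rule T_pow_mono) (auto simp: indicator_def orthant_def intro: order_trans assms)

text \<open>Exchanging step \<open>k\<close> costs \<open>C / (J * sqrt J)\<close> times a sup norm,
  with \<open>J = n - 1 - k + M\<close>. The difference from the Gaussian has norm
  \<open>b k\<close>. The Gaussian part already carries time \<open>k\<close>, so its effective
  smoothing is \<open>J + k = n - 1 + M\<close> for every \<open>k\<close>, which gives the
  \<open>n\<close> equal terms.\<close>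

lemma smoothed_bound:
  assumes f: "bdd_borel 1 f" and M: "M \<ge> 1"
    and b: "\<And>k x. k < n \<Longrightarrow> \<bar>(T ^^ k) f x - G (real k) f x\<bar> \<le> b k"
  shows "\<bar>(T ^^ n) (G (real M) f) x - G (real (n + M)) f x\<bar>
     \<le> (\<Sum>k<n. C * b k / (real (n - 1 - k + M) * sqrt (real (n - 1 - k + M)))) + real n * (C / (real (n - 1 + M) * sqrt (real (n - 1 + M))))"
proof -
  \<comment> \<open>Hybrid with \<open>k\<close> walk steps and Gaussian time
    \<open>n - k + M\<close>; neighbouring hybrids differ by one exchanged step.\<close>
  define a where "a k = (T ^^ k) (G (real (n - k + M)) f) x" for k
  have "(T ^^ n) (G (real M) f) x - G (real (n + M)) f x = a n - a 0" by (simp add: a_def)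
  also have "\<dots> = (\<Sum>k<n. a (Suc k) - a k)" by (rule sum_lessThan_telescope[symmetric])
  also have "\<bar>\<dots>\<bar> \<le> (\<Sum>k<n. \<bar>a (Suc k) - a k\<bar>)" by (rule sum_abs)
  also have "\<dots> \<le> (\<Sum>k<n. C * b k / (real (n - 1 - k + M) * sqrt (real (n - 1 - k + M))) + C / (real (n - 1 + M) * sqrt (real (n - 1 + M))))"
  proof (rule sum_mono)
    fix k assume "k \<in> {..<n}"
    then have k: "k < n" by simp
    define J where "J = n - 1 - k + M"
    have J: "J \<ge> 1" "n - k + M = Suc J" "n - Suc k + M = J" "J + k = n - 1 + M"
      using k M by (auto simp: J_def)
    define g where "g = (T ^^ k) f"
    define h where "h = G (real k) f"
    have g: "bdd_borel 1 g" and h: "bdd_borel 1 h"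
      unfolding g_def h_def by (intro bdd_borel_T_pow bdd_borel_gauss_op f)+
    have gh: "bdd_borel (b k) (\<lambda>x. g x - h x)"
      by (rule bdd_borel_diff[OF g h]) (use b[OF k] in \<open>simp add: g_def h_def\<close>)
    have a1: "a (Suc k) = T (G (real J) g) x"
      unfolding a_def J by (simp add: T_pow_G[OF f] g_def)
    have a2: "a k = G (real J + 1) g x"
      unfolding a_def J by (simp add: T_pow_G[OF f] g_def add.commute)
    have lin1: "T (G (real J) g) x = T (G (real J) (\<lambda>x. g x - h x)) x + T (G (real J) h) x"
      by (simp add: gauss_op_diff[OF g h, abs_def] step_op_diff)
    have lin2: "G (real J + 1) g x = G (real J + 1) (\<lambda>x. g x - h x) x + G (real J + 1) h x"
      by (simp add: gauss_op_diff[OF g h])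
    have h1: "G (real J) h = G (real (J + k)) f" unfolding h_def
      by (subst gauss_op_gauss_op[OF f]) auto
    have h2: "G (real J + 1) h = G (real (J + k) + 1) f" unfolding h_def
      by (subst gauss_op_gauss_op[OF f]) (auto simp: add_ac)
    have "\<bar>T (G (real J) (\<lambda>x. g x - h x)) x - G (real J + 1) (\<lambda>x. g x - h x) x\<bar> \<le> C * b k / (real J * sqrt (real J))"
      using J by (intro swap gh) auto
    moreover have "\<bar>T (G (real (J + k)) f) x - G (real (J + k) + 1) f x\<bar> \<le> C * 1 / (real (J + k) * sqrt (real (J + k)))"
      using J by (intro swap f) auto
    ultimately have "\<bar>a (Suc k) - a k\<bar> \<le> C * b k / (real J * sqrt (real J)) + C * 1 / (real (J + k) * sqrt (real (J + k)))"
      unfolding a1 a2 lin1 lin2 h1 h2 by linarith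
    then show "\<bar>a (Suc k) - a k\<bar> \<le> C * b k / (real (n - 1 - k + M) * sqrt (real (n - 1 - k + M))) + C / (real (n - 1 + M) * sqrt (real (n - 1 + M)))"
      unfolding J(4) by (simp add: J_def)
  qed
  finally show ?thesis by (simp only: sum.distrib sum_constant card_lessThan)
qed


text \<open>A self-bounding argument for the largest discrepancy \<open>\<Delta>\<close>. If the
  threshold moves by \<open>s * a\<close> in every coordinate, the smoothing noise cannot undo the
  move while \<open>norm w \<le> R\<close>, and monotonicity transfers the discrepancy; otherwise,
  with probability at most 1/4, it is bounded by \<open>\<Delta>\<close>. Together with
  \<open>D\<close> and the Lipschitz cost of moving the Gaussian threshold this gives
  \<open>\<Delta> \<le> 4/3 * (D + \<Delta> / 4 + 2 * \<epsilon>)\<close>, which is solved for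
  \<open>\<Delta>\<close>.\<close>

lemma unsmoothing:
  assumes n: "n \<ge> 1"
    and \<Lambda>: "\<Lambda> \<ge> 0" "\<And>t z z'. t > 0 \<Longrightarrow> G t (orth z') 0 - G t (orth z) 0
           \<le> \<Lambda> / sqrt t * (\<Sum>i\<in>UNIV. \<bar>z' $ i - z $ i\<bar>)"
    and R: "R > 0" "measure std_gauss {w :: real^'n. norm w \<le> R} \<ge> 3/4"
    and D: "\<And>z. \<bar>(T ^^ n) (G (real M) (orth z)) 0 - G (real (n + M)) (orth z) 0\<bar> \<le> D"
    and \<epsilon>0: "\<epsilon>0 = \<Lambda> * (CARD('m) * (onorm ((*v) A) * R) + (\<integral>w. (\<Sum>i\<in>UNIV. \<bar>(A *v w) $ i\<bar>) \<partial>std_gauss))"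
  shows "\<bar>(T ^^ n) (orth z) 0 - G (real n) (orth z) 0\<bar> \<le> 2 * D + 4 * \<epsilon>0 * sqrt M / sqrt n"
proof -
  define h where "h z = (T ^^ n) (orth z) 0" for z
  define g where "g z = G (real n) (orth z) 0" for z
  define a where "a = onorm ((*v) A) * R"
  define s where "s = sqrt (real M)"
  \<comment> \<open>Majorant for the change of the Gaussian value under the move and the noise
    together; its mean is \<open>\<epsilon>\<close>.\<close>
  define e where "e w = \<Lambda> / sqrt n * (s * (CARD('m) * a + (\<Sum>i\<in>UNIV. \<bar>(A *v w) $ i\<bar>)))" for w
  define \<epsilon> where "\<epsilon> = \<epsilon>0 * s / sqrt n"
  define \<Omega> where "\<Omega> = {w :: real^'n. norm w \<le> R}"
  define \<omega> where "\<omega> = measure std_gauss \<Omega>"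
  have s0: "s \<ge> 0" by (simp add: s_def)
  have a0: "a \<ge> 0" using R onorm_matrix_nonneg[of A] by (simp add: a_def)
  have \<Omega>m[measurable]: "\<Omega> \<in> sets borel" unfolding \<Omega>_def by measurable
  have i1: "integrable std_gauss (\<lambda>w::real^'n. \<bar>(A *v w) $ i\<bar>)" for i
    by (rule integrable_std_gauss_poly[where c="onorm ((*v) A)" and k=1]) (auto simp: matrix_component_le)
  have ie: "integrable std_gauss e" unfolding e_def
    by (intro integrable_mult_right Bochner_Integration.integrable_add Bochner_Integration.integrable_sum i1) auto
  have Ie: "(\<integral>w. e w \<partial>std_gauss) = \<epsilon>"
    unfolding e_def \<epsilon>_def \<epsilon>0 a_def using gauss.prob_space[where 'n='n] by (simp add: i1 algebra_simps add_divide_distrib)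
  have i\<Omega>: "integrable std_gauss (\<lambda>w. indicator \<Omega> w :: real)"
    by (rule gauss_integrable_bdd[where K=1]) (auto simp: indicator_def)
  have bT: "bdd_borel 1 ((T ^^ n) (orth z))" for z
    by (intro bdd_borel_T_pow bdd_borel_orthant)
  have bG: "bdd_borel 1 (G (real n) (orth z))" for z
    by (intro bdd_borel_gauss_op bdd_borel_orthant)
  have ih: "integrable std_gauss (\<lambda>w. h (z - s *\<^sub>R (A *v w)))" for z
    unfolding h_def T_pow_orthant[symmetric] s_def using gauss_op_integrable[OF bT, where x=0] by simp
  have ig: "integrable std_gauss (\<lambda>w. g (z - s *\<^sub>R (A *v w)))" for z
    unfolding g_def G_orthant[symmetric] s_def using gauss_op_integrable[OF bG, where x=0] by simp
  have Ih: "(T ^^ n) (G (real M) (orth z)) 0 = (\<integral>w. h (z - s *\<^sub>R (A *v w)) \<partial>std_gauss)" for z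
    unfolding T_pow_G[OF bdd_borel_orthant] h_def T_pow_orthant[symmetric] by (simp add: gauss_op_def s_def)
  have Ig: "G (real (n + M)) (orth z) 0 = (\<integral>w. g (z - s *\<^sub>R (A *v w)) \<partial>std_gauss)" for z
  proof -
    have "G (real (n + M)) (orth z) = G (real M) (G (real n) (orth z))"
      by (subst gauss_op_gauss_op[OF bdd_borel_orthant]) (auto simp: add.commute)
    then show ?thesis unfolding g_def G_orthant[symmetric] by (simp add: gauss_op_def s_def)
  qed
  have glip: "\<bar>g z' - g z\<bar> \<le> \<Lambda> / sqrt n * (\<Sum>i\<in>UNIV. \<bar>z' $ i - z $ i\<bar>)" for z z'
    using \<Lambda>(2)[of "real n" z' z] \<Lambda>(2)[of "real n" z z'] n unfolding g_def
    by (simp add: abs_le_iff abs_minus_commute)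
  have gshift: "\<bar>g (z + s *\<^sub>R (\<chi> i. c) - s *\<^sub>R (A *v w)) - g z\<bar> \<le> e w" if "\<bar>c\<bar> = a" for z c w
  proof -
    have "\<bar>(z + s *\<^sub>R (\<chi> i. c) - s *\<^sub>R (A *v w)) $ i - z $ i\<bar> \<le> s * (a + \<bar>(A *v w) $ i\<bar>)" for i
    proof -
      have "(z + s *\<^sub>R (\<chi> i. c) - s *\<^sub>R (A *v w)) $ i - z $ i = s * (c - (A *v w) $ i)" by (simp add: algebra_simps)
      moreover have "\<bar>c - (A *v w) $ i\<bar> \<le> a + \<bar>(A *v w) $ i\<bar>" using that by linarith
      ultimately show ?thesis using s0 by (simp add: abs_mult mult_left_mono)
    qed
    then have "(\<Sum>i\<in>UNIV. \<bar>(z + s *\<^sub>R (\<chi> i. c) - s *\<^sub>R (A *v w)) $ i - z $ i\<bar>) \<le> (\<Sum>i\<in>UNIV. s * (a + \<bar>(A *v w) $ i\<bar>))"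
      by (intro sum_mono)
    also have "\<dots> = s * (CARD('m) * a + (\<Sum>i\<in>UNIV. \<bar>(A *v w) $ i\<bar>))" by (simp add: sum_distrib_left[symmetric] sum.distrib)
    finally have "\<Lambda> / sqrt n * (\<Sum>i\<in>UNIV. \<bar>(z + s *\<^sub>R (\<chi> i. c) - s *\<^sub>R (A *v w)) $ i - z $ i\<bar>) \<le> e w"
      unfolding e_def using \<Lambda> by (intro mult_left_mono) auto
    then show ?thesis using glip order_trans by blast
  qed
  have e0: "e w \<ge> 0" for w using gshift[of a 0 w] a0 by (smt (verit) abs_ge_zero)
  have \<Omega>comp: "\<bar>(A *v w) $ i\<bar> \<le> a" if "w \<in> \<Omega>" for w i
  proof -
    have "\<bar>(A *v w) $ i\<bar> \<le> onorm ((*v) A) * norm w" by (rule matrix_component_le)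
    also have "\<dots> \<le> a" unfolding a_def using that onorm_matrix_nonneg by (intro mult_left_mono) (auto simp: \<Omega>_def)
    finally show ?thesis .
  qed
  have self: "\<bar>h z - g z\<bar> \<le> 4/3 * (D + \<Delta> / 4 + 2 * \<epsilon>)" if \<Delta>: "\<And>z. \<bar>h z - g z\<bar> \<le> \<Delta>" for \<Delta> z
  proof -
    have signed: "\<omega> * (\<sigma> * (h z - g z)) \<le> D + (1 - \<omega>) * \<Delta> + 2 * \<epsilon>" if \<sigma>: "\<sigma> = 1 \<or> \<sigma> = - 1" for \<sigma> :: real
    proof -
      \<comment> \<open>The sign treats both directions at once: up to bound \<open>h - g\<close>
        from above, down to bound it from below.\<close>
      define z' where "z' = z + s *\<^sub>R (\<chi> i. \<sigma> * a)"
      have \<sigma>a: "\<bar>\<sigma> * a\<bar> = a" using \<sigma> a0 by auto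
      have gs: "\<bar>\<sigma> * g (z' - s *\<^sub>R (A *v w)) - \<sigma> * g z\<bar> \<le> e w" for w
        using gshift[OF \<sigma>a, of z w] \<sigma> by (auto simp: z'_def)
      have pw: "indicator \<Omega> w * (\<sigma> * h z) + (1 - indicator \<Omega> w) * (\<sigma> * g z - \<Delta>) - e w \<le> \<sigma> * h (z' - s *\<^sub>R (A *v w))" for w
      proof (cases "w \<in> \<Omega>")
        case True
        have "s * \<bar>(A *v w) $ i\<bar> \<le> s * a" for i using \<Omega>comp[OF True, of i] s0 by (intro mult_left_mono) auto
        then have sA: "\<bar>s * (A *v w) $ i\<bar> \<le> s * a" for i using s0 by (simp add: abs_mult)
        have "(\<sigma> = 1 \<longrightarrow> z $ i \<le> (z' - s *\<^sub>R (A *v w)) $ i) \<and> (\<sigma> = - 1 \<longrightarrow> (z' - s *\<^sub>R (A *v w)) $ i \<le> z $ i)" for i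
          unfolding z'_def using sA[of i] by (auto simp: abs_le_iff)
        then have "\<sigma> * h z \<le> \<sigma> * h (z' - s *\<^sub>R (A *v w))"
          unfolding h_def using \<sigma> by (auto intro!: T_pow_orthant_mono)
        then show ?thesis using True e0[of w] by simp
      next
        case False
        have "\<bar>\<sigma> * h (z' - s *\<^sub>R (A *v w)) - \<sigma> * g (z' - s *\<^sub>R (A *v w))\<bar> \<le> \<Delta>"
          using \<Delta>[of "z' - s *\<^sub>R (A *v w)"] \<sigma> by auto
        then show ?thesis using False gs[of w] by simp
      qed
      have "\<omega> * (\<sigma> * h z) + (1 - \<omega>) * (\<sigma> * g z - \<Delta>) - \<epsilon>
          = (\<integral>w. indicator \<Omega> w * (\<sigma> * h z) + (1 - indicator \<Omega> w) * (\<sigma> * g z - \<Delta>) - e w \<partial>std_gauss)"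
        using gauss.prob_space[where 'n='n] by (simp add: ie Ie i\<Omega> \<omega>_def)
      also have "\<dots> \<le> (\<integral>w. \<sigma> * h (z' - s *\<^sub>R (A *v w)) \<partial>std_gauss)"
        by (intro integral_mono integrable_mult_right ih pw Bochner_Integration.integrable_diff Bochner_Integration.integrable_add
            ie integrable_mult_left i\<Omega>) auto
      also have "\<dots> \<le> D + (\<integral>w. \<sigma> * g (z' - s *\<^sub>R (A *v w)) \<partial>std_gauss)"
        using D[of z'] \<sigma> unfolding Ih Ig by (auto simp: ih ig)
      also have "(\<integral>w. \<sigma> * g (z' - s *\<^sub>R (A *v w)) \<partial>std_gauss) \<le> (\<integral>w. \<sigma> * g z + e w \<partial>std_gauss)"
      proof (intro integral_mono integrable_mult_right ig Bochner_Integration.integrable_add ie)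
        show "\<sigma> * g (z' - s *\<^sub>R (A *v w)) \<le> \<sigma> * g z + e w" for w using gs[of w] by simp
      qed simp
      also have "\<dots> = \<sigma> * g z + \<epsilon>" using gauss.prob_space[where 'n='n] by (simp add: ie Ie)
      finally show ?thesis by (simp add: algebra_simps)
    qed
    have \<omega>: "\<omega> \<ge> 3/4" using R by (simp add: \<omega>_def \<Omega>_def)
    have \<Delta>0: "\<Delta> \<ge> 0" using \<Delta>[of z] by linarith
    have "3/4 * \<bar>h z - g z\<bar> \<le> \<omega> * \<bar>h z - g z\<bar>" using \<omega> by (intro mult_right_mono) auto
    also have "\<dots> \<le> D + (1 - \<omega>) * \<Delta> + 2 * \<epsilon>" using signed[of 1] signed[of "- 1"] by (simp add: abs_if)
    also have "(1 - \<omega>) * \<Delta> \<le> 1/4 * \<Delta>" using \<omega> \<Delta>0 by (intro mult_right_mono) auto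
    finally show ?thesis by simp
  qed
  have bound2: "\<bar>h z - g z\<bar> \<le> 2" for z
    using bdd_borelD(2)[OF bT, of z 0] bdd_borelD(2)[OF bG, of z 0] unfolding h_def g_def by linarith
  \<comment> \<open>The supremum is finite by \<open>bound2\<close>, so a multiple of it can be
    absorbed on the left.\<close>
  define \<Delta> where "\<Delta> = (SUP z. \<bar>h z - g z\<bar>)"
  have bdd: "bdd_above (range (\<lambda>z. \<bar>h z - g z\<bar>))" using bound2 by (intro bdd_aboveI[of _ 2]) auto
  have up: "\<bar>h z - g z\<bar> \<le> \<Delta>" for z unfolding \<Delta>_def by (rule cSUP_upper[OF _ bdd]) simp
  have "\<Delta> \<le> 4/3 * (D + \<Delta> / 4 + 2 * \<epsilon>)" unfolding \<Delta>_def
    by (rule cSUP_least) (use self[OF up] in \<open>auto simp: \<Delta>_def\<close>)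
  then have "\<Delta> \<le> 2 * D + 4 * \<epsilon>" by simp
  then show ?thesis using up[of z] unfolding h_def g_def \<epsilon>_def s_def by simp
qed

theorem berry_esseen_orthants:
  "\<exists>B\<ge>0. \<forall>n z. \<bar>(T ^^ n) (orth z) 0 - G (real n) (orth z) 0\<bar> \<le> B / sqrt n"
proof -
  obtain \<Lambda> where \<Lambda>: "\<Lambda> \<ge> 0" "\<And>t z z'. t > 0 \<Longrightarrow> G t (orth z') 0 - G t (orth z) 0
           \<le> \<Lambda> / sqrt t * (\<Sum>i\<in>UNIV. \<bar>z' $ i - z $ i\<bar>)"
    using gauss_op_orthant_lipschitz[OF rows] by blast
  obtain R where R: "R > 0" "measure std_gauss {w :: real^'n. norm w \<le> R} \<ge> 3/4"
    using gauss_tight[of "1/4", where 'n='n] by auto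
  define \<epsilon>0 where "\<epsilon>0 = \<Lambda> * (CARD('m) * (onorm ((*v) A) * R) + (\<integral>w. (\<Sum>i\<in>UNIV. \<bar>(A *v w) $ i\<bar>) \<partial>std_gauss))"
  have \<epsilon>0: "\<epsilon>0 \<ge> 0" unfolding \<epsilon>0_def using \<Lambda>(1) R onorm_matrix_nonneg[of A]
    by (intro mult_nonneg_nonneg add_nonneg_nonneg integral_nonneg_AE) (auto intro!: sum_nonneg AE_I2)
  \<comment> \<open>Makes \<open>18 * C / sqrt M\<close> at most 1/2, where 18 is twice the 9 of the
    double sum; \<open>M\<close> does not depend on \<open>n\<close>.\<close>
  define M where "M = nat \<lceil>(36 * C)\<^sup>2\<rceil> + 1"
  have M1: "M \<ge> 1" by (simp add: M_def)
  have "(36 * C)\<^sup>2 \<le> real M" unfolding M_def by linarith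
  then have sM: "36 * C \<le> sqrt M" by (rule real_le_rsqrt)
  have sM0: "sqrt M > 0" using M1 by simp
  \<comment> \<open>Twice the part of the error that is free of \<open>B\<close>, namely
    \<open>2 * C + 4 * \<epsilon>0 * sqrt M\<close>; the contraction contributes the other
    half.\<close>
  define B where "B = 4 * C + 8 * \<epsilon>0 * sqrt M"
  have B0: "B \<ge> 0" unfolding B_def using C_nonneg \<epsilon>0 by simp
  have "\<forall>z. \<bar>(T ^^ n) (orth z) 0 - G (real n) (orth z) 0\<bar> \<le> B / sqrt n" for n
  proof (induction n rule: less_induct)
    case (less n)
    show ?case
    proof (cases "n = 0")
      case True
      \<comment> \<open>Both operators are the identity, and \<open>B / sqrt 0\<close> is 0 by the
        convention for division.\<close>
      then show ?thesis by (simp add: gauss_op_0)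
    next
      case False
      then have n: "n \<ge> 1" by simp
      have IH: "\<bar>(T ^^ k) (orth z) x - G (real k) (orth z) x\<bar> \<le> B / sqrt k" if "k < n" for k x z
        unfolding T_pow_orthant[of k z x] G_orthant[of "real k" z x] using less[OF that] by blast
      define D where "D = (9 * C * B / sqrt M + C) / sqrt n"
      have D: "\<bar>(T ^^ n) (G (real M) (orth z)) 0 - G (real (n + M)) (orth z) 0\<bar> \<le> D" for z
      proof -
        have "\<bar>(T ^^ n) (G (real M) (orth z)) 0 - G (real (n + M)) (orth z) 0\<bar>
          \<le> (\<Sum>k<n. C * (B / sqrt k) / (real (n - 1 - k + M) * sqrt (real (n - 1 - k + M)))) + real n * (C / (real (n - 1 + M) * sqrt (real (n - 1 + M))))"
          by (rule smoothed_bound[OF bdd_borel_orthant M1 IH])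
        also have "(\<Sum>k<n. C * (B / sqrt k) / (real (n - 1 - k + M) * sqrt (real (n - 1 - k + M))))
           = C * B * (\<Sum>k=1..<n. 1 / sqrt (real k) * (1 / (real (n - 1 - k + M) * sqrt (real (n - 1 - k + M)))))"
        proof -
          define X where "X k = real (n - 1 - k + M) * sqrt (real (n - 1 - k + M))" for k
          \<comment> \<open>The term \<open>k = 0\<close> vanishes because
            \<open>B / sqrt 0 = 0\<close>, in accordance with exact agreement at time 0.\<close>
          have "{..<n} = insert 0 {1..<n}" using n by auto
          then show ?thesis unfolding X_def[symmetric] by (simp add: sum_distrib_left)
        qed
        also have "\<dots> \<le> C * B * (9 / (sqrt M * sqrt n))"
          using C_nonneg B0 by (intro mult_left_mono sum_sqrt_power_three_half M1 n) auto
        also have "real n * (C / (real (n - 1 + M) * sqrt (real (n - 1 + M)))) \<le> real n * (C / (real n * sqrt (real n)))"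
        proof -
          have "real n \<le> real (n - 1 + M)" using M1 n by linarith
          then show ?thesis using n C_nonneg by (intro mult_left_mono divide_left_mono mult_mono) auto
        qed
        also have "\<dots> = C / sqrt n" using n by simp
        finally show ?thesis unfolding D_def by (simp add: add_divide_distrib mult_ac)
      qed
      show ?thesis
      proof
        fix z
        have "\<bar>(T ^^ n) (orth z) 0 - G (real n) (orth z) 0\<bar> \<le> 2 * D + 4 * \<epsilon>0 * sqrt M / sqrt n"
          by (rule unsmoothing[OF n \<Lambda> R D \<epsilon>0_def])
        also have "\<dots> = (18 * C / sqrt M * B + 2 * C + 4 * \<epsilon>0 * sqrt M) / sqrt n"
          unfolding D_def by (simp add: add_divide_distrib)
        also have "\<dots> \<le> B / sqrt n"
        proof (rule divide_right_mono)
          have "18 * C / sqrt M \<le> 1/2" using sM sM0 by (simp add: divide_le_eq)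
          then have "18 * C / sqrt M * B \<le> 1/2 * B" using B0 by (intro mult_right_mono)
          then show "18 * C / sqrt M * B + 2 * C + 4 * \<epsilon>0 * sqrt M \<le> B" by (simp add: B_def)
        qed simp
        finally show "\<bar>(T ^^ n) (orth z) 0 - G (real n) (orth z) 0\<bar> \<le> B / sqrt n" .
      qed
    qed
  qed
  then show ?thesis using B0 by blast
qed

end

section \<open>Square roots and increments of the Gaussian distribution function\<close>

text \<open>The covariance is the Gram matrix of the vectors \<open>v i\<close>, and row
  \<open>i\<close> of \<open>A\<close> lists the coordinates of \<open>v i\<close> in an orthonormal
  basis of their span. The basis has at most \<open>CARD('m)\<close> elements, so \<open>'m\<close>
  can index it, with zero columns for the rest.\<close>

lemma gram_square_root:
  fixes q :: "'c::finite \<Rightarrow> real" and d :: "'c \<Rightarrow> real^'m::finite"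
  assumes q: "\<And>c. q c \<ge> 0"
  shows "\<exists>A :: real^'m^'m. A ** transpose A = (\<chi> i j. \<Sum>c\<in>UNIV. q c * d c $ i * d c $ j)"
proof -
  define v :: "'m \<Rightarrow> real^'c" where "v i = (\<chi> c. sqrt (q c) * d c $ i)" for i
  have vv: "v i \<bullet> v j = (\<Sum>c\<in>UNIV. q c * d c $ i * d c $ j)" for i j
  proof -
    have "sqrt (q c) * d c $ i * (sqrt (q c) * d c $ j) = q c * d c $ i * d c $ j" for c
      using real_sqrt_mult_self[of "q c"] q[of c] by (simp add: algebra_simps)
    then show ?thesis by (simp only: v_def inner_vec_def vec_lambda_beta inner_real_def)
  qed
  obtain B where B: "pairwise orthogonal B" "\<And>x. x \<in> B \<Longrightarrow> norm x = 1" "independent B"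
      "card B = dim (span (range v))" "span B = span (range v)"
    using orthonormal_basis_subspace[OF subspace_span[of "range v"]] by metis
  have fB: "finite B" using B(3) by (rule independent_imp_finite)
  have "card B \<le> card (range v)" unfolding B(4) dim_span by (rule dim_le_card') simp
  also have "\<dots> \<le> CARD('m)" by (rule card_image_le) simp
  finally obtain e :: "real^'c \<Rightarrow> 'm" where e: "inj_on e B"
    using card_le_inj[OF fB, of "UNIV :: 'm set"] by auto
  define A :: "real^'m^'m" where "A = (\<chi> i k. if k \<in> e ` B then v i \<bullet> inv_into B e k else 0)"
  have "(A ** transpose A) $ i $ j = v i \<bullet> v j" for i j
  proof -
    have "(A ** transpose A) $ i $ j = (\<Sum>k\<in>UNIV. A $ i $ k * A $ j $ k)"
      by (simp add: matrix_matrix_mult_def transpose_def)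
    also have "\<dots> = (\<Sum>k\<in>e ` B. (v i \<bullet> inv_into B e k) * (v j \<bullet> inv_into B e k))"
      by (rule sum.mono_neutral_cong_right) (auto simp: A_def)
    also have "\<dots> = (\<Sum>b\<in>B. (v i \<bullet> b) * (v j \<bullet> b))"
      by (subst sum.reindex[OF e]) (auto simp: e)
    also have "\<dots> = (\<Sum>b\<in>B. (v i \<bullet> b) *\<^sub>R b) \<bullet> v j"
      unfolding inner_sum_left inner_scaleR_left by (simp add: inner_commute)
    also have "(\<Sum>b\<in>B. (v i \<bullet> b) *\<^sub>R b) = v i"
      by (rule orthonormal_basis_expand) (use B fB in \<open>auto intro: span_base\<close>)
    finally show ?thesis .
  qed
  then show ?thesis by (intro exI[of _ A]) (simp add: vec_eq_iff vv)
qed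

text \<open>The increments have preimages \<open>s c\<close> under \<open>A\<close> in the range of
  \<open>transpose A\<close>, whose covariance is the orthogonal projection onto that range. What is
  missing from the identity, the projection onto the kernel of \<open>A\<close>, is supplied by a
  random sign times a scaled vector \<open>z i\<close>; \<open>A\<close> maps it to 0, so the
  increment keeps its law.\<close>

lemma covariance_lift:
  fixes q :: "'c::finite \<Rightarrow> real" and d :: "'c \<Rightarrow> real^'m::finite" and A :: "real^'n::finite^'m"
  assumes q: "\<And>c. q c > 0" "(\<Sum>c\<in>UNIV. q c) = 1" and mean: "(\<Sum>c\<in>UNIV. q c *\<^sub>R d c) = 0"
    and AA: "A ** transpose A = (\<chi> i j. \<Sum>c\<in>UNIV. q c * d c $ i * d c $ j)"
  shows "\<exists>(r :: 'c \<times> 'n \<times> bool \<Rightarrow> real) u.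
     (\<forall>f x. step_op q d f x = (\<Sum>e\<in>UNIV. r e * f (x + A *v u e))) \<and> (\<forall>e. r e \<ge> 0) \<and> (\<Sum>e\<in>UNIV. r e) = 1 \<and>
     (\<forall>k. (\<Sum>e\<in>UNIV. r e * u e $ k) = 0) \<and>
     (\<forall>k l. (\<Sum>e\<in>UNIV. r e * (u e $ k * u e $ l)) = (if k = l then 1 else 0))"
proof -
  have quad: "(transpose A *v x) \<bullet> (transpose A *v y) = (\<Sum>c\<in>UNIV. q c * (d c \<bullet> x) * (d c \<bullet> y))" for x y
  proof -
    have "(transpose A *v x) \<bullet> (transpose A *v y) = x \<bullet> ((A ** transpose A) *v y)"
      by (simp add: dot_lmul_matrix[symmetric] matrix_vector_mul_assoc[symmetric] matrix_transpose_mul vector_transpose_matrix)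
    also have "\<dots> = (\<Sum>i\<in>UNIV. \<Sum>j\<in>UNIV. \<Sum>c\<in>UNIV. q c * (d c $ i * x $ i) * (d c $ j * y $ j))"
      unfolding AA by (simp add: inner_vec_def matrix_vector_mult_def sum_distrib_left sum_distrib_right mult_ac)
    also have "\<dots> = (\<Sum>c\<in>UNIV. \<Sum>i\<in>UNIV. \<Sum>j\<in>UNIV. q c * (d c $ i * x $ i) * (d c $ j * y $ j))"
      by (subst (2) sum.swap, subst sum.swap) simp
    also have "\<dots> = (\<Sum>c\<in>UNIV. q c * (d c \<bullet> x) * (d c \<bullet> y))"
      by (simp add: inner_vec_def sum_distrib_left sum_distrib_right mult_ac)
    finally show ?thesis .
  qed
  have adj: "(transpose A *v a) \<bullet> x = a \<bullet> (A *v x)" for a x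
    by (simp add: dot_lmul_matrix vector_transpose_matrix flip: vector_transpose_matrix)
  note [simp del] = transpose_matrix_vector
  have "\<exists>s a. A *v s = d c \<and> s = transpose A *v a" for c
  proof -
    obtain y o' where yo: "y \<in> span (range ((*v) A))" "\<And>w. w \<in> span (range ((*v) A)) \<Longrightarrow> orthogonal o' w" "d c = y + o'"
      using orthogonal_subspace_decomp_exists by metis
    have span: "span (range ((*v) A)) = range ((*v) A)"
      unfolding span_eq_iff by (rule linear_subspace_image[OF matrix_vector_mul_linear subspace_UNIV])
    have "(transpose A *v o') \<bullet> x = 0" for x
      unfolding adj using yo(2)[unfolded span, of "A *v x"] by (simp add: orthogonal_def)
    then have "transpose A *v o' = 0" by (metis inner_eq_zero_iff)
    \<comment> \<open>The variance in the direction \<open>o'\<close>. Every weight is positive, so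
      each summand vanishes and no \<open>d c\<close> has a component off the range of
      \<open>A\<close>.\<close>
    then have "(\<Sum>c\<in>UNIV. q c * (d c \<bullet> o') * (d c \<bullet> o')) = 0" using quad[of o' o'] by simp
    then have "q c * (d c \<bullet> o') * (d c \<bullet> o') = 0"
      by (subst (asm) sum_nonneg_eq_0_iff) (auto simp: mult.assoc intro!: mult_nonneg_nonneg[OF less_imp_le[OF q(1)]])
    then have "d c \<bullet> o' = 0" using q(1)[of c] by simp
    then have "o' = 0" using yo(2)[OF yo(1)] unfolding yo(3) by (simp add: inner_add_left inner_add_right orthogonal_def inner_commute)
    then obtain s' where s': "A *v s' = d c" using yo span by auto
    \<comment> \<open>Removing the kernel component of a preimage puts it into the range of
      \<open>transpose A\<close>, which later makes it orthogonal to every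
      \<open>z k\<close>.\<close>
    obtain s z where sz: "s \<in> span (range ((*v) (transpose A)))" "\<And>w. w \<in> span (range ((*v) (transpose A))) \<Longrightarrow> orthogonal z w" "s' = s + z"
      using orthogonal_subspace_decomp_exists by metis
    have span': "span (range ((*v) (transpose A))) = range ((*v) (transpose A))"
      unfolding span_eq_iff by (rule linear_subspace_image[OF matrix_vector_mul_linear subspace_UNIV])
    have "a \<bullet> (A *v z) = 0" for a
      unfolding adj[symmetric] using sz(2)[unfolded span', of "transpose A *v a"] by (simp add: orthogonal_def inner_commute)
    then have "A *v z = 0" by (metis inner_eq_zero_iff)
    then have "A *v s = d c" using s' sz(3) by (simp add: matrix_vector_right_distrib)
    moreover have "\<exists>a. s = transpose A *v a" using sz(1) unfolding span' by blast
    ultimately show ?thesis by blast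
  qed
  then obtain s a where s: "\<And>c. A *v s c = d c" "\<And>c. s c = transpose A *v a c" by metis
  have "\<exists>b z. axis k 1 = transpose A *v b + z \<and> A *v z = 0" for k :: 'n
  proof -
    obtain y z where yz: "y \<in> span (range ((*v) (transpose A)))" "\<And>w. w \<in> span (range ((*v) (transpose A))) \<Longrightarrow> orthogonal z w" "axis k 1 = y + z"
      using orthogonal_subspace_decomp_exists by metis
    have span': "span (range ((*v) (transpose A))) = range ((*v) (transpose A))"
      unfolding span_eq_iff by (rule linear_subspace_image[OF matrix_vector_mul_linear subspace_UNIV])
    have "a \<bullet> (A *v z) = 0" for a
      unfolding adj[symmetric] using yz(2)[unfolded span', of "transpose A *v a"] by (simp add: orthogonal_def inner_commute)
    then have "A *v z = 0" by (metis inner_eq_zero_iff)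
    moreover obtain b where "y = transpose A *v b" using yz(1) unfolding span' by blast
    ultimately show ?thesis using yz(3) by blast
  qed
  then obtain b z where bz: "\<And>k. axis k 1 = transpose A *v b k + z k" "\<And>k. A *v z k = 0" by metis
  define y where "y k = transpose A *v b k" for k
  have yk: "axis k 1 = y k + z k" for k using bz by (simp add: y_def)
  have perp: "(transpose A *v a) \<bullet> z k = 0" for a k by (simp add: adj bz)
  have yz0: "y k \<bullet> z l = 0" "z l \<bullet> y k = 0" for k l using perp[of "b k" l] inner_commute[of "z l" "y k"] by (simp_all add: y_def)
  have sz0: "s c \<bullet> z k = 0" for c k by (simp add: s(2) perp)
  have sk: "s c $ k = d c \<bullet> b k" for c k
  proof -
    have "s c $ k = s c \<bullet> (y k + z k)" by (simp add: yk[symmetric] inner_axis)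
    also have "\<dots> = (transpose A *v b k) \<bullet> s c" by (simp add: inner_add_right sz0 y_def inner_commute)
    also have "\<dots> = d c \<bullet> b k" unfolding adj s(1) by (rule inner_commute)
    finally show ?thesis .
  qed
  have covs: "(\<Sum>c\<in>UNIV. q c * (s c $ k * s c $ l)) = y k \<bullet> y l" for k l
    unfolding y_def quad sk by (simp add: mult.assoc)
  have means: "(\<Sum>c\<in>UNIV. q c * s c $ k) = 0" for k
  proof -
    have "(\<Sum>c\<in>UNIV. q c * s c $ k) = (\<Sum>c\<in>UNIV. q c *\<^sub>R d c) \<bullet> b k"
      unfolding sk by (simp add: inner_sum_left)
    then show ?thesis by (simp add: mean)
  qed
  \<comment> \<open>\<open>z\<close> is the matrix of an orthogonal projection, hence symmetric; the
    sum over the noise index thereby becomes an inner product.\<close>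
  have zsym: "z i $ k = z k $ i" for i k
  proof -
    have "z i $ k = z i \<bullet> (y k + z k)" by (simp add: yk[symmetric] inner_axis)
    also have "\<dots> = (y i + z i) \<bullet> z k" by (simp add: inner_add_right inner_add_left yz0)
    also have "\<dots> = z k $ i" by (simp add: yk[symmetric] inner_axis')
    finally show ?thesis .
  qed
  have covz: "(\<Sum>i\<in>UNIV. z i $ k * z i $ l) = z k \<bullet> z l" for k l
    unfolding zsym[of _ k] zsym[of _ l] by (simp add: inner_vec_def)
  have tot: "y k \<bullet> y l + z k \<bullet> z l = (if k = l then 1 else 0)" for k l
  proof -
    have "y k \<bullet> y l + z k \<bullet> z l = (y k + z k) \<bullet> (y l + z l)" by (simp add: inner_add_right inner_add_left yz0)
    also have "\<dots> = (if k = l then 1 else 0)" unfolding yk[symmetric] by (simp add: inner_axis) (simp add: axis_def)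
    finally show ?thesis .
  qed
  define m where "m = real CARD('n)"
  have m: "m > 0" by (simp add: m_def)
  \<comment> \<open>Uniform noise index and fair sign: each \<open>z i\<close> has weight
    \<open>1 / m\<close>, and the factor \<open>sqrt m\<close> in \<open>u\<close>
    compensates.\<close>
  define r :: "'c \<times> 'n \<times> bool \<Rightarrow> real" where "r = (\<lambda>(c, i, b). q c / (2 * m))"
  define u :: "'c \<times> 'n \<times> bool \<Rightarrow> real^'n" where "u = (\<lambda>(c, i, b). s c + (if b then sqrt m else - sqrt m) *\<^sub>R z i)"
  have sum3: "(\<Sum>e\<in>UNIV. F e) = (\<Sum>c\<in>UNIV. \<Sum>i\<in>UNIV. F (c, i, True) + F (c, i, False))" for F :: "'c \<times> 'n \<times> bool \<Rightarrow> real"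
  proof -
    have "(\<Sum>c\<in>UNIV. \<Sum>i\<in>UNIV. \<Sum>b\<in>UNIV. F (c, i, b)) = (\<Sum>e\<in>UNIV. F e)"
      by (simp add: sum.cartesian_product case_prod_unfold)
    then show ?thesis by (simp add: UNIV_bool add.commute)
  qed
  have Au: "A *v u (c, i, b) = d c" for c i b
    unfolding u_def by (simp only: prod.case matrix_vector_right_distrib matrix_vector_mult_scaleR bz(2) s(1) scaleR_zero_right add_0_right)
  have "step_op q d f x = (\<Sum>e\<in>UNIV. r e * f (x + A *v u e))" for f x
    unfolding sum3 using m
    by (simp add: r_def step_op_def Au m_def)
  moreover have "r e \<ge> 0" for e using q(1) m by (auto simp: r_def less_imp_le split: prod.split)
  moreover have "(\<Sum>e\<in>UNIV. r e) = 1"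
    unfolding sum3 using m q(2) by (simp add: r_def m_def)
  moreover have "(\<Sum>e\<in>UNIV. r e * u e $ k) = 0" for k
  proof -
    have "(\<Sum>e\<in>UNIV. r e * u e $ k) = (\<Sum>c\<in>UNIV. \<Sum>i\<in>(UNIV::'n set). q c * s c $ k / m)"
      unfolding sum3 using m by (simp add: r_def u_def field_simps)
    also have "\<dots> = (\<Sum>c\<in>UNIV. q c * s c $ k)" using m by (simp add: m_def)
    finally show ?thesis by (simp add: means)
  qed
  moreover have "(\<Sum>e\<in>UNIV. r e * (u e $ k * u e $ l)) = (if k = l then 1 else 0)" for k l
  proof -
    have pt: "r (c, i, True) * (u (c, i, True) $ k * u (c, i, True) $ l) + r (c, i, False) * (u (c, i, False) $ k * u (c, i, False) $ l)
        = q c * (s c $ k * s c $ l) / m + q c * (z i $ k * z i $ l)" for c i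
    proof -
      have "(s c $ k + sqrt m * z i $ k) * (s c $ l + sqrt m * z i $ l) + (s c $ k - sqrt m * z i $ k) * (s c $ l - sqrt m * z i $ l)
         = 2 * (s c $ k * s c $ l) + 2 * (sqrt m * sqrt m) * (z i $ k * z i $ l)" by (simp add: algebra_simps)
      also have "sqrt m * sqrt m = m" using m by simp
      finally have "q c / (2 * m) * ((s c $ k + sqrt m * z i $ k) * (s c $ l + sqrt m * z i $ l) + (s c $ k - sqrt m * z i $ k) * (s c $ l - sqrt m * z i $ l))
         = q c / (2 * m) * (2 * (s c $ k * s c $ l) + 2 * m * (z i $ k * z i $ l))" by simp
      then show ?thesis using m by (simp add: r_def u_def distrib_left)
    qed
    have "(\<Sum>e\<in>UNIV. r e * (u e $ k * u e $ l)) = (\<Sum>c\<in>UNIV. \<Sum>i\<in>UNIV. q c * (s c $ k * s c $ l) / m + q c * (z i $ k * z i $ l))"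
      unfolding sum3 pt ..
    also have "\<dots> = (\<Sum>c\<in>UNIV. q c * (s c $ k * s c $ l)) + (\<Sum>c\<in>UNIV. q c) * (\<Sum>i\<in>UNIV. z i $ k * z i $ l)"
      using m by (simp add: sum.distrib sum_distrib_left[symmetric] sum_distrib_right[symmetric] m_def)
    also have "\<dots> = (if k = l then 1 else 0)" unfolding covs covz q(2) using tot[of k l] by simp
    finally show ?thesis .
  qed
  ultimately show ?thesis by blast
qed


section \<open>Strict growth of orthant probabilities under a shift of the threshold\<close>

definition gauss_prob :: "real^'n::finite^'m::finite \<Rightarrow> real^'m \<Rightarrow> real" where
  "gauss_prob A z = measure std_gauss {w. A *v w \<in> orthant z}"

lemma gauss_prob_sets [measurable]: "{w. A *v w \<in> orthant z} \<in> sets borel" by (rule Collect_in_borel) measurable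

lemma gauss_op_orthant:
  assumes t: "t > 0"
  shows "gauss_op A t (orth z) 0 = gauss_prob A ((1 / sqrt t) *\<^sub>R z)"
proof -
  have "sqrt t *\<^sub>R (A *v w) \<in> orthant z \<longleftrightarrow> A *v w \<in> orthant ((1 / sqrt t) *\<^sub>R z)" for w
    using t by (simp add: orthant_def field_simps)
  then have "gauss_op A t (orth z) 0 = (\<integral>w. indicator {w. A *v w \<in> orthant ((1 / sqrt t) *\<^sub>R z)} w \<partial>std_gauss)"
    unfolding gauss_op_def by (intro Bochner_Integration.integral_cong) (auto simp: indicator_def)
  then show ?thesis by (simp add: gauss_prob_def)
qed

lemma gauss_prob_mono: "(\<And>i. z $ i \<le> z' $ i) \<Longrightarrow> gauss_prob A z \<le> gauss_prob A z'"
  unfolding gauss_prob_def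
  by (intro gauss.finite_measure_mono) (auto simp: orthant_def intro: order_trans)

lemma std_normal_interval_mass:
  assumes "a \<le> b" "- L \<le> a" "b \<le> L"
  shows "ennreal ((b - a) * std_normal_density L) \<le> emeasure N1 {a<..<b}"
proof -
  have "ennreal ((b - a) * std_normal_density L) = (\<integral>\<^sup>+t. ennreal (std_normal_density L) * indicator {a<..<b} t \<partial>lborel)"
    using assms by (simp add: nn_integral_cmult ennreal_mult' mult.commute)
  also have "\<dots> \<le> (\<integral>\<^sup>+t. ennreal (std_normal_density t) * indicator {a<..<b} t \<partial>lborel)"
  proof (intro nn_integral_mono)
    fix t
    show "ennreal (std_normal_density L) * indicator {a<..<b} t \<le> ennreal (std_normal_density t) * indicator {a<..<b} t"
    proof (cases "t \<in> {a<..<b}")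
      case True
      then have "\<bar>t\<bar> \<le> \<bar>L\<bar>" using assms by auto
      then have "t\<^sup>2 \<le> L\<^sup>2" by (simp add: abs_le_square_iff)
      then have "std_normal_density L \<le> std_normal_density t"
        by (simp add: std_normal_density_def divide_right_mono)
      then show ?thesis using True by (simp add: ennreal_leI)
    qed simp
  qed
  also have "\<dots> = emeasure N1 {a<..<b}"
    unfolding std_normal_measure_def by (rule emeasure_density[symmetric]) auto
  finally show ?thesis .
qed

text \<open>\<open>J\<close> meets the interval from \<open>- K\<close> to \<open>K\<close> and ends
  inside it on one side, so its supremum or infimum lies there. The adjacent interval of length
  \<open>\<rho>\<close> avoids \<open>J\<close> and is reached from \<open>J\<close> by steps
  shorter than \<open>\<rho>\<close>; on it the density is at least its value at
  \<open>K + 1\<close>.\<close>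

lemma std_normal_neighbourhood_mass:
  assumes J: "t0 \<in> J" "\<bar>t0\<bar> \<le> K" and bd: "(\<forall>t\<in>J. t \<le> K) \<or> (\<forall>t\<in>J. - K \<le> t)"
    and \<rho>: "0 \<le> \<rho>" "\<rho> \<le> 1"
    and nb: "\<And>t s. t \<in> J \<Longrightarrow> \<bar>s\<bar> \<le> \<rho> \<Longrightarrow> t + s \<in> J'"
    and m: "J' - J \<in> sets borel"
  shows "ennreal (\<rho> * std_normal_density (K + 1)) \<le> emeasure N1 (J' - J)"
  using bd
proof
  assume up: "\<forall>t\<in>J. t \<le> K"
  then have bdd: "bdd_above J" by (auto intro: bdd_aboveI)
  define r where "r = Sup J"
  have le: "t \<le> r" if "t \<in> J" for t unfolding r_def using that bdd by (rule cSup_upper)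
  have r: "- K \<le> r" "r \<le> K" using le[OF J(1)] J up by (auto simp: r_def intro!: cSup_least)
  have "{r<..<r + \<rho>} \<subseteq> J' - J"
  proof
    fix t assume t: "t \<in> {r<..<r + \<rho>}"
    then have "t - \<rho> < Sup J" by (simp add: r_def)
    then obtain x where x: "x \<in> J" "t - \<rho> < x" using less_cSup_iff[OF _ bdd] J(1) by auto
    have "x + (t - x) \<in> J'" using x t le[OF x(1)] by (intro nb) auto
    then show "t \<in> J' - J" using t le by force
  qed
  then have "emeasure N1 {r<..<r + \<rho>} \<le> emeasure N1 (J' - J)"
    using m by (intro emeasure_mono) auto
  moreover have "ennreal ((r + \<rho> - r) * std_normal_density (K + 1)) \<le> emeasure N1 {r<..<r + \<rho>}"
    using r \<rho> by (intro std_normal_interval_mass) auto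
  ultimately show ?thesis by simp
next
  assume lo: "\<forall>t\<in>J. - K \<le> t"
  then have bdd: "bdd_below J" by (auto intro: bdd_belowI)
  define r where "r = Inf J"
  have le: "r \<le> t" if "t \<in> J" for t unfolding r_def using that bdd by (rule cInf_lower)
  have r: "- K \<le> r" "r \<le> K" using le[OF J(1)] J lo by (auto simp: r_def intro!: cInf_greatest)
  have "{r - \<rho><..<r} \<subseteq> J' - J"
  proof
    fix t assume t: "t \<in> {r - \<rho><..<r}"
    then have "Inf J < t + \<rho>" by (simp add: r_def)
    then obtain x where x: "x \<in> J" "x < t + \<rho>" using cInf_less_iff[OF _ bdd] J(1) by auto
    have "x + (t - x) \<in> J'" using x t le[OF x(1)] by (intro nb) auto
    then show "t \<in> J' - J" using t le by force
  qed
  then have "emeasure N1 {r - \<rho><..<r} \<le> emeasure N1 (J' - J)"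
    using m by (intro emeasure_mono) auto
  moreover have "ennreal ((r - (r - \<rho>)) * std_normal_density (K + 1)) \<le> emeasure N1 {r - \<rho><..<r}"
    using r \<rho> by (intro std_normal_interval_mass) auto
  ultimately show ?thesis by simp
qed

text \<open>Along a coordinate line on which a component with a low threshold varies, the section of
  the orthant ends on one side within \<open>K\<close>, and raising the thresholds by
  \<open>\<delta>\<close> adds an interval of length \<open>\<delta> / B\<close> next to that end.
  Such lines pass through all points of the orthant of norm at most \<open>R\<close>, and these have
  mass at least \<open>\<alpha> / 2\<close>.\<close>

lemma gauss_prob_increment:
  fixes A :: "real^'n::finite^'m::finite"
  assumes rows: "\<And>i. \<exists>j. A $ i $ j \<noteq> 0" and \<alpha>: "0 < \<alpha>" and \<beta>: "\<beta> < 1"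
  shows "\<exists>c>0. \<forall>z \<delta>. 0 \<le> \<delta> \<longrightarrow> \<delta> \<le> 1 \<longrightarrow> \<alpha> \<le> gauss_prob A z \<longrightarrow> gauss_prob A z \<le> \<beta> \<longrightarrow>
     gauss_prob A z + c * \<delta> \<le> gauss_prob A (z + \<delta> *\<^sub>R vec 1)"
proof -
  obtain j where j: "\<And>i. A $ i $ j i \<noteq> 0" using rows by metis
  \<comment> \<open>One bound keeps half of \<open>\<alpha>\<close> for the truncated orthant, the
    other makes the ball heavier than \<open>\<beta>\<close>.\<close>
  define \<eta> where "\<eta> = min (\<alpha> / 2) ((1 - \<beta>) / 2)"
  have "\<eta> > 0" using \<alpha> \<beta> by (simp add: \<eta>_def)
  then obtain R where R: "R > 0" "measure std_gauss {w :: real^'n. norm w \<le> R} \<ge> 1 - \<eta>"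
    using gauss_tight by blast
  define a where "a = onorm ((*v) A) * R"
  have a0: "a \<ge> 0" using R onorm_matrix_nonneg[of A] by (simp add: a_def)
  define \<Lambda> where "\<Lambda> = (\<Sum>i\<in>UNIV. 1 / \<bar>A $ i $ j i\<bar>)"
  have \<Lambda>i: "1 / \<bar>A $ i $ j i\<bar> \<le> \<Lambda>" for i
    unfolding \<Lambda>_def by (rule member_le_sum[of i _ "\<lambda>i. 1 / \<bar>A $ i $ j i\<bar>"]) auto
  have \<Lambda>0: "\<Lambda> \<ge> 0" unfolding \<Lambda>_def by (intro sum_nonneg) auto
  \<comment> \<open>\<open>R\<close> bounds the starting point on the line and
    \<open>2 * a * \<Lambda>\<close> the end of the section: the constant part of the affine
    component is at least \<open>- a\<close> and the threshold is below \<open>a\<close>.\<close>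
  define K where "K = R + 2 * a * \<Lambda>"
  \<comment> \<open>Bounds the speed of every component along every coordinate line, so a move of
    \<open>\<delta> / B\<close> raises none by more than \<open>\<delta>\<close>.\<close>
  define B where "B = 1 + (\<Sum>k\<in>UNIV. \<Sum>l\<in>UNIV. \<bar>A $ k $ l\<bar>)"
  have Bkl: "\<bar>A $ k $ l\<bar> \<le> B" for k l
  proof -
    have "\<bar>A $ k $ l\<bar> \<le> (\<Sum>l\<in>UNIV. \<bar>A $ k $ l\<bar>)" by (rule member_le_sum[of l _ "\<lambda>l. \<bar>A $ k $ l\<bar>"]) auto
    also have "\<dots> \<le> (\<Sum>k\<in>UNIV. \<Sum>l\<in>UNIV. \<bar>A $ k $ l\<bar>)"
      by (rule member_le_sum[of k _ "\<lambda>k. \<Sum>l\<in>UNIV. \<bar>A $ k $ l\<bar>"]) (auto intro: sum_nonneg)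
    finally show ?thesis by (simp add: B_def)
  qed
  have B1: "B \<ge> 1" unfolding B_def by (simp add: sum_nonneg)
  define \<kappa> where "\<kappa> = std_normal_density (K + 1) / B"
  have \<kappa>: "\<kappa> > 0" using B1 by (simp add: \<kappa>_def normal_density_pos)
  have "gauss_prob A z + (\<kappa> * (\<alpha> / 2)) * \<delta> \<le> gauss_prob A (z + \<delta> *\<^sub>R vec 1)"
    if \<delta>: "0 \<le> \<delta>" "\<delta> \<le> 1" and ge: "\<alpha> \<le> gauss_prob A z" and le: "gauss_prob A z \<le> \<beta>" for z \<delta>
  proof -
    define z' where "z' = z + \<delta> *\<^sub>R vec 1"
    have z': "z' $ i = z $ i + \<delta>" for i by (simp add: z'_def)
    have comp: "(A *v w) $ i \<le> a" "\<bar>(A *v w) $ i\<bar> \<le> a" if "norm w \<le> R" for w i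
    proof -
      have "\<bar>(A *v w) $ i\<bar> \<le> onorm ((*v) A) * norm w" by (rule matrix_component_le)
      also have "\<dots> \<le> a" unfolding a_def using that onorm_matrix_nonneg by (intro mult_left_mono) auto
      finally show "\<bar>(A *v w) $ i\<bar> \<le> a" .
      then show "(A *v w) $ i \<le> a" by simp
    qed
    \<comment> \<open>If all thresholds were at least \<open>a\<close>, the orthant would contain
      the image of the whole ball and have probability above \<open>\<beta>\<close>.\<close>
    have "\<exists>i. z $ i < a"
    proof (rule ccontr)
      assume "\<not> (\<exists>i. z $ i < a)"
      then have "{w :: real^'n. norm w \<le> R} \<subseteq> {w. A *v w \<in> orthant z}"
        using comp by (fastforce simp: orthant_def not_less intro: order_trans)
      then have "measure std_gauss {w :: real^'n. norm w \<le> R} \<le> gauss_prob A z"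
        unfolding gauss_prob_def by (intro gauss.finite_measure_mono) auto
      moreover have "1 - \<eta> > \<beta>" using \<beta> by (simp add: \<eta>_def min_def field_simps)
      ultimately show False using R(2) le by linarith
    qed
    then obtain i where i: "z $ i < a" by blast
    define l where "l = j i"
    have c: "A $ i $ l \<noteq> 0" by (simp add: l_def j)
    define E where "E = {w. A *v w \<in> orthant z} \<inter> {w. norm w \<le> R}"
    have Em[measurable]: "E \<in> sets borel" unfolding E_def by measurable
    have mE: "measure std_gauss E \<ge> \<alpha> / 2"
    proof -
      have "measure std_gauss {w. A *v w \<in> orthant z} \<le> measure std_gauss (E \<union> (space std_gauss - {w. norm w \<le> R}))"
        by (intro gauss.finite_measure_mono) (auto simp: E_def)
      also have "\<dots> \<le> measure std_gauss E + measure std_gauss (space std_gauss - {w :: real^'n. norm w \<le> R})"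
        by (intro measure_Un_le) auto
      also have "measure std_gauss (space std_gauss - {w :: real^'n. norm w \<le> R}) = 1 - measure std_gauss {w :: real^'n. norm w \<le> R}"
        by (intro gauss.prob_compl) auto
      finally have "gauss_prob A z \<le> measure std_gauss E + \<eta>" using R by (simp add: gauss_prob_def)
      moreover have "\<eta> \<le> \<alpha> / 2" by (simp add: \<eta>_def)
      ultimately show ?thesis using ge by linarith
    qed
    define S where "S = {w. A *v w \<in> orthant z'} - {w. A *v w \<in> orthant z}"
    have Sm[measurable]: "S \<in> sets borel" unfolding S_def by measurable
    have key: "ennreal (\<kappa> * \<delta>) \<le> emeasure N1 {t. upd w l t \<in> S}" if w: "w \<in> E" for w
    proof -
      define J where "J = {t. A *v upd w l t \<in> orthant z}"
      define J' where "J' = {t. A *v upd w l t \<in> orthant z'}"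
      have wl: "upd w l (w $ l) = w" by (simp add: upd_def vec_eq_iff)
      have nw: "norm w \<le> R" using w by (simp add: E_def)
      have n0: "norm (upd w l 0) \<le> R"
      proof -
        have "norm (upd w l 0) \<le> norm w" by (rule norm_le_componentwise_cart) (simp add: upd_def)
        then show ?thesis using nw by simp
      qed
      have inJ: "w $ l \<in> J" using w by (simp add: J_def wl E_def)
      have K0: "R \<le> K" using a0 \<Lambda>0 by (simp add: K_def)
      have wK: "\<bar>w $ l\<bar> \<le> K" using component_le_norm_cart[of w l] nw K0 by linarith
      have tc: "A $ i $ l * t \<le> 2 * a" if "t \<in> J" for t
      proof -
        have "(A *v upd w l 0) $ i + A $ i $ l * t \<le> z $ i"
          using that unfolding J_def orthant_def matrix_upd[of A w l t, symmetric] by simp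
        then show ?thesis using comp(2)[OF n0, of i] i by linarith
      qed
      have div: "2 * a / \<bar>A $ i $ l\<bar> \<le> K"
      proof -
        have "2 * a * (1 / \<bar>A $ i $ l\<bar>) \<le> 2 * a * \<Lambda>" using \<Lambda>i[of i] a0 unfolding l_def by (intro mult_left_mono) auto
        then show ?thesis using R by (simp add: K_def)
      qed
      have bd: "(\<forall>t\<in>J. t \<le> K) \<or> (\<forall>t\<in>J. - K \<le> t)"
      proof (cases "A $ i $ l > 0")
        case True
        have "t \<le> K" if "t \<in> J" for t
        proof -
          have "t \<le> 2 * a / A $ i $ l" using tc[OF that] True by (simp add: field_simps)
          then show ?thesis using div True by simp
        qed
        then show ?thesis by blast
      next
        case False
        then have neg: "A $ i $ l < 0" using c by simp
        have "- K \<le> t" if "t \<in> J" for t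
        proof -
          have "- t \<le> 2 * a / \<bar>A $ i $ l\<bar>" using tc[OF that] neg by (simp add: field_simps)
          then show ?thesis using div by linarith
        qed
        then show ?thesis by blast
      qed
      have nb: "t + s \<in> J'" if t: "t \<in> J" and s: "\<bar>s\<bar> \<le> \<delta> / B" for t s
      proof -
        have "(A *v upd w l (t + s)) $ k \<le> z' $ k" for k
        proof -
          have "(A *v upd w l (t + s)) $ k = (A *v upd w l t) $ k + A $ k $ l * s"
            unfolding matrix_upd[of A w l "t + s"] matrix_upd[of A w l t] by (simp add: algebra_simps)
          moreover have "(A *v upd w l t) $ k \<le> z $ k" using t by (simp add: J_def orthant_def)
          moreover have "A $ k $ l * s \<le> \<delta>"
          proof -
            have "A $ k $ l * s \<le> \<bar>A $ k $ l\<bar> * \<bar>s\<bar>" by (metis abs_ge_self abs_mult)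
            also have "\<dots> \<le> B * (\<delta> / B)" using Bkl s B1 by (intro mult_mono) auto
            finally show ?thesis using B1 by simp
          qed
          ultimately show ?thesis by (simp add: z')
        qed
        then show ?thesis by (simp add: J'_def orthant_def)
      qed
      have meas: "J' - J \<in> sets borel"
      proof -
        have "{t \<in> space borel. A *v upd w l t \<in> orthant z' \<and> A *v upd w l t \<notin> orthant z} \<in> sets borel" by measurable
        moreover have "J' - J = {t \<in> space borel. A *v upd w l t \<in> orthant z' \<and> A *v upd w l t \<notin> orthant z}"
          by (auto simp: J_def J'_def)
        ultimately show ?thesis by simp
      qed
      have "ennreal (\<delta> / B * std_normal_density (K + 1)) \<le> emeasure N1 (J' - J)"
        by (rule std_normal_neighbourhood_mass[OF inJ wK bd _ _ nb meas]) (use \<delta> B1 in \<open>auto simp: divide_le_eq\<close>)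
      moreover have "J' - J = {t. upd w l t \<in> S}" by (auto simp: J_def J'_def S_def)
      ultimately show ?thesis by (simp add: \<kappa>_def mult.commute)
    qed
    have "ennreal (\<kappa> * \<delta>) * emeasure std_gauss E = (\<integral>\<^sup>+w. ennreal (\<kappa> * \<delta>) * indicator E w \<partial>std_gauss)"
      by (simp add: nn_integral_cmult)
    also have "\<dots> \<le> (\<integral>\<^sup>+w. \<integral>\<^sup>+t. indicator S (upd w l t) \<partial>N1 \<partial>std_gauss)"
    proof (intro nn_integral_mono)
      fix w
      have [measurable]: "{t. upd w l t \<in> S} \<in> sets borel" by (rule Collect_in_borel) measurable
      have "(\<integral>\<^sup>+t. indicator S (upd w l t) \<partial>N1) = (\<integral>\<^sup>+t. indicator {t. upd w l t \<in> S} t \<partial>N1)"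
        by (intro nn_integral_cong) (auto simp: indicator_def)
      also have "\<dots> = emeasure N1 {t. upd w l t \<in> S}" by simp
      finally show "ennreal (\<kappa> * \<delta>) * indicator E w \<le> (\<integral>\<^sup>+t. indicator S (upd w l t) \<partial>N1)"
        using key[of w] by (auto simp: indicator_def)
    qed
    also have "\<dots> = (\<integral>\<^sup>+w. indicator S w \<partial>std_gauss)" by (rule gauss_resample_nn[symmetric]) measurable
    also have "\<dots> = emeasure std_gauss S" by simp
    finally have "\<kappa> * \<delta> * measure std_gauss E \<le> measure std_gauss S"
      using \<kappa> \<delta> by (simp add: gauss.emeasure_eq_measure ennreal_mult'[symmetric])
    moreover have "\<kappa> * \<delta> * (\<alpha> / 2) \<le> \<kappa> * \<delta> * measure std_gauss E"
      using \<kappa> \<delta> mE by (intro mult_left_mono) auto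
    moreover have "measure std_gauss S = gauss_prob A z' - gauss_prob A z"
      unfolding S_def gauss_prob_def using \<delta>(1)
      by (intro gauss.finite_measure_Diff) (auto simp: orthant_def z' intro: order_trans)
    ultimately show ?thesis by (simp add: z'_def algebra_simps)
  qed
  moreover have "\<kappa> * (\<alpha> / 2) > 0" using \<kappa> \<alpha> by simp
  ultimately show ?thesis by blast
qed

section \<open>Slepian--Wolf coding bounds\<close>

lemma finite_seqs: "finite (seqs n :: (nat \<Rightarrow> 'a::finite) set)"
  unfolding seqs_def by (intro finite_PiE) auto

lemma sum_seqs_Suc:
  fixes F :: "(nat \<Rightarrow> 'a::finite) \<Rightarrow> real"
  shows "(\<Sum>x\<in>seqs (Suc n). F x) = (\<Sum>x\<in>seqs n. \<Sum>a\<in>UNIV. F (x(n := a)))"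
proof -
  have "seqs (Suc n) = (\<lambda>(y, g). g(n := y)) ` (UNIV \<times> (seqs n :: (nat \<Rightarrow> 'a) set))"
    unfolding seqs_def lessThan_Suc by (rule PiE_insert_eq)
  moreover have "inj_on (\<lambda>(y, g). g(n := y)) (UNIV \<times> (seqs n :: (nat \<Rightarrow> 'a) set))"
    unfolding seqs_def by (rule inj_combinator) simp
  ultimately have "(\<Sum>x\<in>seqs (Suc n). F x) = (\<Sum>(y, g)\<in>UNIV \<times> seqs n. F (g(n := y)))"
    by (simp add: sum.reindex case_prod_unfold)
  also have "\<dots> = (\<Sum>y\<in>UNIV. \<Sum>g\<in>seqs n. F (g(n := y)))" by (simp add: sum.cartesian_product)
  also have "\<dots> = (\<Sum>x\<in>seqs n. \<Sum>a\<in>UNIV. F (x(n := a)))" by (rule sum.swap)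
  finally show ?thesis .
qed

lemma sum_seqs_prod:
  fixes f :: "nat \<Rightarrow> 'a::finite \<Rightarrow> real"
  shows "(\<Sum>x\<in>seqs n. \<Prod>k<n. f k (x k)) = (\<Prod>k<n. \<Sum>a\<in>UNIV. f k a)"
  unfolding seqs_def by (rule prod_sum_PiE[symmetric]) auto

definition seq_prob :: "('a \<times> 'b \<Rightarrow> real) \<Rightarrow> nat \<Rightarrow> (nat \<Rightarrow> 'a) \<times> (nat \<Rightarrow> 'b) \<Rightarrow> real" where
  "seq_prob p n x = (\<Prod>k<n. p (fst x k, snd x k))"

definition seq_density :: "('a::finite \<times> 'b::finite \<Rightarrow> real) \<Rightarrow> nat \<Rightarrow> (nat \<Rightarrow> 'a) \<times> (nat \<Rightarrow> 'b) \<Rightarrow> real^3" where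
  "seq_density p n x = (\<Sum>k<n. ent_density p (fst x k, snd x k))"

definition seq_pairs :: "nat \<Rightarrow> ((nat \<Rightarrow> 'a) \<times> (nat \<Rightarrow> 'b)) set" where
  "seq_pairs n = seqs n \<times> seqs n"

lemma finite_seq_pairs: "finite (seq_pairs n :: ((nat \<Rightarrow> 'a::finite) \<times> (nat \<Rightarrow> 'b::finite)) set)"
  by (simp add: seq_pairs_def finite_seqs)

lemma sw_error_eq:
  "sw_error p n f1 f2 \<phi> = (\<Sum>x\<in>seq_pairs n. seq_prob p n x * (if \<phi> (f1 (fst x)) (f2 (snd x)) \<noteq> x then 1 else 0))"
  by (simp add: sw_error_def seq_pairs_def seq_prob_def sum.cartesian_product case_prod_unfold)

text \<open>Each counted point carries at least the share \<open>2 powr (- r)\<close> of the mass.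
  The mass \<open>m\<close> is left general because conditional probabilities enter
  unnormalised.\<close>

lemma card_le_powr:
  fixes f :: "'x \<Rightarrow> real"
  assumes A: "finite A" and f: "\<And>x. x \<in> A \<Longrightarrow> f x \<ge> 0" "sum f A \<le> m" and m: "m > 0"
    and P: "\<And>x. x \<in> A \<Longrightarrow> P x \<Longrightarrow> 2 powr (- r) * m \<le> f x"
  shows "real (card {x\<in>A. P x}) \<le> 2 powr r"
proof -
  have "real (card {x\<in>A. P x}) * (2 powr (- r) * m) = (\<Sum>x\<in>{x\<in>A. P x}. 2 powr (- r) * m)" by simp
  also have "\<dots> \<le> sum f {x\<in>A. P x}" using P by (intro sum_mono) auto
  also have "\<dots> \<le> sum f A" using A f(1) by (intro sum_mono2) auto
  also have "\<dots> \<le> m" by (rule f(2))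
  finally have "real (card {x\<in>A. P x}) * 2 powr (- r) \<le> 1" using m by (simp add: mult.assoc[symmetric])
  then show ?thesis by (simp add: powr_minus field_simps)
qed

text \<open>Given the value of \<open>g\<close>, a point has conditional probability at most
  \<open>2 powr (- (a + 2 + \<gamma>))\<close>, and the fibre has at most
  \<open>4 * 2 powr a\<close> points. The 2 in the exponent cancels the 4, which comes from rounding
  the message counts.\<close>

lemma sum_le_powr_by_fibres:
  fixes P :: "'x \<Rightarrow> real" and g :: "'x \<Rightarrow> 'k"
  assumes D: "finite D" "finite K" "g ` D \<subseteq> K"
    and P: "\<And>x. x \<in> D \<Longrightarrow> P x \<le> 2 powr (- (a + 2 + \<gamma>)) * m (g x)"
    and m: "\<And>k. m k \<ge> 0" "sum m K = 1"
    and fibre: "\<And>k. real (card {x\<in>D. g x = k}) \<le> 4 * 2 powr a"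
  shows "sum P D \<le> 2 powr (- \<gamma>)"
proof -
  let ?c = "2 powr (- (a + 2 + \<gamma>))"
  have "sum P D \<le> (\<Sum>x\<in>D. ?c * m (g x))" using P by (rule sum_mono)
  also have "\<dots> = (\<Sum>k\<in>K. \<Sum>x\<in>{x\<in>D. g x = k}. ?c * m (g x))" by (rule sum.group[OF D, symmetric])
  also have "\<dots> = (\<Sum>k\<in>K. real (card {x\<in>D. g x = k}) * (?c * m k))" by simp
  also have "\<dots> \<le> (\<Sum>k\<in>K. (4 * 2 powr a) * (?c * m k))"
    by (intro sum_mono mult_right_mono fibre mult_nonneg_nonneg m) simp
  also have "\<dots> = 4 * 2 powr a * ?c" using m(2) by (simp add: sum_distrib_left[symmetric] mult.assoc[symmetric])
  also have "\<dots> = 2 powr 2 * 2 powr a * ?c" by simp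
  also have "\<dots> = 2 powr (2 + a + - (a + 2 + \<gamma>))" by (simp only: powr_add)
  finally show ?thesis by simp
qed

section \<open>Sequence probabilities and counts of typical sequences\<close>

locale positive_source =
  fixes p :: "'a::finite \<times> 'b::finite \<Rightarrow> real"
  assumes pos: "\<And>x. p x > 0" and total: "(\<Sum>x\<in>UNIV. p x) = 1"
begin

lemma marg_pos: "marg1 p a > 0" "marg2 p b > 0"
  unfolding marg1_def marg2_def by (auto intro!: sum_pos pos)

lemma seq_prob_pos: "seq_prob p n x > 0"
  unfolding seq_prob_def by (intro prod_pos) (simp add: pos)

lemma sum_marg: "(\<Sum>a\<in>UNIV. marg1 p a) = 1" "(\<Sum>b\<in>UNIV. marg2 p b) = 1"
proof -
  show 1: "(\<Sum>a\<in>UNIV. marg1 p a) = 1"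
    unfolding marg1_def using total by (simp add: sum.cartesian_product)
  show "(\<Sum>b\<in>UNIV. marg2 p b) = 1"
    unfolding marg2_def using 1[unfolded marg1_def] by (subst sum.swap)
qed

lemma seq_prob_marg2: "(\<Sum>x1\<in>seqs n. seq_prob p n (x1, x2)) = (\<Prod>k<n. marg2 p (x2 k))"
  unfolding seq_prob_def marg2_def using sum_seqs_prod[of "\<lambda>k a. p (a, x2 k)" n] by simp

lemma seq_prob_marg1: "(\<Sum>x2\<in>seqs n. seq_prob p n (x1, x2)) = (\<Prod>k<n. marg1 p (x1 k))"
  unfolding seq_prob_def marg1_def using sum_seqs_prod[of "\<lambda>k a. p (x1 k, a)" n] by simp

lemma seq_marg_total: "(\<Sum>x1\<in>seqs n. \<Prod>k<n. marg1 p (x1 k)) = 1" "(\<Sum>x2\<in>seqs n. \<Prod>k<n. marg2 p (x2 k)) = 1"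
  using sum_seqs_prod[of "\<lambda>k. marg1 p" n] sum_seqs_prod[of "\<lambda>k. marg2 p" n] by (simp_all add: sum_marg)

lemma seq_prob_total: "(\<Sum>x\<in>seq_pairs n. seq_prob p n x) = 1"
proof -
  have "(\<Sum>x\<in>seq_pairs n. seq_prob p n x) = (\<Sum>x1\<in>seqs n. \<Sum>x2\<in>seqs n. seq_prob p n (x1, x2))"
    by (simp add: seq_pairs_def sum.cartesian_product)
  then show ?thesis using seq_marg_total(1) by (simp add: seq_prob_marg1)
qed

text \<open>The summed densities are negative logarithms of the two conditional probabilities and of
  the joint one. Multiplying by the marginal instead of dividing gives the form that the counting
  lemmas consume.\<close>

lemma seq_density_eq:
  "seq_prob p n x = 2 powr (- (seq_density p n x $ 1)) * (\<Prod>k<n. marg2 p (snd x k))"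
  "seq_prob p n x = 2 powr (- (seq_density p n x $ 2)) * (\<Prod>k<n. marg1 p (fst x k))"
  "seq_prob p n x = 2 powr (- (seq_density p n x $ 3))"
proof -
  have powr_sum: "2 powr (- (\<Sum>k<n. - log 2 (g k))) = (\<Prod>k<n. g k)" if "\<And>k. g k > 0" for g :: "nat \<Rightarrow> real"
    using that by (induction n) (auto simp: powr_add powr_diff powr_minus field_simps)
  show "seq_prob p n x = 2 powr (- (seq_density p n x $ 3))"
    unfolding seq_prob_def seq_density_def ent_density_def
    by (simp add: powr_sum[OF pos] del: sum_negf)
  have 1: "2 powr (- (seq_density p n x $ 1)) = (\<Prod>k<n. p (fst x k, snd x k) / marg2 p (snd x k))"
    unfolding seq_density_def ent_density_def
    by (simp add: powr_sum pos marg_pos del: sum_negf)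
  show "seq_prob p n x = 2 powr (- (seq_density p n x $ 1)) * (\<Prod>k<n. marg2 p (snd x k))"
    unfolding 1 seq_prob_def prod.distrib[symmetric] using marg_pos(2) by (intro prod.cong) (auto simp: less_imp_neq[symmetric])
  have 2: "2 powr (- (seq_density p n x $ 2)) = (\<Prod>k<n. p (fst x k, snd x k) / marg1 p (fst x k))"
    unfolding seq_density_def ent_density_def
    by (simp add: powr_sum pos marg_pos del: sum_negf)
  show "seq_prob p n x = 2 powr (- (seq_density p n x $ 2)) * (\<Prod>k<n. marg1 p (fst x k))"
    unfolding 2 seq_prob_def prod.distrib[symmetric] using marg_pos(1) by (intro prod.cong) (auto simp: less_imp_neq[symmetric])
qed

lemma marg_prod_pos: "(\<Prod>k<n. marg1 p (x1 k)) > 0" "(\<Prod>k<n. marg2 p (x2 k)) > 0"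
  by (auto intro!: prod_pos marg_pos)

text \<open>Given the other source, conditional probabilities sum to 1, and each typical sequence
  has at least \<open>2 powr (- r)\<close>. The next two counts exchange the roles and use the joint
  law.\<close>

lemma typical_card1: "real (card {x1\<in>seqs n. seq_density p n (x1, x2) $ 1 \<le> r}) \<le> 2 powr r"
  by (rule card_le_powr[where f="\<lambda>x1. seq_prob p n (x1, x2)", OF finite_seqs _ _ marg_prod_pos(2)])
     (auto simp: seq_prob_marg2 intro: less_imp_le[OF seq_prob_pos],
      auto simp: seq_density_eq(1) intro!: mult_right_mono less_imp_le[OF marg_prod_pos(2)])

lemma typical_card2: "real (card {x2\<in>seqs n. seq_density p n (x1, x2) $ 2 \<le> r}) \<le> 2 powr r"
  by (rule card_le_powr[where f="\<lambda>x2. seq_prob p n (x1, x2)", OF finite_seqs _ _ marg_prod_pos(1)])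
     (auto simp: seq_prob_marg1 intro: less_imp_le[OF seq_prob_pos],
      auto simp: seq_density_eq(2) intro!: mult_right_mono less_imp_le[OF marg_prod_pos(1)])

lemma typical_card3: "real (card {x\<in>seq_pairs n. seq_density p n x $ 3 \<le> r}) \<le> 2 powr r"
  by (rule card_le_powr[where f="seq_prob p n", OF finite_seq_pairs _ _ zero_less_one])
     (auto simp: seq_prob_total intro: less_imp_le[OF seq_prob_pos], auto simp: seq_density_eq(3))

end

section \<open>Random binning\<close>

lemma card_PiE_collision:
  fixes A :: "'x set" and M :: nat
  assumes A: "finite A" "x \<in> A" "y \<in> A" "x \<noteq> y" and M: "M > 0"
  shows "(\<Sum>f\<in>PiE A (\<lambda>_. {1..M}). if f x = f y then 1 else 0 :: real) = card (PiE A (\<lambda>_. {1..M})) / M"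
proof -
  let ?F = "PiE A (\<lambda>_. {1..M})"
  have fin: "finite ?F" using A by (intro finite_PiE) auto
  \<comment> \<open>Sorted by the common value: two arguments are fixed and
    \<open>card A - 2\<close> values are free, so two distinct points collide with probability
    \<open>1 / M\<close>.\<close>
  have "real (card {f\<in>?F. f x = f y}) = (\<Sum>m\<in>{1..M}. real (card {f\<in>?F. f x = m \<and> f y = m}))"
  proof -
    have "{f\<in>?F. f x = f y} = (\<Union>m\<in>{1..M}. {f\<in>?F. f x = m \<and> f y = m})" using A by (auto simp: PiE_mem)
    then have "card {f\<in>?F. f x = f y} = (\<Sum>m\<in>{1..M}. card {f\<in>?F. f x = m \<and> f y = m})"
      using fin by (simp only:) (rule card_UN_disjoint, auto)
    then show ?thesis by simp
  qed
  also have "\<dots> = (\<Sum>m\<in>{1..M}. real M ^ (card A - 2))"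
  proof (intro sum.cong refl)
    fix m assume m: "m \<in> {1..M}"
    have "{f\<in>?F. f x = m \<and> f y = m} = PiE A (\<lambda>a. if a \<in> {x, y} then {m} else {1..M})"
      using A m by (auto simp: PiE_iff extensional_def split: if_splits)
    then have "card {f\<in>?F. f x = m \<and> f y = m} = (\<Prod>a\<in>A. if a \<in> {x, y} then 1 else M)"
      using A by (simp add: card_PiE if_distrib[of card] cong: if_cong)
    also have "\<dots> = M ^ card (A - {x, y})"
    proof -
      have "A \<inter> - {a. a \<in> {x, y}} = A - {x, y}" by auto
      then show ?thesis using A by (simp only: prod.If_cases) simp
    qed
    also have "card (A - {x, y}) = card A - 2" using A by (subst card_Diff_subset) auto
    finally show "real (card {f\<in>?F. f x = m \<and> f y = m}) = real M ^ (card A - 2)" by simp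
  qed
  also have "\<dots> = real M * real M ^ (card A - 2)" by simp
  also have "\<dots> = card ?F / M"
  proof -
    have "card A \<ge> 2" using card_mono[OF A(1), of "{x, y}"] A by simp
    then obtain m where "card A = 2 + m" by (rule le_Suc_ex[elim_format]) auto
    then show ?thesis using A M by (simp add: card_PiE power_add power2_eq_square)
  qed
  finally show ?thesis using fin by (simp add: sum.If_cases Int_def)
qed

lemma powr_le_msg_size: "2 powr (real n * R) \<le> real (msg_size n R)"
  unfolding msg_size_def by (rule real_nat_ceiling_ge)

lemma msg_size_pos: "msg_size n R > 0"
  using less_le_trans[OF _ powr_le_msg_size, of 0 n R] by simp

lemma msg_size_le:
  assumes "R \<ge> 0"
  shows "real (msg_size n R) \<le> 2 * 2 powr (real n * R)"
proof -
  define y :: real where "y = 2 powr (real n * R)"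
  have y: "y \<ge> 1" unfolding y_def using assms by (intro ge_one_powr_ge_zero) auto
  then have "real (msg_size n R) = of_int \<lceil>y\<rceil>" by (simp add: msg_size_def y_def[symmetric])
  moreover have "of_int \<lceil>y\<rceil> \<le> y + 1" by (rule of_int_ceiling_le_add_one)
  ultimately show ?thesis using y unfolding y_def[symmetric] by linarith
qed

context positive_source
begin

text \<open>The encoders are drawn uniformly from all functions and the error is averaged. Unless
  the source pair is atypical, an error needs a typical rival in the same bins that differs in the
  first component, in the second, or in both. The number of rivals of each kind is bounded by its
  own threshold and divided by the number of bins that separate it, which gives
  \<open>2 powr (- \<gamma>)\<close> three times.\<close>

lemma random_binning:
  fixes R1 R2 \<gamma> :: real and n :: nat
  defines "Typ \<equiv> {x\<in>seq_pairs n. seq_density p n x $ 1 \<le> n * R1 - \<gamma> \<and> seq_density p n x $ 2 \<le> n * R2 - \<gamma>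
      \<and> seq_density p n x $ 3 \<le> n * (R1 + R2) - \<gamma>}"
  shows "\<exists>f1 f2 \<phi>. (\<forall>x\<in>seqs n. f1 x \<in> {1..msg_size n R1}) \<and> (\<forall>x\<in>seqs n. f2 x \<in> {1..msg_size n R2}) \<and>
     (\<forall>m1 m2. \<phi> m1 m2 \<in> seqs n \<times> seqs n) \<and>
     sw_error p n f1 f2 \<phi> \<le> (\<Sum>x\<in>seq_pairs n - Typ. seq_prob p n x) + 3 * 2 powr (- \<gamma>)"
proof -
  define M1 M2 where "M1 = msg_size n R1" and "M2 = msg_size n R2"
  have M0: "M1 > 0" "M2 > 0" by (simp_all add: M1_def M2_def msg_size_pos)
  define F1 :: "((nat \<Rightarrow> 'a) \<Rightarrow> nat) set" where "F1 = PiE (seqs n) (\<lambda>_. {1..M1})"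
  define F2 :: "((nat \<Rightarrow> 'b) \<Rightarrow> nat) set" where "F2 = PiE (seqs n) (\<lambda>_. {1..M2})"
  have finF: "finite F1" "finite F2" by (auto simp: F1_def F2_def finite_seqs intro!: finite_PiE)
  have neF: "F1 \<noteq> {}" "F2 \<noteq> {}" using M0 by (auto simp: F1_def F2_def PiE_eq_empty_iff)
  define N where "N = real (card F1) * real (card F2)"
  have N0: "N > 0" using finF neF by (simp add: N_def card_gt_0_iff)
  define good where "good f1 f2 m1 m2 y \<longleftrightarrow> y \<in> Typ \<and> f1 (fst y) = m1 \<and> f2 (snd y) = m2"
    for f1 :: "(nat \<Rightarrow> 'a) \<Rightarrow> nat" and f2 :: "(nat \<Rightarrow> 'b) \<Rightarrow> nat" and m1 m2 y
  \<comment> \<open>Any typical pair in the bins is chosen. The default still lies in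
    \<open>seqs n \<times> seqs n\<close>, since these sequences must be \<open>undefined\<close>
    outside \<open>{..<n}\<close> and are free inside.\<close>
  define \<phi> where "\<phi> f1 f2 m1 m2 = (if \<exists>y. good f1 f2 m1 m2 y then SOME y. good f1 f2 m1 m2 y else (\<lambda>_. undefined, \<lambda>_. undefined))"
    for f1 f2 m1 m2
  have Typ_sub: "Typ \<subseteq> seq_pairs n" by (auto simp: Typ_def)
  have finT: "finite Typ" using finite_subset[OF Typ_sub finite_seq_pairs] .
  have \<phi>_good: "good f1 f2 m1 m2 (\<phi> f1 f2 m1 m2)" if "good f1 f2 m1 m2 y" for f1 f2 m1 m2 y
  proof -
    have "\<exists>y. good f1 f2 m1 m2 y" using that by blast
    then have "\<phi> f1 f2 m1 m2 = (SOME y. good f1 f2 m1 m2 y)" by (simp only: \<phi>_def if_True)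
    then show ?thesis using someI[of "good f1 f2 m1 m2", OF that] by simp
  qed
  have \<phi>_range: "\<phi> f1 f2 m1 m2 \<in> seqs n \<times> seqs n" for f1 f2 m1 m2
  proof (cases "\<exists>y. good f1 f2 m1 m2 y")
    case True
    then show ?thesis using \<phi>_good Typ_sub unfolding good_def seq_pairs_def by blast
  next
    case False
    then show ?thesis by (auto simp: \<phi>_def seqs_def)
  qed
  define err where "err f1 f2 x = (if \<phi> f1 f2 (f1 (fst x)) (f2 (snd x)) \<noteq> x then 1 else 0 :: real)" for f1 f2 x
  define A1 where "A1 x = {a\<in>seqs n. (a, snd x) \<in> Typ \<and> a \<noteq> fst x}" for x :: "(nat \<Rightarrow> 'a) \<times> (nat \<Rightarrow> 'b)"
  define A2 where "A2 x = {b\<in>seqs n. (fst x, b) \<in> Typ \<and> b \<noteq> snd x}" for x :: "(nat \<Rightarrow> 'a) \<times> (nat \<Rightarrow> 'b)"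
  define A3 where "A3 x = {y\<in>Typ. fst y \<noteq> fst x \<and> snd y \<noteq> snd x}" for x :: "(nat \<Rightarrow> 'a) \<times> (nat \<Rightarrow> 'b)"
  have finA: "finite (A1 x)" "finite (A2 x)" "finite (A3 x)" for x
    using finT by (auto simp: A1_def A2_def A3_def finite_seqs)
  define c1 where "c1 f a a' = (if f a = f a' then 1 else 0 :: real)" for f :: "(nat \<Rightarrow> 'a) \<Rightarrow> nat" and a a'
  define c2 where "c2 f b b' = (if f b = f b' then 1 else 0 :: real)" for f :: "(nat \<Rightarrow> 'b) \<Rightarrow> nat" and b b'
  have c0: "c1 f a a' \<ge> 0" "c2 g b b' \<ge> 0" for f a a' g b b' by (auto simp: c1_def c2_def)
  \<comment> \<open>The union bound as an inequality of real numbers, so that it can be summed over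
    the encoders; the product in the last term then factors over \<open>f1\<close> and
    \<open>f2\<close>.\<close>
  have err_le: "err f1 f2 x \<le> (if x \<in> Typ then 0 else 1) + (\<Sum>a\<in>A1 x. c1 f1 a (fst x)) + (\<Sum>b\<in>A2 x. c2 f2 b (snd x))
      + (\<Sum>y\<in>A3 x. c1 f1 (fst y) (fst x) * c2 f2 (snd y) (snd x))" for f1 f2 x
  proof -
    have s0: "0 \<le> (\<Sum>a\<in>A1 x. c1 f1 a (fst x))" "0 \<le> (\<Sum>b\<in>A2 x. c2 f2 b (snd x))"
       "0 \<le> (\<Sum>y\<in>A3 x. c1 f1 (fst y) (fst x) * c2 f2 (snd y) (snd x))"
      by (auto intro!: sum_nonneg mult_nonneg_nonneg c0)
    show ?thesis
    proof (cases "err f1 f2 x = 1 \<and> x \<in> Typ")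
      case False
      moreover have "err f1 f2 x = 0 \<or> err f1 f2 x = 1" by (auto simp: err_def)
      ultimately show ?thesis using s0 by auto
    next
      case True
      define y where "y = \<phi> f1 f2 (f1 (fst x)) (f2 (snd x))"
      have yx: "y \<noteq> x" using True by (auto simp: err_def y_def split: if_splits)
      have "good f1 f2 (f1 (fst x)) (f2 (snd x)) x" using True by (simp add: good_def)
      then have "good f1 f2 (f1 (fst x)) (f2 (snd x)) y" unfolding y_def by (rule \<phi>_good)
      then have y: "y \<in> Typ" "f1 (fst y) = f1 (fst x)" "f2 (snd y) = f2 (snd x)" by (auto simp: good_def)
      have ys: "fst y \<in> seqs n" "snd y \<in> seqs n" using y(1) Typ_sub by (auto simp: seq_pairs_def)
      consider "fst y \<noteq> fst x" "snd y = snd x" | "fst y = fst x" "snd y \<noteq> snd x" | "fst y \<noteq> fst x" "snd y \<noteq> snd x"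
        using yx by (metis prod_eqI)
      then have "1 \<le> (\<Sum>a\<in>A1 x. c1 f1 a (fst x)) \<or> 1 \<le> (\<Sum>b\<in>A2 x. c2 f2 b (snd x))
         \<or> 1 \<le> (\<Sum>y\<in>A3 x. c1 f1 (fst y) (fst x) * c2 f2 (snd y) (snd x))"
      proof cases
        case 1
        then have "fst y \<in> A1 x" using y ys by (auto simp: A1_def) (metis prod.collapse)
        from member_le_sum[OF this, of "\<lambda>a. c1 f1 a (fst x)"] have "c1 f1 (fst y) (fst x) \<le> (\<Sum>a\<in>A1 x. c1 f1 a (fst x))"
          using finA c0 by auto
        then show ?thesis using y by (simp add: c1_def)
      next
        case 2
        then have "snd y \<in> A2 x" using y ys by (auto simp: A2_def) (metis prod.collapse)
        from member_le_sum[OF this, of "\<lambda>b. c2 f2 b (snd x)"] have "c2 f2 (snd y) (snd x) \<le> (\<Sum>b\<in>A2 x. c2 f2 b (snd x))"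
          using finA c0 by auto
        then show ?thesis using y by (simp add: c2_def)
      next
        case 3
        then have "y \<in> A3 x" using y by (auto simp: A3_def)
        from member_le_sum[OF this, of "\<lambda>y. c1 f1 (fst y) (fst x) * c2 f2 (snd y) (snd x)"]
        have "c1 f1 (fst y) (fst x) * c2 f2 (snd y) (snd x) \<le> (\<Sum>y\<in>A3 x. c1 f1 (fst y) (fst x) * c2 f2 (snd y) (snd x))"
          using finA c0 by auto
        then show ?thesis using y by (simp add: c1_def c2_def)
      qed
      then show ?thesis using s0 True by auto
    qed
  qed
  have col1: "(\<Sum>f\<in>F1. c1 f a a') = card F1 / M1" if "a \<in> seqs n" "a' \<in> seqs n" "a \<noteq> a'" for a a'
    unfolding F1_def c1_def by (rule card_PiE_collision[OF finite_seqs that M0(1)])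
  have col2: "(\<Sum>f\<in>F2. c2 f b b') = card F2 / M2" if "b \<in> seqs n" "b' \<in> seqs n" "b \<noteq> b'" for b b'
    unfolding F2_def c2_def by (rule card_PiE_collision[OF finite_seqs that M0(2)])
  have avg: "(\<Sum>f1\<in>F1. \<Sum>f2\<in>F2. err f1 f2 x) \<le> N * ((if x \<in> Typ then 0 else 1) + 3 * 2 powr (- \<gamma>))" if x: "x \<in> seq_pairs n" for x
  proof -
    have xs: "fst x \<in> seqs n" "snd x \<in> seqs n" using x by (auto simp: seq_pairs_def)
    have t1: "(\<Sum>f1\<in>F1. \<Sum>f2\<in>F2. \<Sum>a\<in>A1 x. c1 f1 a (fst x)) = N * (card (A1 x) / M1)"
    proof -
      have "(\<Sum>f1\<in>F1. \<Sum>f2\<in>F2. \<Sum>a\<in>A1 x. c1 f1 a (fst x)) = card F2 * (\<Sum>f1\<in>F1. \<Sum>a\<in>A1 x. c1 f1 a (fst x))"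
        by (simp add: sum_distrib_left)
      also have "\<dots> = card F2 * (\<Sum>a\<in>A1 x. \<Sum>f1\<in>F1. c1 f1 a (fst x))" by (subst sum.swap) simp
      also have "(\<Sum>a\<in>A1 x. \<Sum>f1\<in>F1. c1 f1 a (fst x)) = (\<Sum>a\<in>A1 x. card F1 / M1)"
        by (intro sum.cong refl col1) (auto simp: A1_def xs)
      finally show ?thesis by (simp add: N_def)
    qed
    have t2: "(\<Sum>f1\<in>F1. \<Sum>f2\<in>F2. \<Sum>b\<in>A2 x. c2 f2 b (snd x)) = N * (card (A2 x) / M2)"
    proof -
      have "(\<Sum>f1\<in>F1. \<Sum>f2\<in>F2. \<Sum>b\<in>A2 x. c2 f2 b (snd x)) = card F1 * (\<Sum>b\<in>A2 x. \<Sum>f2\<in>F2. c2 f2 b (snd x))"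
        by (subst sum.swap[of _ "A2 x"]) simp
      also have "(\<Sum>b\<in>A2 x. \<Sum>f2\<in>F2. c2 f2 b (snd x)) = (\<Sum>b\<in>A2 x. card F2 / M2)"
        by (intro sum.cong refl col2) (auto simp: A2_def xs)
      finally show ?thesis by (simp add: N_def)
    qed
    have t3: "(\<Sum>f1\<in>F1. \<Sum>f2\<in>F2. \<Sum>y\<in>A3 x. c1 f1 (fst y) (fst x) * c2 f2 (snd y) (snd x)) = N * (card (A3 x) / (real M1 * M2))"
    proof -
      have "(\<Sum>f1\<in>F1. \<Sum>f2\<in>F2. \<Sum>y\<in>A3 x. c1 f1 (fst y) (fst x) * c2 f2 (snd y) (snd x))
         = (\<Sum>y\<in>A3 x. \<Sum>f1\<in>F1. \<Sum>f2\<in>F2. c1 f1 (fst y) (fst x) * c2 f2 (snd y) (snd x))"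
      proof -
        have "(\<Sum>f1\<in>F1. \<Sum>f2\<in>F2. \<Sum>y\<in>A3 x. c1 f1 (fst y) (fst x) * c2 f2 (snd y) (snd x))
          = (\<Sum>f1\<in>F1. \<Sum>y\<in>A3 x. \<Sum>f2\<in>F2. c1 f1 (fst y) (fst x) * c2 f2 (snd y) (snd x))"
          by (rule sum.cong[OF refl], rule sum.swap)
        also have "\<dots> = (\<Sum>y\<in>A3 x. \<Sum>f1\<in>F1. \<Sum>f2\<in>F2. c1 f1 (fst y) (fst x) * c2 f2 (snd y) (snd x))" by (rule sum.swap)
        finally show ?thesis .
      qed
      also have "\<dots> = (\<Sum>y\<in>A3 x. (\<Sum>f1\<in>F1. c1 f1 (fst y) (fst x)) * (\<Sum>f2\<in>F2. c2 f2 (snd y) (snd x)))"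
        by (simp add: sum_product)
      also have "\<dots> = (\<Sum>y\<in>A3 x. (card F1 / M1) * (card F2 / M2))"
      proof (intro sum.cong refl arg_cong2[where f="(*)"])
        fix y assume y: "y \<in> A3 x"
        then have "fst y \<in> seqs n" "snd y \<in> seqs n" using Typ_sub by (auto simp: A3_def seq_pairs_def)
        then show "(\<Sum>f1\<in>F1. c1 f1 (fst y) (fst x)) = card F1 / M1" "(\<Sum>f2\<in>F2. c2 f2 (snd y) (snd x)) = card F2 / M2"
          using y xs by (auto intro!: col1 col2 simp: A3_def)
      qed
      finally show ?thesis by (simp add: N_def)
    qed
    have frac: "r / m \<le> 2 powr (- \<gamma>)" if "r \<le> 2 powr (s - \<gamma>)" "2 powr s \<le> m" for r s m :: real
    proof -
      have m0: "m > 0" using that(2) by (rule less_le_trans[rotated]) simp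
      have "r \<le> 2 powr (- \<gamma>) * 2 powr s" using that(1) by (simp add: powr_add[symmetric])
      also have "\<dots> \<le> 2 powr (- \<gamma>) * m" using that(2) by (intro mult_left_mono) auto
      finally show ?thesis using m0 by (simp add: divide_le_eq)
    qed
    have b1: "card (A1 x) / M1 \<le> 2 powr (- \<gamma>)"
    proof (rule frac)
      have "card (A1 x) \<le> card {x1\<in>seqs n. seq_density p n (x1, snd x) $ 1 \<le> n * R1 - \<gamma>}"
        by (intro card_mono) (auto simp: A1_def Typ_def finite_seqs)
      then show "real (card (A1 x)) \<le> 2 powr (n * R1 - \<gamma>)" using typical_card1[of n "snd x" "n * R1 - \<gamma>"] by linarith
    qed (simp add: M1_def powr_le_msg_size)
    have b2: "card (A2 x) / M2 \<le> 2 powr (- \<gamma>)"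
    proof (rule frac)
      have "card (A2 x) \<le> card {x2\<in>seqs n. seq_density p n (fst x, x2) $ 2 \<le> n * R2 - \<gamma>}"
        by (intro card_mono) (auto simp: A2_def Typ_def finite_seqs)
      then show "real (card (A2 x)) \<le> 2 powr (n * R2 - \<gamma>)" using typical_card2[of n "fst x" "n * R2 - \<gamma>"] by linarith
    qed (simp add: M2_def powr_le_msg_size)
    have b3: "card (A3 x) / (real M1 * M2) \<le> 2 powr (- \<gamma>)"
    proof (rule frac)
      have "card (A3 x) \<le> card {x\<in>seq_pairs n. seq_density p n x $ 3 \<le> n * (R1 + R2) - \<gamma>}"
        by (intro card_mono) (auto simp: A3_def Typ_def finite_seq_pairs)
      then show "real (card (A3 x)) \<le> 2 powr (n * (R1 + R2) - \<gamma>)" using typical_card3[of n "n * (R1 + R2) - \<gamma>"] by linarith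
      have "2 powr (n * (R1 + R2)) = 2 powr (n * R1) * 2 powr (n * R2)" by (simp add: distrib_left powr_add)
      also have "\<dots> \<le> real M1 * real M2" unfolding M1_def M2_def by (intro mult_mono powr_le_msg_size) auto
      finally show "2 powr (n * (R1 + R2)) \<le> real M1 * real M2" .
    qed
    have "(\<Sum>f1\<in>F1. \<Sum>f2\<in>F2. err f1 f2 x) \<le> (\<Sum>f1\<in>F1. \<Sum>f2\<in>F2. (if x \<in> Typ then 0 else 1) + (\<Sum>a\<in>A1 x. c1 f1 a (fst x)) + (\<Sum>b\<in>A2 x. c2 f2 b (snd x))
      + (\<Sum>y\<in>A3 x. c1 f1 (fst y) (fst x) * c2 f2 (snd y) (snd x)))"
      by (intro sum_mono err_le)
    also have "\<dots> = N * (if x \<in> Typ then 0 else 1) + N * (card (A1 x) / M1) + N * (card (A2 x) / M2) + N * (card (A3 x) / (real M1 * M2))"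
      unfolding t1[symmetric] t2[symmetric] t3[symmetric] by (simp only: sum.distrib) (simp add: N_def)
    also have "\<dots> = N * ((if x \<in> Typ then 0 else 1) + (card (A1 x) / M1 + card (A2 x) / M2 + card (A3 x) / (real M1 * M2)))"
      by (simp only: distrib_left add.assoc)
    also have "\<dots> \<le> N * ((if x \<in> Typ then 0 else 1) + 3 * 2 powr (- \<gamma>))"
      using b1 b2 b3 N0 by (intro mult_left_mono) linarith+
    finally show ?thesis .
  qed
  define bound where "bound = (\<Sum>x\<in>seq_pairs n - Typ. seq_prob p n x) + 3 * 2 powr (- \<gamma>)"
  have sw: "sw_error p n f1 f2 (\<phi> f1 f2) = (\<Sum>x\<in>seq_pairs n. seq_prob p n x * err f1 f2 x)" for f1 f2
    unfolding sw_error_eq err_def ..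
  have "(\<Sum>f1\<in>F1. \<Sum>f2\<in>F2. sw_error p n f1 f2 (\<phi> f1 f2)) = (\<Sum>x\<in>seq_pairs n. seq_prob p n x * (\<Sum>f1\<in>F1. \<Sum>f2\<in>F2. err f1 f2 x))"
  proof -
    have "(\<Sum>f1\<in>F1. \<Sum>f2\<in>F2. sw_error p n f1 f2 (\<phi> f1 f2)) = (\<Sum>f1\<in>F1. \<Sum>x\<in>seq_pairs n. \<Sum>f2\<in>F2. seq_prob p n x * err f1 f2 x)"
      unfolding sw by (rule sum.cong[OF refl], rule sum.swap)
    also have "\<dots> = (\<Sum>x\<in>seq_pairs n. \<Sum>f1\<in>F1. \<Sum>f2\<in>F2. seq_prob p n x * err f1 f2 x)" by (rule sum.swap)
    finally show ?thesis by (simp add: sum_distrib_left)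
  qed
  also have "\<dots> \<le> (\<Sum>x\<in>seq_pairs n. seq_prob p n x * (N * ((if x \<in> Typ then 0 else 1) + 3 * 2 powr (- \<gamma>))))"
    by (intro sum_mono mult_left_mono avg less_imp_le seq_prob_pos)
  also have "\<dots> = N * ((\<Sum>x\<in>seq_pairs n. seq_prob p n x * (if x \<in> Typ then 0 else 1)) + (\<Sum>x\<in>seq_pairs n. seq_prob p n x) * (3 * 2 powr (- \<gamma>)))"
  proof -
    have "(\<Sum>x\<in>seq_pairs n. seq_prob p n x * (N * ((if x \<in> Typ then 0 else 1) + 3 * 2 powr (- \<gamma>))))
       = (\<Sum>x\<in>seq_pairs n. N * (seq_prob p n x * (if x \<in> Typ then 0 else 1) + seq_prob p n x * (3 * 2 powr (- \<gamma>))))"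
      by (rule sum.cong[OF refl]) (simp add: distrib_left)
    then show ?thesis by (simp only: sum_distrib_left[symmetric] sum_distrib_right[symmetric] sum.distrib)
  qed
  also have "(\<Sum>x\<in>seq_pairs n. seq_prob p n x * (if x \<in> Typ then 0 else 1)) = (\<Sum>x\<in>seq_pairs n - Typ. seq_prob p n x)"
    by (rule sum.mono_neutral_cong_right) (auto simp: finite_seq_pairs)
  finally have total_le: "(\<Sum>f1\<in>F1. \<Sum>f2\<in>F2. sw_error p n f1 f2 (\<phi> f1 f2)) \<le> N * bound"
    by (simp add: seq_prob_total bound_def)
  \<comment> \<open>If every pair of encoders exceeded the bound, so would the average.\<close>
  have "\<exists>f1\<in>F1. \<exists>f2\<in>F2. sw_error p n f1 f2 (\<phi> f1 f2) \<le> bound"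
  proof (rule ccontr)
    assume "\<not> ?thesis"
    then have gt: "bound < sw_error p n f1 f2 (\<phi> f1 f2)" if "f1 \<in> F1" "f2 \<in> F2" for f1 f2 using that by force
    have "(\<Sum>f1\<in>F1. \<Sum>f2\<in>F2. bound) < (\<Sum>f1\<in>F1. \<Sum>f2\<in>F2. sw_error p n f1 f2 (\<phi> f1 f2))"
      by (intro sum_strict_mono finF neF gt)
    then show False using total_le by (simp add: N_def)
  qed
  then obtain f1 f2 where f: "f1 \<in> F1" "f2 \<in> F2" "sw_error p n f1 f2 (\<phi> f1 f2) \<le> bound" by blast
  have "\<forall>x\<in>seqs n. f1 x \<in> {1..msg_size n R1}" "\<forall>x\<in>seqs n. f2 x \<in> {1..msg_size n R2}"
    using f(1,2) unfolding F1_def F2_def M1_def M2_def by blast+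
  then show ?thesis using f(3) \<phi>_range unfolding bound_def by blast
qed

text \<open>On the set \<open>D\<close> of correctly decoded pairs the two messages determine the
  source pair. With one source fixed, \<open>D\<close> therefore holds at most as many sequences as
  the other encoder has messages, and the pairs of \<open>D\<close> that violate a threshold are few
  and individually improbable.\<close>

lemma converse_bound:
  fixes R1 R2 \<gamma> :: real
  assumes ach: "sw_achievable p n \<epsilon> R1 R2"
  shows "1 - \<epsilon> \<le> (\<Sum>x\<in>{x\<in>seq_pairs n. seq_density p n x $ 1 \<le> n * R1 + 2 + \<gamma> \<and> seq_density p n x $ 2 \<le> n * R2 + 2 + \<gamma>
      \<and> seq_density p n x $ 3 \<le> n * (R1 + R2) + 2 + \<gamma>}. seq_prob p n x) + 3 * 2 powr (- \<gamma>)"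
proof -
  obtain f1 f2 \<phi> where R: "R1 \<ge> 0" "R2 \<ge> 0" and f: "\<forall>x\<in>seqs n. f1 x \<in> {1..msg_size n R1}" "\<forall>x\<in>seqs n. f2 x \<in> {1..msg_size n R2}"
     and e: "sw_error p n f1 f2 \<phi> \<le> \<epsilon>"
    using ach unfolding sw_achievable_def by blast
  define D where "D = {x\<in>seq_pairs n. \<phi> (f1 (fst x)) (f2 (snd x)) = x}"
  have finD: "finite D" unfolding D_def using finite_seq_pairs by (rule finite_subset[rotated]) auto
  define t1 t2 t3 where "t1 = n * R1 + 2 + \<gamma>" and "t2 = n * R2 + 2 + \<gamma>" and "t3 = n * (R1 + R2) + 2 + \<gamma>"
  define Typ where "Typ = {x\<in>seq_pairs n. seq_density p n x $ 1 \<le> t1 \<and> seq_density p n x $ 2 \<le> t2 \<and> seq_density p n x $ 3 \<le> t3}"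
  let ?P = "\<lambda>S. \<Sum>x\<in>S. seq_prob p n x"
  have "sw_error p n f1 f2 \<phi> = ?P (seq_pairs n - D)"
    unfolding sw_error_eq by (rule sum.mono_neutral_cong_right) (auto simp: finite_seq_pairs D_def)
  also have "\<dots> = 1 - ?P D"
  proof -
    have "D \<subseteq> seq_pairs n" by (auto simp: D_def)
    from sum.subset_diff[OF this finite_seq_pairs, of "seq_prob p n"] show ?thesis by (simp add: seq_prob_total)
  qed
  finally have PD: "1 - \<epsilon> \<le> ?P D" using e by linarith
  define D1 where "D1 = {x\<in>D. seq_density p n x $ 1 > t1}"
  define D2 where "D2 = {x\<in>D. seq_density p n x $ 2 > t2}"
  define D3 where "D3 = {x\<in>D. seq_density p n x $ 3 > t3}"
  have finDs: "finite D1" "finite D2" "finite D3" "finite Typ"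
    using finD finite_seq_pairs by (auto simp: D1_def D2_def D3_def Typ_def intro: finite_subset)
  have nn: "0 \<le> seq_prob p n x" for x using seq_prob_pos less_imp_le by blast
  have un: "?P (S \<union> S') \<le> ?P S + ?P S'" if "finite S" "finite S'" for S S'
    using sum.union_inter[OF that, of "seq_prob p n"] sum_nonneg[of "S \<inter> S'" "seq_prob p n", OF nn] by linarith
  have inj: "x = y" if "x \<in> D" "y \<in> D" "f1 (fst x) = f1 (fst y)" "f2 (snd x) = f2 (snd y)" for x y
    using that by (auto simp: D_def)
  have enc: "f1 (fst x) \<in> {1..msg_size n R1}" "f2 (snd x) \<in> {1..msg_size n R2}" "fst x \<in> seqs n" "snd x \<in> seqs n" if "x \<in> D" for x
    using that f by (auto simp: D_def seq_pairs_def)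
  have "?P D \<le> ?P (Typ \<union> D1 \<union> D2 \<union> D3)"
  proof (rule sum_mono2)
    show "finite (Typ \<union> D1 \<union> D2 \<union> D3)" using finDs by simp
    show "D \<subseteq> Typ \<union> D1 \<union> D2 \<union> D3" by (auto simp: D1_def D2_def D3_def Typ_def D_def)
  qed (rule nn)
  also have "\<dots> \<le> ?P Typ + ?P D1 + ?P D2 + ?P D3"
    using un[of "Typ \<union> D1 \<union> D2" D3] un[of "Typ \<union> D1" D2] un[of Typ D1] finDs by simp
  also have "?P D1 \<le> 2 powr (- \<gamma>)"
  proof (rule sum_le_powr_by_fibres[where g=snd and m="\<lambda>b. \<Prod>k<n. marg2 p (b k)", OF finDs(1) finite_seqs])
    show "snd ` D1 \<subseteq> seqs n" using enc(4) unfolding D1_def by blast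
    show "seq_prob p n x \<le> 2 powr (- (n * R1 + 2 + \<gamma>)) * (\<Prod>k<n. marg2 p (snd x k))" if "x \<in> D1" for x
      using that by (auto simp: seq_density_eq(1) D1_def t1_def intro!: mult_right_mono less_imp_le[OF marg_prod_pos(2)])
    fix b
    have "card {x\<in>D1. snd x = b} \<le> card {1..msg_size n R1}"
    proof (rule card_inj_on_le[where f="f1 \<circ> fst"])
      show "inj_on (f1 \<circ> fst) {x\<in>D1. snd x = b}" by (rule inj_onI, rule inj) (auto simp: D1_def)
    qed (use enc(1,2) in \<open>auto simp: D1_def\<close>)
    then show "real (card {x\<in>D1. snd x = b}) \<le> 4 * 2 powr (n * R1)"
      using msg_size_le[OF R(1), of n] powr_ge_zero[of 2 "n * R1"] by simp
  qed (rule less_imp_le[OF marg_prod_pos(2)] seq_marg_total(2))+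
  also have "?P D2 \<le> 2 powr (- \<gamma>)"
  proof (rule sum_le_powr_by_fibres[where g=fst and m="\<lambda>a. \<Prod>k<n. marg1 p (a k)", OF finDs(2) finite_seqs])
    show "fst ` D2 \<subseteq> seqs n" using enc(3) unfolding D2_def by blast
    show "seq_prob p n x \<le> 2 powr (- (n * R2 + 2 + \<gamma>)) * (\<Prod>k<n. marg1 p (fst x k))" if "x \<in> D2" for x
      using that by (auto simp: seq_density_eq(2) D2_def t2_def intro!: mult_right_mono less_imp_le[OF marg_prod_pos(1)])
    fix a
    have "card {x\<in>D2. fst x = a} \<le> card {1..msg_size n R2}"
    proof (rule card_inj_on_le[where f="f2 \<circ> snd"])
      show "inj_on (f2 \<circ> snd) {x\<in>D2. fst x = a}" by (rule inj_onI, rule inj) (auto simp: D2_def)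
    qed (use enc(1,2) in \<open>auto simp: D2_def\<close>)
    then show "real (card {x\<in>D2. fst x = a}) \<le> 4 * 2 powr (n * R2)"
      using msg_size_le[OF R(2), of n] powr_ge_zero[of 2 "n * R2"] by simp
  qed (rule less_imp_le[OF marg_prod_pos(1)] seq_marg_total(1))+
  also have "?P D3 \<le> 2 powr (- \<gamma>)"
  \<comment> \<open>The joint law needs no conditioning, so \<open>D3\<close> is a single fibre over
    the unit type; two rounded message counts produce the full factor 4.\<close>
  proof (rule sum_le_powr_by_fibres[where g="\<lambda>_. ()" and K="{()}" and m="\<lambda>_. 1", OF finDs(3)])
    show "seq_prob p n x \<le> 2 powr (- (n * (R1 + R2) + 2 + \<gamma>)) * 1" if "x \<in> D3" for x
      using that by (auto simp: seq_density_eq(3) D3_def t3_def)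
    have "card D3 \<le> card ({1..msg_size n R1} \<times> {1..msg_size n R2})"
    proof (rule card_inj_on_le[where f="\<lambda>x. (f1 (fst x), f2 (snd x))"])
      show "inj_on (\<lambda>x. (f1 (fst x), f2 (snd x))) D3" by (rule inj_onI, rule inj) (auto simp: D3_def)
    qed (use enc(1,2) in \<open>auto simp: D3_def\<close>)
    then have "real (card D3) \<le> real (msg_size n R1) * real (msg_size n R2)"
      unfolding of_nat_mult[symmetric] of_nat_le_iff by simp
    also have "\<dots> \<le> (2 * 2 powr (n * R1)) * (2 * 2 powr (n * R2))"
      by (intro mult_mono msg_size_le R) auto
    also have "\<dots> = 4 * 2 powr (n * (R1 + R2))" by (simp add: distrib_left powr_add)
    finally show "real (card {x\<in>D3. () = k}) \<le> 4 * 2 powr (n * (R1 + R2))" for k by simp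
  qed auto
  finally show ?thesis using PD unfolding Typ_def t1_def t2_def t3_def by linarith
qed

end

section \<open>Normal approximation of the source\<close>

text \<open>The iterated average is the expectation over source words of length \<open>n\<close>.
  The induction unfolds the innermost step, so the new letter is the one at position
  \<open>n\<close>.\<close>

lemma step_op_pow_seqs:
  fixes p :: "'a::finite \<times> 'b::finite \<Rightarrow> real" and d :: "'a \<times> 'b \<Rightarrow> real^'m::finite"
  shows "(step_op p d ^^ n) f v = (\<Sum>x\<in>seq_pairs n. seq_prob p n x * f (v + (\<Sum>k<n. d (fst x k, snd x k))))"
proof (induction n arbitrary: f)
  case 0
  then show ?case by (simp add: seq_pairs_def seqs_def seq_prob_def)
next
  case (Suc n)
  have pairs: "(\<Sum>x\<in>seq_pairs m. F x) = (\<Sum>x1\<in>seqs m. \<Sum>x2\<in>seqs m. F (x1, x2))" for F :: "(nat \<Rightarrow> 'a) \<times> (nat \<Rightarrow> 'b) \<Rightarrow> real" and m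
    by (simp add: seq_pairs_def sum.cartesian_product)
  have c: "(\<Sum>c\<in>UNIV. F c) = (\<Sum>a\<in>UNIV. \<Sum>b\<in>UNIV. F (a, b))" for F :: "'a \<times> 'b \<Rightarrow> real"
    by (simp add: sum.cartesian_product)
  let ?S = "\<lambda>x1 x2. v + (\<Sum>k<n. d (x1 k, x2 k))"
  have "(step_op p d ^^ Suc n) f v = (step_op p d ^^ n) (step_op p d f) v"
    by (simp add: funpow_Suc_right del: funpow.simps)
  also have "\<dots> = (\<Sum>x1\<in>seqs n. \<Sum>x2\<in>seqs n. \<Sum>a\<in>UNIV. \<Sum>b\<in>UNIV.
        seq_prob p n (x1, x2) * p (a, b) * f (?S x1 x2 + d (a, b)))"
    unfolding Suc pairs by (simp add: step_op_def c sum_distrib_left mult.assoc)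
  also have "\<dots> = (\<Sum>x1\<in>seqs n. \<Sum>a\<in>UNIV. \<Sum>x2\<in>seqs n. \<Sum>b\<in>UNIV.
        seq_prob p n (x1, x2) * p (a, b) * f (?S x1 x2 + d (a, b)))"
    by (rule sum.cong[OF refl], rule sum.swap)
  also have "\<dots> = (\<Sum>x1\<in>seqs n. \<Sum>a\<in>UNIV. \<Sum>x2\<in>seqs n. \<Sum>b\<in>UNIV.
        seq_prob p (Suc n) (x1(n := a), x2(n := b)) * f (v + (\<Sum>k<Suc n. d ((x1(n := a)) k, (x2(n := b)) k))))"
  proof -
    have sp: "seq_prob p (Suc n) (x1(n := a), x2(n := b)) = seq_prob p n (x1, x2) * p (a, b)" for x1 x2 a b
      by (simp add: seq_prob_def)
    have ss: "(\<Sum>k<Suc n. d ((x1(n := a)) k, (x2(n := b)) k)) = (\<Sum>k<n. d (x1 k, x2 k)) + d (a, b)" for x1 x2 a b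
      by simp
    show ?thesis unfolding sp ss by (simp only: add.assoc)
  qed
  also have "\<dots> = (\<Sum>x\<in>seq_pairs (Suc n). seq_prob p (Suc n) x * f (v + (\<Sum>k<Suc n. d (fst x k, snd x k))))"
    unfolding pairs sum_seqs_Suc by simp
  finally show ?case .
qed

lemma gauss_cdf_eq_gauss_prob:
  "gauss_cdf V z = gauss_prob (SOME A :: real^3^3. A ** transpose A = V) z"
proof -
  define A where "A = (SOME A :: real^3^3. A ** transpose A = V)"
  have "gauss_prob A z = measure (PiM UNIV (\<lambda>_. N1))
      ((\<lambda>w. \<chi> i. w i) -` {w. A *v w \<in> orthant z} \<inter> space (PiM UNIV (\<lambda>_. N1)))"
    unfolding gauss_prob_def std_gauss_def by (rule measure_distr) auto
  also have "(\<lambda>w. \<chi> i. w i) -` {w. A *v w \<in> orthant z} \<inter> space (PiM UNIV (\<lambda>_. N1))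
     = {w \<in> space (PiM UNIV (\<lambda>_. N1)). \<forall>i. (A *v (\<chi> j. w j)) $ i \<le> z $ i}"
    by (auto simp: orthant_def)
  finally show ?thesis unfolding gauss_cdf_def Let_def A_def by simp
qed

lemma kappa_nonneg: "kappa p \<ge> 0"
proof -
  have "0 \<le> spec_norm (hessian H_cond1 p)"
    unfolding spec_norm_def by (rule onorm_matrix_nonneg)
  also have "\<dots> \<le> kappa p" unfolding kappa_def by (rule Max_ge) auto
  finally show ?thesis .
qed

lemma nu_ge: "nu (p :: 'a::finite \<times> 'b::finite \<Rightarrow> real) \<ge> 3/2"
  using kappa_nonneg[of p] by (simp add: nu_def)

locale dependent_source = positive_source p for p :: "'a::finite \<times> 'b::finite \<Rightarrow> real" +
  assumes dep: "\<not> independent_pmf p"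
begin

abbreviation dev :: "'a \<times> 'b \<Rightarrow> real^3" where "dev x \<equiv> ent_density p x - ent_vec p"

lemma disp_mat_gram: "disp_mat p = (\<chi> i j. \<Sum>x\<in>UNIV. p x * dev x $ i * dev x $ j)"
  by (simp add: disp_mat_def)

lemma dev_mean: "(\<Sum>x\<in>UNIV. p x *\<^sub>R dev x) = 0"
  by (simp add: scaleR_diff_right sum_subtractf ent_vec_def total flip: scaleR_sum_left)

text \<open>A constant first entry makes \<open>p\<close> a constant multiple of the second
  marginal, and summation identifies the constant with the first marginal. The second entry is
  symmetric, and a constant third entry makes \<open>p\<close> uniform. Each case is a product
  law.\<close>

lemma ent_density_nonconst: "\<exists>x. dev x $ i \<noteq> 0"
proof (rule ccontr)
  assume neg: "\<not> (\<exists>x. dev x $ i \<noteq> 0)"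
  have const: "ent_density p x $ i = ent_vec p $ i" for x
  proof -
    have "dev x $ i = 0" using neg by blast
    then show ?thesis by simp
  qed
  define k where "k = 2 powr (- (ent_vec p $ i))"
  have sum1: "marg1 p a = (\<Sum>b\<in>UNIV. p (a, b))" for a by (simp add: marg1_def)
  have sum2: "marg2 p b = (\<Sum>a\<in>UNIV. p (a, b))" for b by (simp add: marg2_def)
  have "i = 1 \<or> i = 2 \<or> i = 3" using exhaust_3 by blast
  then have "p (a, b) = marg1 p a * marg2 p b" for a b
  proof (elim disjE)
    assume i: "i = 1"
    have "p x / marg2 p (snd x) = k" for x
      unfolding k_def const[symmetric, of x] using pos[of x] marg_pos by (simp add: i ent_density_def)
    then have eq: "p (a, b) = k * marg2 p b" for a b
      using marg_pos(2)[of b] by (metis nonzero_divide_eq_eq snd_conv less_numeral_extra(3))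
    have "marg1 p a = k" unfolding sum1 eq using sum_marg(2) by (simp flip: sum_distrib_left)
    then show ?thesis using eq by simp
  next
    assume i: "i = 2"
    have "p x / marg1 p (fst x) = k" for x
      unfolding k_def const[symmetric, of x] using pos[of x] marg_pos by (simp add: i ent_density_def)
    then have eq: "p (a, b) = k * marg1 p a" for a b
      using marg_pos(1)[of a] by (metis nonzero_divide_eq_eq fst_conv less_numeral_extra(3))
    have "marg2 p b = k" unfolding sum2 eq using sum_marg(1) by (simp flip: sum_distrib_left)
    then show ?thesis using eq by (simp add: mult.commute)
  next
    assume i: "i = 3"
    have eq: "p x = k" for x
      unfolding k_def const[symmetric, of x] using pos[of x] by (simp add: i ent_density_def)
    have "real CARD('a) * (real CARD('b) * k) = 1" using sum_marg(1) by (simp add: sum1 eq)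
    moreover have "marg1 p a * marg2 p b = (real CARD('a) * (real CARD('b) * k)) * k" by (simp add: sum1 sum2 eq)
    ultimately show ?thesis by (simp add: eq)
  qed
  then show False using dep by (simp add: independent_pmf_def)
qed

lemma disp_mat_diag_pos: "disp_mat p $ i $ i > 0"
proof -
  obtain x where x: "dev x $ i \<noteq> 0" using ent_density_nonconst by blast
  have "0 < (\<Sum>x\<in>UNIV. p x * (dev x $ i * dev x $ i))"
  proof (rule sum_pos2)
    have "0 < dev x $ i * dev x $ i" using not_real_square_gt_zero[of "dev x $ i"] x by blast
    then show "0 < p x * (dev x $ i * dev x $ i)" by (rule mult_pos_pos[OF pos])
  qed (auto intro!: mult_nonneg_nonneg[OF less_imp_le[OF pos]])
  then show ?thesis by (simp add: disp_mat_gram mult.assoc)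
qed

text \<open>Achievability demands nonnegative rates; in the inner region these come from positive
  entropies once \<open>n\<close> is large. A vanishing entropy would force a density that is zero
  everywhere, hence constant.\<close>

lemma ent_vec_pos: "ent_vec p $ i > 0"
proof -
  have le1: "p x \<le> marg1 p (fst x)" for x
  proof -
    have "p (fst x, snd x) \<le> (\<Sum>b\<in>UNIV. p (fst x, b))"
      by (rule member_le_sum[of "snd x" _ "\<lambda>b. p (fst x, b)"]) (auto intro: less_imp_le pos)
    then show ?thesis by (simp add: marg1_def)
  qed
  have le2: "p x \<le> marg2 p (snd x)" for x
  proof -
    have "p (fst x, snd x) \<le> (\<Sum>a\<in>UNIV. p (a, snd x))"
      by (rule member_le_sum[of "fst x" _ "\<lambda>a. p (a, snd x)"]) (auto intro: less_imp_le pos)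
    then show ?thesis by (simp add: marg2_def)
  qed
  have le3: "p x \<le> 1" for x
    using member_le_sum[of x UNIV p] total less_imp_le[OF pos] by simp
  have h0: "ent_density p x $ i \<ge> 0" for x
    using exhaust_3[of i] le3[of x] le1[of x] le2[of x] pos[of x] marg_pos(1)[of "fst x"] marg_pos(2)[of "snd x"]
    by (auto simp: ent_density_def)
  have "0 \<le> ent_vec p $ i"
    unfolding ent_vec_def by (auto intro!: sum_nonneg mult_nonneg_nonneg h0 less_imp_le[OF pos])
  moreover have "ent_vec p $ i \<noteq> 0"
  proof
    assume 0: "ent_vec p $ i = 0"
    then have "(\<Sum>x\<in>UNIV. p x * ent_density p x $ i) = 0" by (simp add: ent_vec_def)
    then have "\<forall>x\<in>UNIV. p x * ent_density p x $ i = 0"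
      by (subst (asm) sum_nonneg_eq_0_iff) (auto intro!: mult_nonneg_nonneg h0 less_imp_le[OF pos])
    then have "ent_density p x $ i = 0" for x using pos[of x] by (metis UNIV_I mult_eq_0_iff less_numeral_extra(3))
    then show False using ent_density_nonconst[of i] 0 by simp
  qed
  ultimately show ?thesis by simp
qed

text \<open>Literally the root picked inside \<open>gauss_cdf\<close>, so that \<open>S_set\<close>
  and the normal approximation speak of one and the same matrix.\<close>

definition disp_root :: "real^3^3" where
  "disp_root = (SOME A. A ** transpose A = disp_mat p)"

lemma disp_root: "disp_root ** transpose disp_root = disp_mat p"
proof -
  have "\<exists>A :: real^3^3. A ** transpose A = disp_mat p"
    unfolding disp_mat_gram by (rule gram_square_root) (rule less_imp_le[OF pos])
  then show ?thesis unfolding disp_root_def by (rule someI_ex)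
qed

lemma disp_root_rows: "\<exists>j. disp_root $ i $ j \<noteq> 0"
proof (rule ccontr)
  assume "\<not> ?thesis"
  then have "(disp_root ** transpose disp_root) $ i $ i = 0" by (simp add: matrix_matrix_mult_def)
  then show False using disp_mat_diag_pos[of i] by (simp add: disp_root)
qed

abbreviation lim_cdf :: "real^3 \<Rightarrow> real" where "lim_cdf \<equiv> gauss_prob disp_root"

lemma S_set_iff: "z \<in> S_set (disp_mat p) \<epsilon> \<longleftrightarrow> lim_cdf z \<ge> 1 - \<epsilon>"
  by (simp add: S_set_def gauss_cdf_eq_gauss_prob disp_root_def)

definition seq_cdf :: "nat \<Rightarrow> real^3 \<Rightarrow> real" where
  "seq_cdf n t = (\<Sum>x\<in>{x\<in>seq_pairs n. seq_density p n x \<in> orthant t}. seq_prob p n x)"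

lemma seq_cdf_eq_step_op: "seq_cdf n t = (step_op p dev ^^ n) (indicator (orthant (t - real n *\<^sub>R ent_vec p))) 0"
proof -
  have "0 + (\<Sum>k<n. dev (fst x k, snd x k)) = seq_density p n x - real n *\<^sub>R ent_vec p" for x
    by (simp add: seq_density_def sum_subtractf sum_constant_scaleR del: sum_constant)
  then have "(step_op p dev ^^ n) (indicator (orthant (t - real n *\<^sub>R ent_vec p))) 0
      = (\<Sum>x\<in>seq_pairs n. seq_prob p n x * indicator (orthant (t - real n *\<^sub>R ent_vec p)) (seq_density p n x - real n *\<^sub>R ent_vec p))"
    by (simp only: step_op_pow_seqs)
  also have "\<dots> = seq_cdf n t"
    unfolding seq_cdf_def
    by (rule sum.mono_neutral_cong_right) (auto simp: finite_seq_pairs orthant_def indicator_def)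
  finally show ?thesis ..
qed

lemma seq_cdf_berry_esseen:
  "\<exists>B\<ge>0. \<forall>n\<ge>1. \<forall>t. \<bar>seq_cdf n t - lim_cdf ((1 / sqrt n) *\<^sub>R (t - real n *\<^sub>R ent_vec p))\<bar> \<le> B / sqrt n"
proof -
  obtain r :: "('a \<times> 'b) \<times> 3 \<times> bool \<Rightarrow> real" and u where
    lift: "\<forall>f x. step_op p dev f x = (\<Sum>e\<in>UNIV. r e * f (x + disp_root *v u e))"
    and r: "\<forall>e. r e \<ge> 0" "(\<Sum>e\<in>UNIV. r e) = 1"
    and mom: "\<forall>k. (\<Sum>e\<in>UNIV. r e * u e $ k) = 0"
       "\<forall>k l. (\<Sum>e\<in>UNIV. r e * (u e $ k * u e $ l)) = (if k = l then 1 else 0)"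
    using covariance_lift[OF pos total dev_mean disp_root[unfolded disp_mat_gram]] by (elim exE conjE) (rule that)
  obtain C where C: "C \<ge> 0" "\<forall>j>0. \<forall>K f x. bdd_borel K f \<longrightarrow>
     \<bar>step_op p dev (gauss_op disp_root j f) x - gauss_op disp_root (j + 1) f x\<bar> \<le> C * K / (j * sqrt j)"
    using step_gauss_swap[OF lift[rule_format] r(1)[rule_format] r(2) mom[rule_format]] by blast
  interpret lindeberg_swap p dev disp_root C
    using C by unfold_locales (auto simp: total disp_root_rows intro: less_imp_le[OF pos])
  obtain B where "B \<ge> 0" and B: "\<And>n z. \<bar>(step_op p dev ^^ n) (orth z) 0 - gauss_op disp_root (real n) (orth z) 0\<bar> \<le> B / sqrt n"
    using berry_esseen_orthants by blast
  moreover have "\<bar>seq_cdf n t - lim_cdf ((1 / sqrt n) *\<^sub>R (t - real n *\<^sub>R ent_vec p))\<bar> \<le> B / sqrt n" if "n \<ge> 1" for n t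
    using B[of n "t - real n *\<^sub>R ent_vec p"] that unfolding seq_cdf_eq_step_op by (simp add: gauss_op_orthant)
  ultimately show ?thesis by blast
qed

section \<open>Slack accounting and the two inclusions\<close>

lemma S_set_bounded_below:
  assumes "\<epsilon> < 1"
  shows "\<exists>a\<ge>0. \<forall>z i. lim_cdf z \<ge> 1 - \<epsilon> \<longrightarrow> - a \<le> z $ i"
proof -
  obtain R where R: "R > 0" "measure std_gauss {w :: real^3. norm w \<le> R} \<ge> 1 - (1 - \<epsilon>) / 2"
    using gauss_tight[of "(1 - \<epsilon>) / 2"] assms by auto
  define a where "a = onorm ((*v) disp_root) * R"
  have "a \<ge> 0" using R onorm_matrix_nonneg[of disp_root] by (simp add: a_def)
  moreover have "- a \<le> z $ i" if z: "lim_cdf z \<ge> 1 - \<epsilon>" for z i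
  proof (rule ccontr)
    assume "\<not> ?thesis"
    then have zi: "z $ i < - a" by simp
    have "{w. disp_root *v w \<in> orthant z} \<subseteq> space std_gauss - {w. norm w \<le> R}"
    proof clarsimp
      fix w assume w: "disp_root *v w \<in> orthant z" "norm w \<le> R"
      have "\<bar>(disp_root *v w) $ i\<bar> \<le> onorm ((*v) disp_root) * norm w" by (rule matrix_component_le)
      also have "\<dots> \<le> a" unfolding a_def using w onorm_matrix_nonneg by (intro mult_left_mono) auto
      finally have "\<bar>(disp_root *v w) $ i\<bar> \<le> a" .
      moreover have "(disp_root *v w) $ i \<le> z $ i" using w by (simp add: orthant_def)
      ultimately show False using zi by linarith
    qed
    then have "lim_cdf z \<le> measure std_gauss (space std_gauss - {w :: real^3. norm w \<le> R})"
      unfolding gauss_prob_def by (intro gauss.finite_measure_mono) auto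
    also have "\<dots> = 1 - measure std_gauss {w :: real^3. norm w \<le> R}" by (rule gauss.prob_compl) auto
    finally show False using R(2) z assms by argo
  qed
  ultimately show ?thesis by blast
qed

lemma rate_regions:
  assumes \<epsilon>: "0 < \<epsilon>" "\<epsilon> < 1"
  shows "\<exists>N. \<forall>n\<ge>N. R_in p n \<epsilon> \<subseteq> SW_region p n \<epsilon> \<and> SW_region p n \<epsilon> \<subseteq> R_out p n \<epsilon>"
proof -
  obtain B where B0: "B \<ge> 0" and B: "\<And>n t. n \<ge> 1 \<Longrightarrow> \<bar>seq_cdf n t - lim_cdf ((1 / sqrt n) *\<^sub>R (t - real n *\<^sub>R ent_vec p))\<bar> \<le> B / sqrt n"
    using seq_cdf_berry_esseen by blast
  \<comment> \<open>The window contains \<open>1 - \<epsilon>\<close> in its interior. Above it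
    there is room to spare, and below it the outer inclusion never gets for large
    \<open>n\<close>.\<close>
  obtain c where c0: "c > 0" and c: "\<And>z \<delta>. 0 \<le> \<delta> \<Longrightarrow> \<delta> \<le> 1 \<Longrightarrow> (1 - \<epsilon>) / 2 \<le> lim_cdf z \<Longrightarrow> lim_cdf z \<le> 1 - \<epsilon> / 2 \<Longrightarrow>
     lim_cdf z + c * \<delta> \<le> lim_cdf (z + \<delta> *\<^sub>R vec 1)"
    using gauss_prob_increment[OF disp_root_rows, of "(1 - \<epsilon>) / 2" "1 - \<epsilon> / 2"] \<epsilon> by auto
  \<comment> \<open>Uniform over all admissible \<open>z\<close>: divided by \<open>sqrt n\<close>
    this lower bound is outweighed by the entropies.\<close>
  obtain a where a0: "a \<ge> 0" and a: "\<And>z i. lim_cdf z \<ge> 1 - \<epsilon> \<Longrightarrow> - a \<le> z $ i"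
    using S_set_bounded_below[OF \<epsilon>(2)] by blast
  \<comment> \<open>A threshold shift of \<open>L / sqrt n\<close> gains
    \<open>(B + 3) / sqrt n\<close>: \<open>B\<close> for the normal approximation and 3 for the
    coding terms.\<close>
  define L where "L = (B + 3) / c"
  have L0: "L > 0" using B0 c0 by (simp add: L_def)
  have cL: "c * L = B + 3" using c0 by (simp add: L_def)
  \<comment> \<open>A lower bound for \<open>sqrt n\<close> that meets every size requirement: shift
    at most 1, errors at most half of \<open>1 - \<epsilon>\<close> and of
    \<open>\<epsilon>\<close>, nonnegative rates.\<close>
  define Q where "Q = L + 2 * (B + 3) / (1 - \<epsilon>) + 2 * (B + 3) / \<epsilon> + a / ent_vec p $ 1 + a / ent_vec p $ 2"
  \<comment> \<open>The second summand gives \<open>2 * L + 4 \<le> l\<close>, which fits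
    \<open>2 + l / 2 + L\<close> into \<open>l\<close> in the outer bound.\<close>
  define N where "N = nat \<lceil>Q\<^sup>2\<rceil> + nat \<lceil>2 powr (2 * L + 4)\<rceil> + 1"
  have parts: "0 \<le> 2 * (B + 3) / (1 - \<epsilon>)" "0 \<le> 2 * (B + 3) / \<epsilon>" "0 \<le> a / ent_vec p $ 1" "0 \<le> a / ent_vec p $ 2"
    using B0 \<epsilon> a0 less_imp_le[OF ent_vec_pos] by auto
  have "R_in p n \<epsilon> \<subseteq> SW_region p n \<epsilon> \<and> SW_region p n \<epsilon> \<subseteq> R_out p n \<epsilon>" if nN: "n \<ge> N" for n
  proof -
    have n1: "n \<ge> 1" using nN by (simp add: N_def)
    define s where "s = sqrt (real n)"
    define l where "l = log 2 (real n)"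
    have s0: "s > 0" using n1 by (simp add: s_def)
    have ss: "s * s = real n" by (simp add: s_def)
    have "Q\<^sup>2 \<le> real (nat \<lceil>Q\<^sup>2\<rceil>)" by (rule real_nat_ceiling_ge)
    also have "\<dots> \<le> real n" using nN unfolding N_def by linarith
    finally have Qs: "Q \<le> s" unfolding s_def by (rule real_le_rsqrt)
    have sL: "L \<le> s" and s\<epsilon>1: "2 * (B + 3) / (1 - \<epsilon>) \<le> s" and s\<epsilon>: "2 * (B + 3) / \<epsilon> \<le> s"
      and sH: "a / ent_vec p $ 1 \<le> s" "a / ent_vec p $ 2 \<le> s"
      using Qs parts L0 unfolding Q_def by linarith+
    have "2 powr (2 * L + 4) \<le> real (nat \<lceil>2 powr (2 * L + 4)\<rceil>)" by (rule real_nat_ceiling_ge)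
    also have "\<dots> \<le> real n" using nN unfolding N_def by linarith
    finally have lL: "2 * L + 4 \<le> l" unfolding l_def using n1 by (simp add: le_log_iff)
    \<comment> \<open>With slack \<open>l / 2\<close> the coding error has the same order as the
      Berry--Esseen error.\<close>
    have half: "2 powr (- (l / 2)) = 1 / s"
    proof -
      have "2 powr (l / 2) = (2 powr l) powr (1 / 2)" by (simp add: powr_powr)
      also have "2 powr l = real n" using n1 by (simp add: l_def)
      also have "real n powr (1 / 2) = s" using n1 by (simp add: s_def powr_half_sqrt)
      finally show ?thesis by (simp add: powr_minus field_simps)
    qed
    define \<delta> where "\<delta> = L / s"
    have \<delta>: "0 \<le> \<delta>" "\<delta> \<le> 1" using sL s0 L0 by (auto simp: \<delta>_def)
    have c\<delta>: "c * \<delta> = (B + 3) / s" by (simp add: \<delta>_def cL[symmetric])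
    have small1: "(B + 3) / s \<le> (1 - \<epsilon>) / 2" using s\<epsilon>1 s0 \<epsilon> by (simp add: field_simps)
    have small2: "(B + 3) / s \<le> \<epsilon> / 2" using s\<epsilon> s0 \<epsilon> by (simp add: field_simps)
    have rate: "rate_vec R1 R2 $ 1 = R1" "rate_vec R1 R2 $ 2 = R2" "rate_vec R1 R2 $ 3 = R1 + R2" for R1 R2
      by (simp_all add: rate_vec_def)
    have "R_in p n \<epsilon> \<subseteq> SW_region p n \<epsilon>"
    proof
      fix R assume "R \<in> R_in p n \<epsilon>"
      then obtain R1 R2 z where R: "R = (R1, R2)" and z: "lim_cdf z \<ge> 1 - \<epsilon>"
        and rv: "rate_vec R1 R2 = ent_vec p + (1 / s) *\<^sub>R z + (nu p * l / real n) *\<^sub>R vec 1"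
        unfolding R_in_def s_def l_def by (auto simp: S_set_iff)
      have rvi: "rate_vec R1 R2 $ i = ent_vec p $ i + z $ i / s + nu p * l / real n" for i
        unfolding rv by simp
      have l0: "l \<ge> 0" using lL L0 by linarith
      have nul: "nu p * l / real n \<ge> 0" using nu_ge[of p] l0 by auto
      have rpos: "0 \<le> rate_vec R1 R2 $ i" if "a / ent_vec p $ i \<le> s" for i
      proof -
        have "a / s \<le> ent_vec p $ i" using that s0 ent_vec_pos[of i] by (simp add: field_simps)
        moreover have "- a / s \<le> z $ i / s" using a[OF z, of i] s0 by (intro divide_right_mono) auto
        ultimately show ?thesis unfolding rvi using nul by simp
      qed
      have R12: "R1 \<ge> 0" "R2 \<ge> 0" using rpos[OF sH(1)] rpos[OF sH(2)] rate by simp_all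
      define t :: "real^3" where "t = real n *\<^sub>R rate_vec R1 R2 - (l / 2) *\<^sub>R vec 1"
      define Typ where "Typ = {x\<in>seq_pairs n. seq_density p n x $ 1 \<le> n * R1 - l / 2 \<and> seq_density p n x $ 2 \<le> n * R2 - l / 2
        \<and> seq_density p n x $ 3 \<le> n * (R1 + R2) - l / 2}"
      obtain f1 f2 \<phi> where code: "\<forall>x\<in>seqs n. f1 x \<in> {1..msg_size n R1}" "\<forall>x\<in>seqs n. f2 x \<in> {1..msg_size n R2}"
          "\<forall>m1 m2. \<phi> m1 m2 \<in> seqs n \<times> seqs n"
        and err: "sw_error p n f1 f2 \<phi> \<le> (\<Sum>x\<in>seq_pairs n - Typ. seq_prob p n x) + 3 * 2 powr (- (l / 2))"
        using random_binning[of n R1 R2 "l / 2"] unfolding Typ_def by blast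
      have Typ_eq: "Typ = {x\<in>seq_pairs n. seq_density p n x \<in> orthant t}"
        unfolding Typ_def orthant_def t_def by (auto simp: forall_3 rate)
      have "(\<Sum>x\<in>seq_pairs n - Typ. seq_prob p n x) = 1 - seq_cdf n t"
      proof -
        have "Typ \<subseteq> seq_pairs n" by (auto simp: Typ_def)
        from sum.subset_diff[OF this finite_seq_pairs, of "seq_prob p n"] show ?thesis
          by (simp add: seq_prob_total seq_cdf_def Typ_eq)
      qed
      moreover have "seq_cdf n t \<ge> lim_cdf (z + \<delta> *\<^sub>R vec 1) - B / s"
      proof -
        have "lim_cdf (z + \<delta> *\<^sub>R vec 1) \<le> lim_cdf ((1 / s) *\<^sub>R (t - real n *\<^sub>R ent_vec p))"
        proof (rule gauss_prob_mono)
          fix i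
          have "((1 / s) *\<^sub>R (t - real n *\<^sub>R ent_vec p)) $ i = (real n * (z $ i / s) + nu p * l - l / 2) / s"
          proof -
            have "(t - real n *\<^sub>R ent_vec p) $ i = real n * (z $ i / s) + nu p * l - l / 2"
              unfolding t_def using n1 by (simp add: rvi distrib_left)
            then show ?thesis by simp
          qed
          also have "\<dots> = z $ i + (nu p - 1 / 2) * l / s"
            unfolding ss[symmetric] using s0 by (simp add: field_simps)
          also have "\<dots> \<ge> z $ i + \<delta>"
          proof -
            \<comment> \<open>Of the \<open>nu p * l\<close> allowed by the region,
              \<open>l / 2\<close> went into the binning slack; as \<open>nu p \<ge> 3/2\<close>, at
              least \<open>l\<close> remains, and it exceeds \<open>L\<close>.\<close>
            have "L \<le> 1 * l" using lL L0 by simp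
            also have "\<dots> \<le> (nu p - 1 / 2) * l" using nu_ge[of p] l0 by (intro mult_right_mono) auto
            finally show ?thesis unfolding \<delta>_def using s0 by (simp add: divide_right_mono)
          qed
          finally show "(z + \<delta> *\<^sub>R vec 1) $ i \<le> ((1 / s) *\<^sub>R (t - real n *\<^sub>R ent_vec p)) $ i" by simp
        qed
        then show ?thesis using B[OF n1, of t] unfolding s_def[symmetric] by linarith
      qed
      \<comment> \<open>Above the window the increment bound does not apply, but there monotonicity
        suffices: the excess \<open>\<epsilon> / 2\<close> covers
        \<open>(B + 3) / s\<close>.\<close>
      moreover have "lim_cdf (z + \<delta> *\<^sub>R vec 1) \<ge> 1 - \<epsilon> + (B + 3) / s"
      proof (cases "lim_cdf z \<le> 1 - \<epsilon> / 2")
        case True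
        have "(1 - \<epsilon>) / 2 \<le> 1 - \<epsilon>" using \<epsilon> by simp
        from order_trans[OF this z] have "(1 - \<epsilon>) / 2 \<le> lim_cdf z" .
        from c[OF \<delta> this True] show ?thesis using z c\<delta> by linarith
      next
        case False
        have "lim_cdf z \<le> lim_cdf (z + \<delta> *\<^sub>R vec 1)" by (rule gauss_prob_mono) (simp add: \<delta>)
        then show ?thesis using False small2 by linarith
      qed
      ultimately have "sw_error p n f1 f2 \<phi> \<le> \<epsilon>"
        using err unfolding half by (simp add: add_divide_distrib)
      then have "sw_achievable p n \<epsilon> R1 R2" unfolding sw_achievable_def using R12 code by blast
      then show "R \<in> SW_region p n \<epsilon>" by (simp add: SW_region_def R)
    qed
    moreover have "SW_region p n \<epsilon> \<subseteq> R_out p n \<epsilon>"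
    proof
      fix R assume "R \<in> SW_region p n \<epsilon>"
      then obtain R1 R2 where R: "R = (R1, R2)" and ach: "sw_achievable p n \<epsilon> R1 R2"
        unfolding SW_region_def by auto
      define t :: "real^3" where "t = real n *\<^sub>R rate_vec R1 R2 + (2 + l / 2) *\<^sub>R vec 1"
      define y where "y = (1 / s) *\<^sub>R (t - real n *\<^sub>R ent_vec p)"
      \<comment> \<open>The defining equation of the outer region solved for \<open>z\<close>;
        membership becomes a statement about \<open>lim_cdf z\<close> alone.\<close>
      define z where "z = s *\<^sub>R (rate_vec R1 R2 - ent_vec p) + (l / s) *\<^sub>R vec 1"
      have "{x\<in>seq_pairs n. seq_density p n x $ 1 \<le> n * R1 + 2 + l / 2 \<and> seq_density p n x $ 2 \<le> n * R2 + 2 + l / 2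
        \<and> seq_density p n x $ 3 \<le> n * (R1 + R2) + 2 + l / 2} = {x\<in>seq_pairs n. seq_density p n x \<in> orthant t}"
        unfolding orthant_def t_def by (auto simp: forall_3 rate add.assoc)
      then have "1 - \<epsilon> \<le> seq_cdf n t + 3 / s"
        using converse_bound[OF ach, of "l / 2"] unfolding half seq_cdf_def by simp
      then have cy: "lim_cdf y \<ge> 1 - \<epsilon> - (B + 3) / s"
        using B[OF n1, of t] unfolding s_def[symmetric] y_def by (simp add: add_divide_distrib)
      have yz: "lim_cdf (y + \<delta> *\<^sub>R vec 1) \<le> lim_cdf z"
      proof (rule gauss_prob_mono)
        fix i
        have "y $ i = (real n * (rate_vec R1 R2 $ i - ent_vec p $ i)) / s + (2 + l / 2) / s"
          unfolding y_def t_def by (simp add: algebra_simps add_divide_distrib diff_divide_distrib)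
        also have "(real n * (rate_vec R1 R2 $ i - ent_vec p $ i)) / s = s * (rate_vec R1 R2 $ i - ent_vec p $ i)"
          unfolding ss[symmetric] using s0 by simp
        finally have yi: "y $ i = s * (rate_vec R1 R2 $ i - ent_vec p $ i) + (2 + l / 2) / s" .
        have "(2 + l / 2) / s + L / s \<le> l / s"
          unfolding add_divide_distrib[symmetric] using lL s0 by (intro divide_right_mono) auto
        then show "(y + \<delta> *\<^sub>R vec 1) $ i \<le> z $ i" by (simp add: yi z_def \<delta>_def)
      qed
      have "lim_cdf z \<ge> 1 - \<epsilon>"
      proof (cases "lim_cdf y \<ge> 1 - \<epsilon>")
        case True
        have "lim_cdf y \<le> lim_cdf (y + \<delta> *\<^sub>R vec 1)" by (rule gauss_prob_mono) (simp add: \<delta>)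
        then show ?thesis using True yz by linarith
      next
        case False
        \<comment> \<open>The converse loses at most \<open>(1 - \<epsilon>) / 2\<close>, so
          \<open>lim_cdf y\<close> cannot fall below the window of the increment bound.\<close>
        have "(1 - \<epsilon>) - (1 - \<epsilon>) / 2 \<le> lim_cdf y" using cy small1 by argo
        moreover have "(1 - \<epsilon>) - (1 - \<epsilon>) / 2 = (1 - \<epsilon>) / 2" by (simp add: field_simps)
        moreover have "1 - \<epsilon> \<le> 1 - \<epsilon> / 2" using \<epsilon> by simp
        ultimately have "(1 - \<epsilon>) / 2 \<le> lim_cdf y" "lim_cdf y \<le> 1 - \<epsilon> / 2" using False by argo+
        from c[OF \<delta> this] show ?thesis using cy c\<delta> yz by linarith
      qed
      moreover have "rate_vec R1 R2 = ent_vec p + (1 / s) *\<^sub>R z - (l / real n) *\<^sub>R vec 1"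
        unfolding z_def ss[symmetric] using s0 by (simp add: scaleR_add_right)
      ultimately show "R \<in> R_out p n \<epsilon>"
        unfolding R_out_def R s_def l_def by (auto simp: S_set_iff)
    qed
    ultimately show ?thesis ..
  qed
  then show ?thesis by blast
qed

end

theorem theorem1:
  fixes p :: "'a::finite \<times> 'b::finite \<Rightarrow> real" and \<epsilon> :: real
  assumes "\<forall>x. p x > 0"
    and "(\<Sum>x\<in>UNIV. p x) = 1"
    and "\<not> independent_pmf p"
    and "0 < \<epsilon>" and "\<epsilon> < 1"
  shows "\<exists>N. \<forall>n\<ge>N. R_in p n \<epsilon> \<subseteq> SW_region p n \<epsilon> \<and> SW_region p n \<epsilon> \<subseteq> R_out p n \<epsilon>"
proof -
  interpret dependent_source p
    using assms by unfold_locales auto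
  show ?thesis using assms(4,5) by (rule rate_regions)
qed

end
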